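(* Let $m\ge1$ and $d\ge 2$ be integers and let $\varepsilon>0$ be a fixed real number. There exists $\gamma>0$, depending only on $d$, $m$ and $\varepsilon$, such that the following holds. Let $p$ be a prime, let $S$ be a matrix as in the context with $s_{0,1}s_{1,2}\cdots s_{m-1,m}\ne0$, let $\mathcal F=\{F_0,\ldots,F_m\}\in\mathfrak F(S,m)$ be a polynomial system over $\mathbb F_p$ of total degree $d$, and let $\mathbf w_n=(u_{n,0},\ldots,u_{n,m})$, $n\ge0$, be the sequence generated by iterating $\mathcal F$ from an initial vector $\mathbf w_0\in\mathbb F_p^{m+1}$. Assume that $\{\mathbf w_n\}$ is purely periodic with (least) period $\tau$. Then for any positive integer $N$ with $\tau\ge N\ge p^{m+\varepsilon}$, the discrepancy of the sequence $$\left(\frac{u_{n,0}}p,\ldots,\frac{u_{n,m}}p\right),\qquad n=0,\ldots,N-1,$$ satisfies the bound $O(p^{-\gamma})$, where the implied constant depends only on $d$, $m$ and $\varepsilon$.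
   Context: The discrepancy of a sequence $\Gamma$ of $N$ points in $[0,1)^s$ is $$\Delta(\Gamma)=\sup_{B\subseteq[0,1)^s}\left|\frac{T_\Gamma(B)}N-|B|\right|,$$ where the supremum is over all boxes $B=[\alpha_1,\beta_1)\times\cdots\times[\alpha_s,\beta_s)\subseteq[0,1)^s$, $|B|$ is the volume of $B$, and $T_\Gamma(B)$ is the number of points of $\Gamma$ (counted with multiplicity) inside $B$. $\mathbb F_p$ is represented by $\{0,1,\ldots,p-1\}$. $S$ is an integral upper triangular $(m+1)\times(m+1)$ matrix, rows and columns indexed by $0,\ldots,m$, with ones on the diagonal and entries $s_{i,j}$ for $0\le i<j\le m$ (used as exponents, hence non-negative). $\mathfrak F(S,m)$ is the set of all systems $\{F_0,\ldots,F_m\}$ of polynomials in $\mathbb F_p[X_0,\ldots,X_m]$ of the form $$F_i=X_iG_i(X_{i+1},\ldots,X_m)+H_i(X_{i+1},\ldots,X_m)\quad (0\le i\le m-1),\qquad F_m=g_mX_m+h_m,$$ with $g_m,h_m\in\mathbb F_p$, $g_m\ne0$, $G_i,H_i\in\mathbb F_p[X_{i+1},\ldots,X_m]$, where for $0\le i\le m-1$ $$G_i=g_iX_{i+1}^{s_{i,i+1}}\cdots X_m^{s_{i,m}}+\widetilde G_i,\qquad g_i\in\mathbb F_p^*,$$ and $\deg_{X_j}\widetilde G_i<s_{i,j}$, $\deg_{X_j}H_i\le s_{i,j}$ for $j=i+1,\ldots,m$ (the zero polynomial has degree $-\infty$). The sequence generated by iterating $\mathcal F$: $u_{n+1,i}\equiv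 F_i(u_{n,0},\ldots,u_{n,m})\pmod p$ with $0\le u_{n,i}<p$, for $i=0,\ldots,m$, $n\ge0$. Purely periodic with period $\tau$ means $\mathbf w_{n+\tau}=\mathbf w_n$ for all $n\ge0$, with $\tau$ the least such positive integer. *)

theory Defs
  imports
    "HOL-Analysis.Analysis"
    "HOL-Library.Poly_Mapping"
    "HOL-Number_Theory.Cong"
    "Jordan_Normal_Form.Matrix"
begin

text \<open>
  Polynomials in \<open>X 0, X 1, \<dots>\<close> over the integers. A polynomial over the field with \<open>p\<close> elements
  is represented by the integer polynomial whose coefficients are the representatives in
  \<open>{0..<p}\<close>, and identities over that field become coefficientwise congruences modulo \<open>p\<close>.
  No type of residues is used because the prime has to be quantified inside a formula.
\<close>

type_synonym int_mpoly = "(nat \<Rightarrow>\<^sub>0 nat) \<Rightarrow>\<^sub>0 int"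

definition X :: "nat \<Rightarrow> int_mpoly" where
  "X j = Poly_Mapping.single (Poly_Mapping.single j 1) 1"

definition const :: "int \<Rightarrow> int_mpoly" where
  "const c = Poly_Mapping.single 0 c"

definition mpoly_eval :: "int_mpoly \<Rightarrow> (nat \<Rightarrow> int) \<Rightarrow> int" where
  "mpoly_eval P x = (\<Sum>t\<in>Poly_Mapping.keys P.
     Poly_Mapping.lookup P t * (\<Prod>j\<in>Poly_Mapping.keys t. x j ^ Poly_Mapping.lookup t j))"

definition Fp_polys :: "nat \<Rightarrow> nat set \<Rightarrow> int_mpoly set" where
  "Fp_polys p V = {P. (\<forall>t. Poly_Mapping.lookup P t \<in> {0..<int p}) \<and>
                      (\<forall>t\<in>Poly_Mapping.keys P. Poly_Mapping.keys t \<subseteq> V)}"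

definition poly_cong :: "nat \<Rightarrow> int_mpoly \<Rightarrow> int_mpoly \<Rightarrow> bool" where
  "poly_cong p P Q \<longleftrightarrow>
     (\<forall>t. [Poly_Mapping.lookup P t = Poly_Mapping.lookup Q t] (mod int p))"

text \<open>Degrees are extended reals: the supremum over no monomials is \<open>-\<infinity>\<close>. They are the degrees
  over the field with \<open>p\<close> elements only for polynomials with reduced coefficients.\<close>

definition deg_in :: "nat \<Rightarrow> int_mpoly \<Rightarrow> ereal" where
  "deg_in j P = (SUP t\<in>Poly_Mapping.keys P. ereal (real (Poly_Mapping.lookup t j)))"

definition total_deg :: "int_mpoly \<Rightarrow> ereal" where
  "total_deg P = (SUP t\<in>Poly_Mapping.keys P.
     ereal (real (\<Sum>j\<in>Poly_Mapping.keys t. Poly_Mapping.lookup t j)))"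

definition system_deg :: "nat \<Rightarrow> (nat \<Rightarrow> int_mpoly) \<Rightarrow> ereal" where
  "system_deg m F = (SUP i\<in>{..m}. total_deg (F i))"

text \<open>Rows and columns of \<open>S\<close> are indexed by \<open>0, \<dots>, m\<close>.\<close>

definition exponent_matrix :: "nat \<Rightarrow> nat mat \<Rightarrow> bool" where
  "exponent_matrix m S \<longleftrightarrow> S \<in> carrier_mat (Suc m) (Suc m) \<and> upper_triangular S \<and>
     (\<forall>i\<le>m. S $$ (i, i) = 1)"

definition poly_systems :: "nat \<Rightarrow> nat mat \<Rightarrow> nat \<Rightarrow> (nat \<Rightarrow> int_mpoly) set" where
  "poly_systems p S m = {F.
     (\<forall>i\<le>m. F i \<in> Fp_polys p {0..m}) \<and>
     (\<forall>i<m. \<exists>G\<in>Fp_polys p {i+1..m}. \<exists>H\<in>Fp_polys p {i+1..m}.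
        \<exists>G'\<in>Fp_polys p {i+1..m}. \<exists>g\<in>{1..<int p}.
          poly_cong p (F i) (X i * G + H) \<and>
          poly_cong p G (const g * (\<Prod>j=i+1..m. X j ^ (S $$ (i, j))) + G') \<and>
          (\<forall>j\<in>{i+1..m}. deg_in j G' < ereal (real (S $$ (i, j))) \<and>
                         deg_in j H \<le> ereal (real (S $$ (i, j))))) \<and>
     (\<exists>g\<in>{1..<int p}. \<exists>h\<in>{0..<int p}. poly_cong p (F m) (const g * X m + const h))}"

text \<open>Vectors over the field with \<open>p\<close> elements are extensional functions on \<open>{..m}\<close>, so that
  equality of functions is equality of vectors.\<close>

definition generated_by :: "nat \<Rightarrow> nat \<Rightarrow> (nat \<Rightarrow> int_mpoly) \<Rightarrow> (nat \<Rightarrow> nat \<Rightarrow> int) \<Rightarrow> bool" where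
  "generated_by p m F w \<longleftrightarrow>
     (\<forall>n. w n \<in> {..m} \<rightarrow>\<^sub>E {0..<int p}) \<and>
     (\<forall>n. \<forall>i\<le>m. [w (n + 1) i = mpoly_eval (F i) (w n)] (mod int p))"

definition purely_periodic :: "(nat \<Rightarrow> 'a) \<Rightarrow> nat \<Rightarrow> bool" where
  "purely_periodic w \<tau> \<longleftrightarrow> 0 < \<tau> \<and> (\<forall>n. w (n + \<tau>) = w n) \<and>
     (\<forall>\<sigma>. 0 < \<sigma> \<and> (\<forall>n. w (n + \<sigma>) = w n) \<longrightarrow> \<tau> \<le> \<sigma>)"

text \<open>The points are \<open>x 0, \<dots>, x (N - 1)\<close>, with coordinates indexed by \<open>{..<s}\<close>.\<close>

definition discrepancy :: "nat \<Rightarrow> nat \<Rightarrow> (nat \<Rightarrow> nat \<Rightarrow> real) \<Rightarrow> real" where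
  "discrepancy s N x =
     (SUP (\<alpha>, \<beta>)\<in>{(\<alpha>, \<beta>). \<forall>k<s. 0 \<le> \<alpha> k \<and> \<alpha> k \<le> \<beta> k \<and> \<beta> k \<le> (1::real)}.
        \<bar>real (card {n. n < N \<and> x n \<in> Pi {..<s} (\<lambda>k. {\<alpha> k..<\<beta> k})}) / real N
          - (\<Prod>k<s. \<beta> k - \<alpha> k)\<bar>)"

end

theory Submission
  imports Defs
begin

text \<open>The points have coordinates that are multiples of \<open>1/p\<close>, so a box is a box of residues up to a
volume error of \<open>(m+1)/p\<close>, and finite Fourier analysis bounds the discrepancy by a power of
\<open>ln p\<close> times the largest of the sums \<open>\<Sum>n<N. e(a \<bullet> w n / p) / N\<close> over the frequencies
\<open>a \<noteq> 0\<close> (\<open>discrepancy_le\<close>). It is therefore enough to save a power of \<open>p\<close> in each of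
these sums. Let \<open>i\<close> be the first index with \<open>a i \<noteq> 0\<close>. Two different phenomena have to be
understood.

\<^bold>\<open>The case \<open>i < m\<close>.\<close> The sum is replaced by an average over \<open>K\<close> shifts, where
\<open>K\<close> is about \<open>p^(\<epsilon>/2)\<close>, and then by its mean of order \<open>2\<nu>\<close>. The states \<open>w n\<close> with
\<open>n < N\<close> are distinct, so the mean can be extended to all \<open>p^(m+1)\<close> states \<open>v\<close>. After
expansion, every pair of \<open>\<nu>\<close>-tuples of shifts contributes a sum over \<open>v\<close> of
\<open>e(\<Sum>k. c k * \<phi> (it k v) / p)\<close> with integers \<open>c k\<close>, where \<open>\<phi> v = a \<bullet> v\<close>. The pairs with
\<open>c = 0\<close> are those that agree up to order, which is rare. For the others the key point is that the
\<open>i\<close>-th coordinate of the \<open>k\<close>-th iterate is affine in \<open>v i\<close>, with a slope that depends on the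
later coordinates only; hence the sum over \<open>v i\<close> vanishes unless the same combination
\<open>\<Sum>k. c k * slope i k v\<close> of the slopes vanishes modulo \<open>p\<close>. The slope is a product of values of
\<open>G i\<close> along the orbit. As a polynomial in \<open>v (i+1)\<close> it has degree \<open>k * s i (i+1)\<close>, and because
\<open>s i (i+1) \<noteq> 0\<close> these degrees are distinct, so the combination vanishes for only \<open>O(K p^m)\<close>
states (\<open>card_slope_relation\<close>, \<open>moment_bound\<close>, \<open>sequence_asymptotic\<close>).

\<^bold>\<open>The case \<open>i = m\<close>.\<close> The last coordinate runs through an orbit of an affine map
\<open>y \<mapsto> g y + h\<close>. Since the other coordinates take at most \<open>p^m\<close> values, the orbit has at least
\<open>p^\<epsilon>\<close> elements. If \<open>g = 1\<close> it is everything; otherwise it is a translate of a coset of the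
group generated by \<open>g\<close>, which may have as few as \<open>p^\<epsilon>\<close> elements. The equidistribution of such
small multiplicative groups is the theorem of Bourgain, Glibichuk and Konyagin
(\<open>subgroup_exponential_sum\<close>).

\<^bold>\<open>Small multiplicative groups.\<close> Suppose that the sum over a group \<open>H\<close> is at least
\<open>p^-\<gamma> |H|\<close> at some nonzero frequency. Among the sets of frequencies where it is at least
\<open>p^(-3^j \<gamma>) |H|\<close>, for bounded \<open>j\<close>, two consecutive ones have almost the same size. Many
differences of elements of the smaller one lie in the larger one (\<open>large_spectrum_differences\<close>),
so the lemma of Balog, Szemeredi and Gowers provides a large set \<open>D\<close> in the larger one with
\<open>|D - D|\<close> not much larger than \<open>|D|\<close>. The larger one is invariant under \<open>H\<close>, so the dilates
of \<open>D\<close> by elements of \<open>H\<close> crowd into it and meet each other; hence for many \<open>\<xi>\<close> in a multiple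
of \<open>H\<close>, the dilate \<open>\<xi> D\<close> is covered by few translates of \<open>D - D\<close> (\<open>many_dilates_meet\<close>).
This property survives sums, differences and products, and with boundedly many of these operations
one reaches at least \<open>p/2\<close> elements (\<open>covered_growth_iterated\<close>). For at least one of so many
\<open>\<xi>\<close>, however, \<open>D + \<xi> D\<close> has about \<open>min(|D|^2, p)\<close> elements
(\<open>large_sumset_of_dilate\<close>). This leaves only very small and very large sets \<open>D\<close>
(\<open>dilation_dichotomy\<close>), and both are impossible: the spectrum contains an orbit of \<open>H\<close>, and
Parseval's identity bounds it by about \<open>p / |H|\<close>.\<close>

section \<open>Sumsets and small doubling\<close>

definition sumset :: "'a::ab_group_add set \<Rightarrow> 'a set \<Rightarrow> 'a set" where
  "sumset A B = (\<lambda>(a, b). a + b) ` (A \<times> B)"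

definition diffset :: "'a::ab_group_add set \<Rightarrow> 'a set \<Rightarrow> 'a set" where
  "diffset A B = (\<lambda>(a, b). a - b) ` (A \<times> B)"

lemma sumset_iff: "x \<in> sumset A B \<longleftrightarrow> (\<exists>a\<in>A. \<exists>b\<in>B. x = a + b)"
  by (auto simp: sumset_def)

lemma diffset_iff: "x \<in> diffset A B \<longleftrightarrow> (\<exists>a\<in>A. \<exists>b\<in>B. x = a - b)"
  by (auto simp: diffset_def)

lemma sumsetI [intro]: "a \<in> A \<Longrightarrow> b \<in> B \<Longrightarrow> a + b \<in> sumset A B"
  by (auto simp: sumset_def)

lemma diffsetI [intro]: "a \<in> A \<Longrightarrow> b \<in> B \<Longrightarrow> a - b \<in> diffset A B"
  by (auto simp: diffset_def)

lemma bex_sumset: "(\<exists>x\<in>sumset A B. P x) \<longleftrightarrow> (\<exists>a\<in>A. \<exists>b\<in>B. P (a + b))"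
  by (auto simp: sumset_def)

lemma bex_diffset: "(\<exists>x\<in>diffset A B. P x) \<longleftrightarrow> (\<exists>a\<in>A. \<exists>b\<in>B. P (a - b))"
  by (auto simp: diffset_def)

lemma sumset_assoc: "sumset (sumset A B) C = sumset A (sumset B C)"
  by (simp add: set_eq_iff sumset_iff bex_sumset add.assoc)

lemma sumset_commute: "sumset A B = sumset B A"
  by (auto simp: set_eq_iff sumset_iff) (metis add.commute)+

lemma sumset_left_commute: "sumset A (sumset B C) = sumset B (sumset A C)"
  by (metis sumset_assoc sumset_commute)

lemmas sumset_ac = sumset_assoc sumset_commute sumset_left_commute

lemma uminus_sumset: "uminus ` sumset A B = sumset (uminus ` A) (uminus ` B)"
  by (simp add: set_eq_iff sumset_iff image_iff bex_sumset)

lemma uminus_uminus_image: "uminus ` uminus ` A = (A::'a::ab_group_add set)"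
  by (simp add: image_image)

lemma diffset_eq_sumset: "diffset A B = sumset A (uminus ` B)"
  by (simp add: set_eq_iff sumset_iff diffset_iff image_iff)

lemmas set_arith = diffset_eq_sumset uminus_sumset uminus_uminus_image sumset_ac

lemma finite_sumset [simp, intro]: "finite A \<Longrightarrow> finite B \<Longrightarrow> finite (sumset A B)"
  by (simp add: sumset_def)

lemma finite_diffset [simp, intro]: "finite A \<Longrightarrow> finite B \<Longrightarrow> finite (diffset A B)"
  by (simp add: diffset_def)

lemma card_sumset_le: "finite A \<Longrightarrow> finite B \<Longrightarrow> card (sumset A B) \<le> card A * card B"
  unfolding sumset_def by (metis card_cartesian_product card_image_le finite_cartesian_product)

lemma card_diffset_le: "finite A \<Longrightarrow> finite B \<Longrightarrow> card (diffset A B) \<le> card A * card B"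
  unfolding diffset_def by (metis card_cartesian_product card_image_le finite_cartesian_product)

lemma sumset_mono: "A \<subseteq> A' \<Longrightarrow> B \<subseteq> B' \<Longrightarrow> sumset A B \<subseteq> sumset A' B'"
  unfolding sumset_def by auto

lemma diffset_mono: "A \<subseteq> A' \<Longrightarrow> B \<subseteq> B' \<Longrightarrow> diffset A B \<subseteq> diffset A' B'"
  unfolding diffset_def by auto

lemma card_diffset_commute: "card (diffset A B) = card (diffset B A)"
proof -
  have "diffset A B = uminus ` diffset B A"
    by (simp add: set_arith)
  thus ?thesis by (simp add: card_image)
qed

text \<open>Write every \<open>d\<close> in \<open>A - C\<close> in one way as \<open>a - c\<close>; then \<open>(d, b)\<close> can be recovered from
\<open>(a - b, b - c)\<close>, since these two differences add up to \<open>d\<close>.\<close>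

lemma ruzsa_triangle:
  fixes A B C :: "'a::ab_group_add set"
  assumes fin: "finite A" "finite B" "finite C"
  shows "card (diffset A C) * card B \<le> card (diffset A B) * card (diffset B C)"
proof -
  have "\<forall>d\<in>diffset A C. \<exists>q. fst q \<in> A \<and> snd q \<in> C \<and> d = fst q - snd q"
    by (force simp: diffset_iff)
  then obtain q where q: "\<And>d. d \<in> diffset A C \<Longrightarrow> fst (q d) \<in> A \<and> snd (q d) \<in> C \<and> d = fst (q d) - snd (q d)"
    by metis
  let ?f = "\<lambda>(d, b). (fst (q d) - b, b - snd (q d))"
  have "inj_on ?f (diffset A C \<times> B)"
  proof (rule inj_onI, clarify)
    fix d b d' b'
    assume d: "d \<in> diffset A C" and d': "d' \<in> diffset A C"
      and eq: "fst (q d) - b = fst (q d') - b'" "b - snd (q d) = b' - snd (q d')"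
    have "(fst (q d) - b) + (b - snd (q d)) = (fst (q d') - b') + (b' - snd (q d'))"
      using eq by simp
    hence "d = d'" using q[OF d] q[OF d'] by simp
    with eq show "d = d' \<and> b = b'" by simp
  qed
  moreover have "?f ` (diffset A C \<times> B) \<subseteq> diffset A B \<times> diffset B C"
    using q by (fastforce simp: diffset_iff)
  ultimately have "card (diffset A C \<times> B) \<le> card (diffset A B \<times> diffset B C)"
    using fin by (intro card_inj_on_le[of ?f]) auto
  thus ?thesis by (simp add: card_cartesian_product)
qed

text \<open>Petridis' argument for Pluennecke's inequality: if no subset of \<open>X\<close> grows less than \<open>X\<close> itself
when \<open>B\<close> is added, then the growth factor \<open>K\<close> persists after adding any further set \<open>C\<close>. In
the induction on \<open>C\<close>, the new element \<open>c\<close> adds nothing on the translates of those \<open>x\<close> for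
which \<open>x + c\<close> is already in \<open>X + C\<close>, and minimality bounds what these \<open>x\<close> would have cost.\<close>

lemma petridis:
  fixes X B C :: "'a::ab_group_add set"
  assumes fin: "finite X" "finite B" "finite C"
    and min: "\<And>Y. Y \<subseteq> X \<Longrightarrow> K * real (card Y) \<le> real (card (sumset Y B))"
    and K: "real (card (sumset X B)) = K * real (card X)"
  shows "real (card (sumset (sumset X B) C)) \<le> K * real (card (sumset X C))"
  using fin(3)
proof (induction C)
  case empty
  thus ?case by (simp add: sumset_def)
next
  case (insert c C)
  define W where "W = {x \<in> X. x + c \<in> sumset X C}"
  define t where "t = (\<lambda>S::'a set. (\<lambda>x. x + c) ` S)"
  have ct: "card (t S) = card S" for S by (simp add: t_def card_image)
  have WX: "W \<subseteq> X" "finite W" using fin by (auto simp: W_def)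
  have "sumset (sumset X B) (insert c C) \<subseteq> sumset (sumset X B) C \<union> (t (sumset X B) - t (sumset W B))"
  proof
    fix y assume "y \<in> sumset (sumset X B) (insert c C)"
    then obtain x b z where y: "x \<in> X" "b \<in> B" "z \<in> insert c C" "y = x + b + z"
      by (metis sumset_iff)
    show "y \<in> sumset (sumset X B) C \<union> (t (sumset X B) - t (sumset W B))"
    proof (cases "z \<in> C")
      case True thus ?thesis using y by auto
    next
      case False
      hence z: "z = c" using y by auto
      have in1: "y \<in> t (sumset X B)" using y z by (auto simp: t_def sumset_iff)
      have "y \<in> sumset (sumset X B) C" if "y \<in> t (sumset W B)"
      proof -
        from that obtain w b' where w: "w \<in> W" "b' \<in> B" "y = w + b' + c"
          by (auto simp: t_def sumset_iff)
        then obtain x' c' where "x' \<in> X" "c' \<in> C" "w + c = x' + c'"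
          by (auto simp: W_def sumset_iff)
        hence "y = (x' + b') + c'" using w by (simp add: algebra_simps)
        thus ?thesis using \<open>x' \<in> X\<close> \<open>c' \<in> C\<close> w by (metis sumsetI)
      qed
      with in1 show ?thesis by blast
    qed
  qed
  moreover have "t (sumset W B) \<subseteq> t (sumset X B)"
    unfolding t_def using WX by (intro image_mono sumset_mono) auto
  ultimately have "card (sumset (sumset X B) (insert c C)) \<le>
      card (sumset (sumset X B) C) + (card (sumset X B) - card (sumset W B))"
    using fin insert WX
    by (smt (verit, best) card_Diff_subset card_Un_le card_mono ct finite_Diff finite_Un finite_imageI
        finite_sumset le_trans t_def)
  moreover have "card (sumset W B) \<le> card (sumset X B)"
    using WX fin by (intro card_mono sumset_mono) auto
  ultimately have 1: "real (card (sumset (sumset X B) (insert c C))) \<le>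
      real (card (sumset (sumset X B) C)) + real (card (sumset X B)) - real (card (sumset W B))"
    by linarith
  have "sumset X (insert c C) = sumset X C \<union> t X"
    by (auto simp: sumset_def t_def)
  moreover have "t W \<subseteq> sumset X C" by (auto simp: t_def W_def)
  ultimately have "sumset X (insert c C) = sumset X C \<union> (t X - t W)" by blast
  moreover have "sumset X C \<inter> (t X - t W) = {}"
    by (auto simp: t_def W_def)
  ultimately have "card (sumset X (insert c C)) = card (sumset X C) + card (t X - t W)"
    using fin insert by (simp add: card_Un_disjoint t_def)
  moreover have "card (t X - t W) = card X - card W"
    using WX fin by (subst card_Diff_subset) (auto simp: t_def card_image)
  moreover have "card W \<le> card X" using WX fin by (intro card_mono) auto
  ultimately have 2: "real (card (sumset X (insert c C))) = real (card (sumset X C)) + real (card X) - real (card W)"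
    by simp
  have "real (card (sumset (sumset X B) (insert c C))) \<le> K * real (card (sumset X C)) + K * real (card X) - K * real (card W)"
    using 1 insert.IH min[OF WX(1)] K by linarith
  also have "\<dots> = K * real (card (sumset X (insert c C)))"
    unfolding 2 by (simp add: algebra_simps)
  finally show ?case .
qed

text \<open>The hypothesis of the preceding lemma holds for a nonempty subset of \<open>A\<close> with minimal growth
factor.\<close>

lemma pluennecke:
  fixes A B :: "'a::ab_group_add set"
  assumes fin: "finite A" "finite B" and ne: "A \<noteq> {}"
    and K: "real (card (sumset A B)) \<le> K * real (card A)"
  obtains X where "X \<subseteq> A" "X \<noteq> {}"
    "\<And>C. finite C \<Longrightarrow> real (card (sumset (sumset X B) C)) \<le> K * real (card (sumset X C))"
proof -
  define r where "r = (\<lambda>Y. real (card (sumset Y B)) / real (card Y))"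
  have "finite (Pow A - {{}})" "Pow A - {{}} \<noteq> {}" using fin ne by auto
  from ex_min_if_finite[OF finite_imageI[OF this(1), of r]] this(2)
  obtain X where X: "X \<in> Pow A - {{}}" "\<And>Y. Y \<in> Pow A - {{}} \<Longrightarrow> r X \<le> r Y"
    by (auto simp: not_less)
  have finX: "finite X" "card X > 0" using X fin by (auto simp: card_gt_0_iff finite_subset)
  have rK: "r X \<le> K"
  proof -
    have "r X \<le> r A" using X ne by auto
    also have "\<dots> \<le> K" using K ne fin by (simp add: r_def divide_le_eq card_gt_0_iff)
    finally show ?thesis .
  qed
  have "real (card (sumset (sumset X B) C)) \<le> K * real (card (sumset X C))" if "finite C" for C
  proof -
    have "real (card (sumset (sumset X B) C)) \<le> r X * real (card (sumset X C))"
    proof (rule petridis[OF finX(1) fin(2) that])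
      fix Y assume Y: "Y \<subseteq> X"
      show "r X * real (card Y) \<le> real (card (sumset Y B))"
      proof (cases "Y = {}")
        case False
        hence "r X \<le> r Y" using X Y by auto
        moreover have "card Y > 0" using False Y finX by (auto simp: card_gt_0_iff finite_subset)
        moreover have "r Y * real (card Y) = real (card (sumset Y B))"
          using \<open>card Y > 0\<close> by (auto simp: r_def)
        ultimately show ?thesis by (metis mult_right_mono of_nat_0_le_iff)
      qed simp
    next
      show "real (card (sumset X B)) = r X * real (card X)" using finX by (auto simp: r_def)
    qed
    also have "\<dots> \<le> K * real (card (sumset X C))" using rK by (intro mult_right_mono) auto
    finally show ?thesis .
  qed
  with X show ?thesis by (intro that[of X]) auto
qed

text \<open>A set \<open>X\<close> as in Pluennecke's inequality controls \<open>X - D\<close>, \<open>X - 2D\<close> and \<open>X - 3D\<close>; the triangle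
inequality through \<open>X\<close> removes \<open>X\<close> from the statement.\<close>

lemma small_doubling_iterated:
  fixes D :: "'a::ab_group_add set"
  assumes fin: "finite D" and ne: "D \<noteq> {}"
    and K: "real (card (diffset D D)) \<le> K * real (card D)"
  shows "real (card (diffset (sumset D D) (sumset (sumset D D) D))) \<le> K ^ 5 * real (card D)"
    and "real (card (diffset (sumset D D) D)) \<le> K ^ 3 * real (card D)"
proof -
  note d = diffset_eq_sumset
  let ?D = "uminus ` D"
  obtain X where X: "X \<subseteq> D" "X \<noteq> {}"
    "\<And>C. finite C \<Longrightarrow> real (card (sumset (sumset X ?D) C)) \<le> K * real (card (sumset X C))"
    using pluennecke[of D ?D K] fin ne K by (auto simp: d)
  have finX: "finite X" "card X > 0" using X fin by (auto simp: card_gt_0_iff finite_subset)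
  have "real (card D) > 0" using fin ne by (simp add: card_gt_0_iff)
  moreover have "0 \<le> K * real (card D)" using K by (meson of_nat_0_le_iff order_trans)
  ultimately have K0: "K \<ge> 0" by (simp add: zero_le_mult_iff)
  have s0: "sumset A {0} = A" for A :: "'a set" by (auto simp: sumset_iff)
  have X1: "real (card (diffset X D)) \<le> K * real (card X)"
    using X(3)[of "{0}"] by (simp add: d s0)
  have e2: "diffset X (sumset D D) = sumset (sumset X ?D) ?D"
    by (simp add: set_arith)
  have X2: "real (card (diffset X (sumset D D))) \<le> K ^ 2 * real (card X)"
  proof -
    have "real (card (diffset X (sumset D D))) \<le> K * real (card (diffset X D))"
      unfolding e2 d[of X D] using X(3)[of ?D] fin by simp
    also have "\<dots> \<le> K * (K * real (card X))" using X1 K0 by (intro mult_left_mono)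
    finally show ?thesis by (simp add: power2_eq_square)
  qed
  have e3: "diffset X (sumset (sumset D D) D) = sumset (sumset X ?D) (uminus ` sumset D D)"
    by (simp add: set_arith)
  have X3: "real (card (diffset X (sumset (sumset D D) D))) \<le> K ^ 3 * real (card X)"
  proof -
    have "real (card (diffset X (sumset (sumset D D) D))) \<le> K * real (card (diffset X (sumset D D)))"
      unfolding e3 using X(3)[of "uminus ` sumset D D"] fin by (simp add: d)
    also have "\<dots> \<le> K * (K ^ 2 * real (card X))" using X2 K0 by (intro mult_left_mono)
    finally show ?thesis by (simp add: eval_nat_numeral)
  qed
  have tri: "real (card (diffset A B)) \<le> K ^ (i + j) * real (card D)"
    if "finite A" "finite B" "real (card (diffset X A)) \<le> K ^ i * real (card X)"
      "real (card (diffset X B)) \<le> K ^ j * real (card X)" for A B i j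
  proof -
    have "real (card (diffset A B)) * real (card X) \<le> real (card (diffset A X)) * real (card (diffset X B))"
      using ruzsa_triangle[of A X B] that finX by (simp flip: of_nat_mult)
    also have "\<dots> \<le> (K ^ i * real (card X)) * (K ^ j * real (card X))"
      using that K0 by (intro mult_mono) (auto simp: card_diffset_commute[of A X])
    finally have "real (card (diffset A B)) \<le> K ^ (i + j) * real (card X)"
      using finX by (simp add: power_add mult_ac)
    also have "\<dots> \<le> K ^ (i + j) * real (card D)"
      using K0 X fin by (intro mult_left_mono) (auto intro: card_mono)
    finally show ?thesis .
  qed
  show "real (card (diffset (sumset D D) (sumset (sumset D D) D))) \<le> K ^ 5 * real (card D)"
    using tri[OF _ _ X2 X3] fin by simp
  show "real (card (diffset (sumset D D) D)) \<le> K ^ 3 * real (card D)"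
    using tri[of "sumset D D" D 2 1] X1 X2 fin by simp
qed

text \<open>A maximal family of pairwise disjoint translates \<open>t - Y\<close> with \<open>t\<close> in \<open>A\<close> fits at most \<open>K\<close>
times into \<open>A - Y\<close>, and by maximality every other \<open>a - Y\<close> meets one of them.\<close>

lemma ruzsa_covering:
  fixes A Y :: "'a::ab_group_add set"
  assumes fin: "finite A" "finite Y" and ne: "Y \<noteq> {}"
    and K: "real (card (diffset A Y)) \<le> K * real (card Y)"
  obtains T where "finite T" "real (card T) \<le> K" "A \<subseteq> sumset T (diffset Y Y)"
proof -
  define t where "t = (\<lambda>a. (\<lambda>y. a - y) ` Y)"
  define Ts where "Ts = {T. T \<subseteq> A \<and> (\<forall>a\<in>T. \<forall>b\<in>T. a \<noteq> b \<longrightarrow> t a \<inter> t b = {})}"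
  have "finite Ts" using fin by (auto simp: Ts_def)
  moreover have "{} \<in> Ts" by (simp add: Ts_def)
  ultimately obtain T where T: "T \<in> Ts" "\<And>T'. T' \<in> Ts \<Longrightarrow> card T' \<le> card T"
    using Max_ge[of "card ` Ts"] Max_in[of "card ` Ts"] by (metis empty_iff finite_imageI image_iff)
  have TA: "T \<subseteq> A" "finite T" using T fin by (auto simp: Ts_def finite_subset)
  have ct: "card (t a) = card Y" for a unfolding t_def by (intro card_image) (auto simp: inj_on_def)
  have "card (\<Union>a\<in>T. t a) = (\<Sum>a\<in>T. card (t a))"
    using T TA fin by (intro card_UN_disjoint) (auto simp: Ts_def t_def)
  also have "\<dots> = card T * card Y" by (simp add: ct)
  finally have "card T * card Y = card (\<Union>a\<in>T. t a)" by simp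
  also have "\<dots> \<le> card (diffset A Y)"
    using TA fin by (intro card_mono) (auto simp: t_def diffset_iff intro!: bexI)
  finally have "real (card T) * real (card Y) \<le> K * real (card Y)" using K
    by (metis of_nat_le_iff of_nat_mult order_trans)
  hence cT: "real (card T) \<le> K" using ne fin by (simp add: card_gt_0_iff)
  have "A \<subseteq> sumset T (diffset Y Y)"
  proof
    fix a assume a: "a \<in> A"
    have "\<exists>b\<in>T. t a \<inter> t b \<noteq> {}"
    proof (rule ccontr)
      assume n: "\<not> ?thesis"
      have "t a \<noteq> {}" using ne by (simp add: t_def)
      hence aT: "a \<notin> T" using n by auto
      have "insert a T \<in> Ts" using n T a by (auto simp: Ts_def)
      from T(2)[OF this] show False using aT TA by simp
    qed
    then obtain b y y' where "b \<in> T" "y \<in> Y" "y' \<in> Y" "a - y = b - y'" by (auto simp: t_def)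
    hence "a = b + (y - y')" by (simp add: algebra_simps)
    thus "a \<in> sumset T (diffset Y Y)"
      using \<open>b \<in> T\<close> \<open>y \<in> Y\<close> \<open>y' \<in> Y\<close> by (metis sumset_iff diffset_iff)
  qed
  with TA cT show ?thesis by (intro that) auto
qed

section \<open>The lemma of Balog, Szemeredi and Gowers\<close>

lemma sum_power2_le_card_mult:
  fixes f :: "'a \<Rightarrow> real"
  shows "(\<Sum>x\<in>A. f x)\<^sup>2 \<le> real (card A) * (\<Sum>x\<in>A. (f x)\<^sup>2)"
  using Cauchy_Schwarz_ineq_sum[of "\<lambda>_. 1" f A] by simp

lemma card_filter_eq_sum: "finite A \<Longrightarrow> real (card {x \<in> A. P x}) = (\<Sum>x\<in>A. of_bool (P x))"
  by (simp add: sum.If_cases of_bool_def Int_def)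

text \<open>Join \<open>a\<close> to \<open>x\<close> when \<open>a - x\<close> lies in \<open>L'\<close>. For a suitable \<open>x\<close>, only few pairs of neighbours
of \<open>x\<close> have few common neighbours. Discarding the neighbours that lie in many bad pairs leaves a
set any two of whose elements \<open>a\<close>, \<open>a'\<close> are joined through many triples \<open>(y, b, z)\<close>, so that
\<open>a - a' = (a - y) - (b - y) + (b - z) - (a' - z)\<close> has many representations by four elements of
\<open>L'\<close>. Counting representations bounds the number of differences.\<close>

lemma balog_szemeredi_gowers:
  fixes L L' :: "'a::ab_group_add set"
  assumes fin: "finite L" "finite L'" and ne: "L \<noteq> {}" and \<theta>: "0 < \<theta>"
    and many: "\<theta> * real (card L) ^ 2 \<le> (\<Sum>x\<in>L. real (card {a \<in> L. a - x \<in> L'}))"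
  obtains D where "D \<subseteq> L'" "3/8 * \<theta> * real (card L) \<le> real (card D)"
    "real (card (diffset D D)) * (\<theta> ^ 5 * real (card L) ^ 3) \<le> 4096 * real (card L') ^ 4"
proof -
  define n where "n = real (card L)"
  define N where "N = (\<lambda>x. {a \<in> L. a - x \<in> L'})"
  define com where "com = (\<lambda>a b. {x \<in> L. a \<in> N x \<and> b \<in> N x})"
  define \<eta> where "\<eta> = \<theta>\<^sup>2 / 32"
  define bad where "bad = {q \<in> L \<times> L. real (card (com (fst q) (snd q))) < \<eta> * n}"
  define bx where "bx = (\<lambda>x. {q \<in> bad. fst q \<in> N x \<and> snd q \<in> N x})"
  \<comment> \<open>The bad pairs inside the neighbourhoods are weighted by \<open>16\<close> so that the average of the
    difference stays positive and the bad pairs at the chosen \<open>x\<close> fill at most a sixteenth of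
    all pairs; the value of \<open>\<eta>\<close> makes \<open>16 \<eta>\<close> equal to \<open>\<theta>^2 / 2\<close>.\<close>
  have n: "n > 0" using fin ne by (simp add: n_def card_gt_0_iff)
  have \<eta>: "\<eta> > 0" using \<theta> by (simp add: \<eta>_def)
  have finN [simp]: "finite (N x)" for x using fin by (simp add: N_def)
  have NL: "N x \<subseteq> L" for x by (auto simp: N_def)
  have finb [simp]: "finite bad" using fin by (simp add: bad_def)
  have fincom [simp]: "finite (com a b)" for a b using fin by (simp add: com_def)
  have 1: "\<theta> * n\<^sup>2 \<le> (\<Sum>x\<in>L. real (card (N x)))"
    using many by (simp add: n_def N_def)
  have "\<theta>\<^sup>2 * n ^ 4 = (\<theta> * n\<^sup>2)\<^sup>2" by (simp add: power_mult_distrib)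
  also have "\<dots> \<le> (\<Sum>x\<in>L. real (card (N x)))\<^sup>2"
    using 1 \<theta> by (intro power_mono) auto
  also have "\<dots> \<le> n * (\<Sum>x\<in>L. (real (card (N x)))\<^sup>2)"
    unfolding n_def by (rule sum_power2_le_card_mult)
  finally have "n * (\<theta>\<^sup>2 * n ^ 3) \<le> n * (\<Sum>x\<in>L. (real (card (N x)))\<^sup>2)"
    by (simp add: eval_nat_numeral mult_ac)
  hence 2: "\<theta>\<^sup>2 * n ^ 3 \<le> (\<Sum>x\<in>L. (real (card (N x)))\<^sup>2)"
    using n by simp
  have "(\<Sum>x\<in>L. real (card (bx x))) = (\<Sum>x\<in>L. \<Sum>q\<in>bad. of_bool (fst q \<in> N x \<and> snd q \<in> N x))"
    by (simp only: bx_def card_filter_eq_sum[OF finb])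
  also have "\<dots> = (\<Sum>q\<in>bad. \<Sum>x\<in>L. of_bool (fst q \<in> N x \<and> snd q \<in> N x))" by (rule sum.swap)
  also have "\<dots> = (\<Sum>q\<in>bad. real (card (com (fst q) (snd q))))"
    by (simp only: com_def card_filter_eq_sum[OF fin(1)])
  also have "\<dots> \<le> (\<Sum>q\<in>bad. \<eta> * n)" by (intro sum_mono) (auto simp: bad_def)
  also have "\<dots> = real (card bad) * (\<eta> * n)" by simp
  also have "\<dots> \<le> n\<^sup>2 * (\<eta> * n)"
  proof -
    have "card bad \<le> card (L \<times> L)" using fin by (intro card_mono) (auto simp: bad_def)
    hence "real (card bad) \<le> n\<^sup>2" by (simp add: n_def power2_eq_square card_cartesian_product flip: of_nat_mult)
    thus ?thesis using \<eta> n by (intro mult_right_mono) auto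
  qed
  finally have 3: "(\<Sum>x\<in>L. real (card (bx x))) \<le> \<eta> * n ^ 3"
    by (simp add: eval_nat_numeral mult_ac)
  have "\<exists>x\<in>L. \<theta>\<^sup>2 * n\<^sup>2 / 2 \<le> (real (card (N x)))\<^sup>2 - 16 * real (card (bx x))"
  proof (rule ccontr)
    assume "\<not> ?thesis"
    hence "(\<Sum>x\<in>L. (real (card (N x)))\<^sup>2 - 16 * real (card (bx x))) < (\<Sum>x\<in>L. \<theta>\<^sup>2 * n\<^sup>2 / 2)"
      using fin ne by (intro sum_strict_mono) (auto simp: not_le)
    also have "\<dots> = \<theta>\<^sup>2 * n ^ 3 / 2" by (simp add: n_def eval_nat_numeral)
    also have "\<dots> = \<theta>\<^sup>2 * n ^ 3 - 16 * (\<eta> * n ^ 3)" by (simp add: \<eta>_def field_simps)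
    also have "\<dots> \<le> (\<Sum>x\<in>L. (real (card (N x)))\<^sup>2) - 16 * (\<Sum>x\<in>L. real (card (bx x)))"
      using 2 3 by linarith
    finally show False by (simp add: sum_subtractf sum_distrib_left)
  qed
  then obtain x where x: "x \<in> L" "\<theta>\<^sup>2 * n\<^sup>2 / 2 \<le> (real (card (N x)))\<^sup>2 - 16 * real (card (bx x))"
    by blast
  define c where "c = real (card (N x))"
  have "(\<theta> * n / 2)\<^sup>2 \<le> c\<^sup>2"
  proof -
    have "(\<theta> * n / 2)\<^sup>2 \<le> \<theta>\<^sup>2 * n\<^sup>2 / 2" by (simp add: power_mult_distrib power_divide)
    also have "\<dots> \<le> c\<^sup>2" using x by (simp add: c_def)
    finally show ?thesis .
  qed
  hence cn: "\<theta> * n / 2 \<le> c" by (rule power2_le_imp_le) (simp add: c_def)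
  hence c0: "c > 0" using \<theta> n by (smt (verit) divide_pos_pos mult_pos_pos)
  have cb: "16 * real (card (bx x)) \<le> c\<^sup>2" using x \<theta> n by (smt (verit) c_def divide_nonneg_nonneg mult_nonneg_nonneg zero_le_power2)
  define B where "B = (\<lambda>a. {b \<in> N x. (a, b) \<in> bad})"
  define A where "A = {a \<in> N x. 4 * real (card (B a)) \<le> c}"
  have finB [simp]: "finite (B a)" for a by (simp add: B_def)
  have AN: "A \<subseteq> N x" "finite A" by (auto simp: A_def)
  have "bx x = Sigma (N x) B" by (auto simp: bx_def B_def)
  hence "real (card (bx x)) = (\<Sum>a\<in>N x. real (card (B a)))" by simp
  also have "\<dots> \<ge> (\<Sum>a\<in>N x - A. real (card (B a)))" by (intro sum_mono2) auto
  also have "(\<Sum>a\<in>N x - A. real (card (B a))) \<ge> (\<Sum>a\<in>N x - A. c / 4)"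
    by (intro sum_mono) (auto simp: A_def)
  finally have "real (card (N x - A)) * (c / 4) \<le> real (card (bx x))" by simp
  hence "real (card (N x - A)) * (c / 4) \<le> c\<^sup>2 / 16" using cb by linarith
  hence "real (card (N x - A)) \<le> c / 4" using c0 by (simp add: power2_eq_square field_simps)
  moreover have "real (card (N x - A)) = c - real (card A)"
    using AN by (simp add: c_def card_Diff_subset card_mono of_nat_diff)
  ultimately have cA: "real (card A) \<ge> 3/4 * c" by linarith

  define M where "M = (\<lambda>q. N x - B (fst q) - B (snd q))"
  define T where "T = (\<lambda>q. Sigma (M q) (\<lambda>b. com (fst q) b \<times> com (snd q) b))"
  have Tcard: "real (card (T q)) \<ge> (c / 2) * (\<eta> * n)\<^sup>2" if "fst q \<in> A" "snd q \<in> A" for q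
  proof -
    have "real (card (N x)) \<le> real (card (M q \<union> B (fst q) \<union> B (snd q)))"
      by (intro of_nat_mono card_mono) (auto simp: M_def)
    also have "\<dots> \<le> real (card (M q)) + real (card (B (fst q))) + real (card (B (snd q)))"
      by (metis (no_types, lifting) add_mono card_Un_le le_trans of_nat_add of_nat_mono order_refl)
    finally have M: "real (card (M q)) \<ge> c / 2" using that by (auto simp: A_def c_def)
    have "(c / 2) * (\<eta> * n)\<^sup>2 \<le> real (card (M q)) * (\<eta> * n)\<^sup>2" using M by (intro mult_right_mono) auto
    also have "\<dots> = (\<Sum>b\<in>M q. (\<eta> * n) * (\<eta> * n))" by (simp add: power2_eq_square)
    also have "\<dots> \<le> (\<Sum>b\<in>M q. real (card (com (fst q) b)) * real (card (com (snd q) b)))"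
    proof (intro sum_mono mult_mono)
      fix b assume "b \<in> M q"
      hence "(fst q, b) \<notin> bad" "(snd q, b) \<notin> bad" "b \<in> L" using NL by (auto simp: M_def B_def)
      moreover have "fst q \<in> L" "snd q \<in> L" using that AN NL by blast+
      ultimately show "\<eta> * n \<le> real (card (com (fst q) b))" "\<eta> * n \<le> real (card (com (snd q) b))"
        by (auto simp: bad_def not_less)
    qed (use \<eta> n in auto)
    also have "\<dots> = real (card (T q))"
      unfolding T_def by (subst card_SigmaI) (auto simp: M_def card_cartesian_product)
    finally show ?thesis .
  qed
  have "\<forall>d\<in>diffset A A. \<exists>q. fst q \<in> A \<and> snd q \<in> A \<and> d = fst q - snd q"
    by (force simp: diffset_iff)
  then obtain q where q: "\<And>d. d \<in> diffset A A \<Longrightarrow> fst (q d) \<in> A \<and> snd (q d) \<in> A \<and> d = fst (q d) - snd (q d)"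
    by metis
  let ?f = "\<lambda>(d, b, y, z). (fst (q d) - y, b - y, b - z, snd (q d) - z)"
  let ?W = "Sigma (diffset A A) (\<lambda>d. T (q d))"
  have inj: "inj_on ?f ?W"
  proof (rule inj_onI)
    fix u v assume u: "u \<in> ?W" and v: "v \<in> ?W" and uv: "?f u = ?f v"
    obtain d b y z where u': "u = (d, b, y, z)" by (cases u)
    obtain d' b' y' z' where v': "v = (d', b', y', z')" by (cases v)
    have d: "d \<in> diffset A A" and d': "d' \<in> diffset A A" using u v u' v' by auto
    have eq: "fst (q d) - y = fst (q d') - y'" "b - y = b' - y'" "b - z = b' - z'"
        "snd (q d) - z = snd (q d') - z'" using uv u' v' by auto
    have "(fst (q d) - y) - (b - y) + (b - z) - (snd (q d) - z)
        = (fst (q d') - y') - (b' - y') + (b' - z') - (snd (q d') - z')" using eq by simp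
    hence "d = d'" using q[OF d] q[OF d'] by (simp add: algebra_simps)
    with eq show "u = v" by (auto simp: u' v')
  qed
  have "?f ` ?W \<subseteq> L' \<times> L' \<times> L' \<times> L'"
    by (auto simp: T_def com_def M_def N_def)
  hence "card ?W \<le> card (L' \<times> L' \<times> L' \<times> L')"
    using fin by (intro card_inj_on_le[OF inj]) auto
  hence "real (card ?W) \<le> real (card L') ^ 4"
    by (simp add: card_cartesian_product eval_nat_numeral flip: of_nat_mult)
  moreover have "real (card ?W) = (\<Sum>d\<in>diffset A A. real (card (T (q d))))"
    using AN by (subst card_SigmaI) (auto simp: T_def M_def)
  moreover have "(\<Sum>d\<in>diffset A A. real (card (T (q d)))) \<ge> (\<Sum>d\<in>diffset A A. (c / 2) * (\<eta> * n)\<^sup>2)"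
    using q by (intro sum_mono Tcard) auto
  ultimately have "real (card (diffset A A)) * ((c / 2) * (\<eta> * n)\<^sup>2) \<le> real (card L') ^ 4"
    by simp
  moreover have "real (card (diffset A A)) * ((\<theta> * n / 2 / 2) * (\<eta> * n)\<^sup>2) \<le> real (card (diffset A A)) * ((c / 2) * (\<eta> * n)\<^sup>2)"
    using cn by (intro mult_left_mono mult_right_mono) auto
  ultimately have final: "real (card (diffset A A)) * (\<theta> ^ 5 * n ^ 3) \<le> 4096 * real (card L') ^ 4"
    by (simp add: \<eta>_def power2_eq_square eval_nat_numeral field_simps)

  define D where "D = (\<lambda>a. a - x) ` A"
  have cD: "card D = card A" unfolding D_def by (intro card_image) (auto simp: inj_on_def)
  have "diffset D D = diffset A A" by (force simp: diffset_iff D_def)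
  moreover have "D \<subseteq> L'" using AN by (auto simp: D_def N_def)
  moreover have "3/8 * \<theta> * real (card L) \<le> real (card D)" using cA cn by (simp add: cD n_def)
  ultimately show ?thesis using final by (intro that[of D]) (auto simp: n_def)
qed

section \<open>Dilates covered by translates of a difference set\<close>

text \<open>For a set \<open>D\<close> of small doubling, the scalars \<open>\<xi>\<close> for which \<open>D + \<xi> D\<close> is small behave like an
approximate ring. Covering \<open>\<xi> D\<close> by translates of the symmetric set \<open>D - D\<close> is an essentially
equivalent condition that passes to sums and products directly and makes no use of inverses.\<close>

definition covered :: "real \<Rightarrow> 'a::comm_ring_1 set \<Rightarrow> 'a \<Rightarrow> bool" where
  "covered k D \<xi> \<longleftrightarrow> (\<exists>T. finite T \<and> real (card T) \<le> k \<and> (*) \<xi> ` D \<subseteq> sumset T (diffset D D))"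

lemma dilate_subset_iff:
  "(*) \<xi> ` D \<subseteq> sumset T (diffset D D) \<longleftrightarrow> (\<forall>x\<in>D. \<exists>t\<in>T. \<exists>a\<in>D. \<exists>b\<in>D. \<xi> * x = t + (a - b))"
  by (simp add: image_subset_iff sumset_iff bex_diffset)

lemma covered_mono: "covered k D \<xi> \<Longrightarrow> k \<le> k' \<Longrightarrow> covered k' D \<xi>"
  unfolding covered_def by force

lemma covered_uminus:
  assumes "covered k D \<xi>"
  shows "covered k D (- \<xi>)"
proof -
  from assms obtain T where T: "finite T" "real (card T) \<le> k" "(*) \<xi> ` D \<subseteq> sumset T (diffset D D)"
    by (auto simp: covered_def)
  have "(*) (- \<xi>) ` D \<subseteq> sumset (uminus ` T) (diffset D D)"
  proof clarify
    fix x assume "x \<in> D"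
    then obtain t a b where "t \<in> T" "a \<in> D" "b \<in> D" "\<xi> * x = t + (a - b)"
      using T(3) unfolding dilate_subset_iff by blast
    hence "- \<xi> * x = (- t) + (b - a)" by (simp add: algebra_simps)
    thus "- \<xi> * x \<in> sumset (uminus ` T) (diffset D D)"
      using \<open>t \<in> T\<close> \<open>a \<in> D\<close> \<open>b \<in> D\<close> by (metis sumsetI diffsetI imageI)
  qed
  thus ?thesis unfolding covered_def using T
    by (intro exI[of _ "uminus ` T"]) (auto simp: card_image)
qed

text \<open>This is what makes iteration possible: whatever is covered by translates of \<open>2D - 2D\<close> is covered by
\<open>K^5\<close> times as many translates of \<open>D - D\<close>.\<close>

lemma small_doubling_cover:
  fixes D :: "'a::ab_group_add set"
  assumes "finite D" "D \<noteq> {}" "real (card (diffset D D)) \<le> K * real (card D)"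
  obtains U where "finite U" "real (card U) \<le> K ^ 5"
    "diffset (sumset D D) (sumset D D) \<subseteq> sumset U (diffset D D)"
proof -
  have "diffset (diffset (sumset D D) (sumset D D)) D = diffset (sumset D D) (sumset (sumset D D) D)"
    by (simp add: set_arith)
  with small_doubling_iterated(1)[OF assms]
  have "real (card (diffset (diffset (sumset D D) (sumset D D)) D)) \<le> K ^ 5 * real (card D)" by simp
  from ruzsa_covering[OF _ assms(1,2) this] assms that show ?thesis by auto
qed

lemma covered_step:
  fixes D :: "'a::comm_ring_1 set"
  assumes D: "finite D" "D \<noteq> {}" "real (card (diffset D D)) \<le> K * real (card D)"
    and T: "finite T" "real (card T) \<le> k"
      "(*) \<xi> ` D \<subseteq> sumset T (diffset (sumset D D) (sumset D D))"
  shows "covered (k * K ^ 5) D \<xi>"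
proof -
  obtain U where U: "finite U" "real (card U) \<le> K ^ 5"
    "diffset (sumset D D) (sumset D D) \<subseteq> sumset U (diffset D D)"
    using small_doubling_cover[OF D] by blast
  have "(*) \<xi> ` D \<subseteq> sumset T (sumset U (diffset D D))"
    using T(3) U(3) sumset_mono by blast
  also have "\<dots> = sumset (sumset T U) (diffset D D)"
    by (simp add: set_arith)
  finally have "(*) \<xi> ` D \<subseteq> sumset (sumset T U) (diffset D D)" .
  moreover have "real (card (sumset T U)) \<le> k * K ^ 5"
  proof -
    have "real (card (sumset T U)) \<le> real (card T) * real (card U)"
      using card_sumset_le[OF T(1) U(1)] by (simp flip: of_nat_mult)
    also have "\<dots> \<le> k * K ^ 5" using T U by (intro mult_mono) (auto intro: order_trans[OF of_nat_0_le_iff])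
    finally show ?thesis .
  qed
  ultimately show ?thesis unfolding covered_def using T U by blast
qed

lemma covered_add:
  fixes D :: "'a::comm_ring_1 set"
  assumes D: "finite D" "D \<noteq> {}" "real (card (diffset D D)) \<le> K * real (card D)"
    and c: "covered k D \<xi>" "covered l D \<zeta>"
  shows "covered (k * l * K ^ 5) D (\<xi> + \<zeta>)"
proof -
  from c obtain S T where S: "finite S" "real (card S) \<le> k" "(*) \<xi> ` D \<subseteq> sumset S (diffset D D)"
    and T: "finite T" "real (card T) \<le> l" "(*) \<zeta> ` D \<subseteq> sumset T (diffset D D)"
    by (auto simp: covered_def)
  show ?thesis
  proof (rule covered_step[OF D])
    show "finite (sumset S T)" using S T by auto
    have "real (card (sumset S T)) \<le> real (card S) * real (card T)"
      using card_sumset_le[OF S(1) T(1)] by (simp flip: of_nat_mult)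
    also have "\<dots> \<le> k * l" using S T by (intro mult_mono) (auto intro: order_trans[OF of_nat_0_le_iff])
    finally show "real (card (sumset S T)) \<le> k * l" .
    show "(*) (\<xi> + \<zeta>) ` D \<subseteq> sumset (sumset S T) (diffset (sumset D D) (sumset D D))"
    proof clarify
      fix x assume x: "x \<in> D"
      obtain s a b where s: "s \<in> S" "a \<in> D" "b \<in> D" "\<xi> * x = s + (a - b)"
        using S(3) x unfolding dilate_subset_iff by blast
      obtain t a' b' where t: "t \<in> T" "a' \<in> D" "b' \<in> D" "\<zeta> * x = t + (a' - b')"
        using T(3) x unfolding dilate_subset_iff by blast
      have "(\<xi> + \<zeta>) * x = \<xi> * x + \<zeta> * x" by (simp add: algebra_simps)
      also have "\<dots> = (s + t) + ((a + a') - (b + b'))"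
        unfolding s(4) t(4) by (simp add: algebra_simps)
      finally show "(\<xi> + \<zeta>) * x \<in> sumset (sumset S T) (diffset (sumset D D) (sumset D D))"
        using s t by (metis sumsetI diffsetI)
    qed
  qed
qed

text \<open>Apply \<open>\<xi>\<close> to a covering of \<open>\<zeta> D\<close> by translates \<open>t + D - D\<close>; the covering of \<open>\<xi> D\<close> is then
used twice, for the two copies of \<open>D\<close>, which explains the square.\<close>

lemma covered_mult:
  fixes D :: "'a::comm_ring_1 set"
  assumes D: "finite D" "D \<noteq> {}" "real (card (diffset D D)) \<le> K * real (card D)"
    and c: "covered k D \<xi>" "covered l D \<zeta>"
  shows "covered (l * k\<^sup>2 * K ^ 5) D (\<xi> * \<zeta>)"
proof -
  from c obtain S T where S: "finite S" "real (card S) \<le> k" "(*) \<xi> ` D \<subseteq> sumset S (diffset D D)"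
    and T: "finite T" "real (card T) \<le> l" "(*) \<zeta> ` D \<subseteq> sumset T (diffset D D)"
    by (auto simp: covered_def)
  let ?V = "sumset ((*) \<xi> ` T) (diffset S S)"
  show ?thesis
  proof (rule covered_step[OF D])
    show "finite ?V" by (intro finite_sumset finite_imageI finite_diffset S(1) T(1))
    have "card ?V \<le> card ((*) \<xi> ` T) * card (diffset S S)"
      by (intro card_sumset_le finite_imageI finite_diffset S(1) T(1))
    also have "\<dots> \<le> card T * (card S * card S)"
      by (intro mult_mono card_image_le card_diffset_le S(1) T(1)) auto
    finally have "real (card ?V) \<le> real (card T) * real (card S) ^ 2"
      by (simp add: power2_eq_square flip: of_nat_mult)
    also have "\<dots> \<le> l * k\<^sup>2" using S T by (intro mult_mono power_mono) (auto intro: order_trans[OF of_nat_0_le_iff])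
    finally show "real (card ?V) \<le> l * k\<^sup>2" .
    show "(*) (\<xi> * \<zeta>) ` D \<subseteq> sumset ?V (diffset (sumset D D) (sumset D D))"
    proof clarify
      fix x assume x: "x \<in> D"
      have ex: "\<exists>s\<in>S. \<exists>a\<in>D. \<exists>b\<in>D. \<xi> * y = s + (a - b)" if "y \<in> D" for y
        using S(3) that unfolding dilate_subset_iff by blast
      obtain t a b where t: "t \<in> T" "a \<in> D" "b \<in> D" "\<zeta> * x = t + (a - b)"
        using T(3) x unfolding dilate_subset_iff by blast
      obtain s1 a1 b1 where 1: "s1 \<in> S" "a1 \<in> D" "b1 \<in> D" "\<xi> * a = s1 + (a1 - b1)" using ex t by blast
      obtain s2 a2 b2 where 2: "s2 \<in> S" "a2 \<in> D" "b2 \<in> D" "\<xi> * b = s2 + (a2 - b2)" using ex t by blast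
      have "\<xi> * \<zeta> * x = \<xi> * (t + (a - b))" by (simp only: mult.assoc t(4))
      also have "\<dots> = \<xi> * t + \<xi> * a - \<xi> * b" by (simp add: algebra_simps)
      also have "\<dots> = (\<xi> * t + (s1 - s2)) + ((a1 + b2) - (b1 + a2))"
        unfolding 1(4) 2(4) by (simp add: algebra_simps)
      finally show "\<xi> * \<zeta> * x \<in> sumset ?V (diffset (sumset D D) (sumset D D))"
        using t 1 2 by (metis sumsetI diffsetI imageI)
    qed
  qed
qed

lemma covered_imp_small_sumset:
  fixes D :: "'a::comm_ring_1 set"
  assumes D: "finite D" "D \<noteq> {}" "real (card (diffset D D)) \<le> K * real (card D)"
    and c: "covered k D \<xi>"
  shows "real (card (sumset D ((*) \<xi> ` D))) \<le> k * K ^ 3 * real (card D)"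
proof -
  from c obtain T where T: "finite T" "real (card T) \<le> k" "(*) \<xi> ` D \<subseteq> sumset T (diffset D D)"
    by (auto simp: covered_def)
  have "sumset D ((*) \<xi> ` D) \<subseteq> sumset D (sumset T (diffset D D))"
    using T by (intro sumset_mono) auto
  also have "\<dots> = sumset T (diffset (sumset D D) D)"
    by (simp add: set_arith)
  finally have "card (sumset D ((*) \<xi> ` D)) \<le> card (sumset T (diffset (sumset D D) D))"
    using T D by (intro card_mono) auto
  also have "\<dots> \<le> card T * card (diffset (sumset D D) D)" using T D by (intro card_sumset_le) auto
  finally have "real (card (sumset D ((*) \<xi> ` D))) \<le> real (card T) * real (card (diffset (sumset D D) D))"
    by (simp flip: of_nat_mult)
  also have "\<dots> \<le> k * (K ^ 3 * real (card D))"
    using T small_doubling_iterated(2)[OF D] by (intro mult_mono) (auto intro: order_trans[OF of_nat_0_le_iff])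
  finally show ?thesis by (simp add: mult_ac)
qed

text \<open>If \<open>Y\<close> lies in both \<open>D\<close> and \<open>\<xi> D\<close>, then \<open>\<xi> D - Y\<close> lies in \<open>\<xi> (D - D)\<close> and hence is small,
so the covering lemma applies with \<open>Y\<close>.\<close>

lemma covered_of_large_intersection:
  fixes D :: "'a::comm_ring_1 set"
  assumes D: "finite D" "real (card (diffset D D)) \<le> K * real (card D)"
    and Y: "Y \<subseteq> D" "Y \<subseteq> (*) \<xi> ` D" "Y \<noteq> {}"
    and k: "K * real (card D) \<le> k * real (card Y)"
  shows "covered k D \<xi>"
proof -
  have finY: "finite Y" using D Y finite_subset by blast
  have "diffset ((*) \<xi> ` D) Y \<subseteq> (*) \<xi> ` diffset D D"
    using Y(2) by (force simp: diffset_iff image_iff algebra_simps)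
  hence "card (diffset ((*) \<xi> ` D) Y) \<le> card ((*) \<xi> ` diffset D D)" using D by (intro card_mono) auto
  also have "\<dots> \<le> card (diffset D D)" using D by (intro card_image_le) auto
  finally have "real (card (diffset ((*) \<xi> ` D) Y)) \<le> k * real (card Y)" using D(2) k by linarith
  from ruzsa_covering[OF _ finY Y(3) this] obtain T where
    T: "finite T" "real (card T) \<le> k" "(*) \<xi> ` D \<subseteq> sumset T (diffset Y Y)" using D by auto
  moreover have "sumset T (diffset Y Y) \<subseteq> sumset T (diffset D D)"
    using Y by (intro sumset_mono diffset_mono) auto
  ultimately show ?thesis unfolding covered_def by blast
qed

section \<open>A ring that contains all prime fields\<close>

text \<open>The prime is a variable of the theorem, so the field with \<open>p\<close> elements cannot be a type. All these
fields live in one commutative ring, the product over all \<open>n\<close> of the integers modulo \<open>n\<close>: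
the multiples of the indicator \<open>component_unit p\<close> of the \<open>p\<close>-th factor form a field with \<open>p\<close>
elements, whose unit is \<open>component_unit p\<close> and not \<open>1\<close>. The results on sumsets, which are stated
for types, can be used there without any relativisation.\<close>

quotient_type residues = "nat \<Rightarrow> int" / "\<lambda>f g. \<forall>n. [f n = g n] (mod int n)"
  by (rule equivpI) (auto simp: reflp_def symp_def transp_def cong_sym intro: cong_trans)

instantiation residues :: comm_ring_1
begin
lift_definition zero_residues :: residues is "\<lambda>_. 0" .
lift_definition one_residues :: residues is "\<lambda>_. 1" .
lift_definition plus_residues :: "residues \<Rightarrow> residues \<Rightarrow> residues" is "\<lambda>f g n. f n + g n"
  by (simp add: cong_add)
lift_definition minus_residues :: "residues \<Rightarrow> residues \<Rightarrow> residues" is "\<lambda>f g n. f n - g n"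
  by (simp add: cong_diff)
lift_definition uminus_residues :: "residues \<Rightarrow> residues" is "\<lambda>f n. - f n"
  by (simp add: cong_minus_minus_iff)
lift_definition times_residues :: "residues \<Rightarrow> residues \<Rightarrow> residues" is "\<lambda>f g n. f n * g n"
  by (simp add: cong_mult)
instance
proof
  show "(0::residues) \<noteq> 1" by transfer (auto simp: cong_def intro!: exI[of _ 2])
qed (transfer; simp add: algebra_simps)+
end

lift_definition component_unit :: "nat \<Rightarrow> residues" is "\<lambda>p n. of_bool (n = p)" .

lemma of_int_residues: "of_int z = abs_residues (\<lambda>_. z)"
proof (induction z rule: int_induct[of _ 0])
  case base show ?case by (simp add: zero_residues_def)
next
  case (step1 i) thus ?case by (simp add: one_residues_def plus_residues.abs_eq)
next
  case (step2 i) thus ?case by (simp add: one_residues_def minus_residues.abs_eq)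
qed

text \<open>A field with \<open>p\<close> elements inside a ring: the image \<open>F\<close> of the integers under \<open>z \<mapsto> z u\<close>, for
an idempotent \<open>u\<close> of additive order \<open>p\<close>.\<close>

locale prime_field_in_ring =
  fixes p :: nat and u :: "'a::comm_ring_1"
  assumes prime: "prime p"
    and idem: "u * u = u"
    and kernel: "\<And>z. of_int z * u = 0 \<longleftrightarrow> int p dvd z"
begin

definition emb :: "int \<Rightarrow> 'a" where "emb z = of_int z * u"

definition F :: "'a set" where "F = range emb"

lemma emb_add: "emb (a + b) = emb a + emb b" by (simp add: emb_def algebra_simps)
lemma emb_diff: "emb (a - b) = emb a - emb b" by (simp add: emb_def algebra_simps)
lemma emb_mult: "emb (a * b) = emb a * emb b"
proof -
  have "emb a * emb b = of_int a * of_int b * (u * u)" by (simp only: emb_def mult_ac)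
  thus ?thesis by (simp add: emb_def idem)
qed
lemma emb_0 [simp]: "emb 0 = 0" by (simp add: emb_def)
lemma emb_1: "emb 1 = u" by (simp add: emb_def)
lemma emb_eq_0_iff: "emb a = 0 \<longleftrightarrow> int p dvd a" by (simp add: emb_def kernel)
lemma emb_eq_iff: "emb a = emb b \<longleftrightarrow> [a = b] (mod int p)"
  using emb_eq_0_iff[of "a - b"] by (simp add: emb_diff cong_iff_dvd_diff)
lemma emb_mod: "emb (a mod int p) = emb a" by (simp add: emb_eq_iff)

lemma p_gt: "p > 1" using prime prime_gt_1_nat by blast

lemma emb_inj: "inj_on emb {0..<int p}"
  by (intro inj_onI) (simp add: emb_eq_iff cong_def)

lemma F_eq: "F = emb ` {0..<int p}"
proof -
  have "emb a \<in> emb ` {0..<int p}" for a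
  proof -
    have "a mod int p \<in> {0..<int p}" using p_gt by simp
    hence "emb (a mod int p) \<in> emb ` {0..<int p}" by (rule imageI)
    thus ?thesis by (simp only: emb_mod)
  qed
  thus ?thesis unfolding F_def by auto
qed

lemma card_F: "card F = p" "finite F"
  unfolding F_eq using emb_inj by (simp_all add: card_image)

lemma F_closed: "x \<in> F \<Longrightarrow> y \<in> F \<Longrightarrow> x + y \<in> F" "x \<in> F \<Longrightarrow> y \<in> F \<Longrightarrow> x - y \<in> F"
  "x \<in> F \<Longrightarrow> y \<in> F \<Longrightarrow> x * y \<in> F" "0 \<in> F" "u \<in> F"
  by (auto simp: F_def simp flip: emb_add emb_diff emb_mult)
    (metis emb_0 rangeI, metis emb_1 rangeI)

lemma u_mult: "x \<in> F \<Longrightarrow> u * x = x"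
  unfolding F_def using emb_mult[of 1] by (auto simp: emb_1)

lemma no_zero_divisors: "x \<in> F \<Longrightarrow> y \<in> F \<Longrightarrow> x * y = 0 \<Longrightarrow> x = 0 \<or> y = 0"
  unfolding F_def using prime by (auto simp: emb_eq_0_iff prime_dvd_mult_iff simp flip: emb_mult)

lemma cancel: "x \<in> F \<Longrightarrow> x \<noteq> 0 \<Longrightarrow> y \<in> F \<Longrightarrow> z \<in> F \<Longrightarrow> x * y = x * z \<Longrightarrow> y = z"
  using no_zero_divisors[of x "y - z"] F_closed by (auto simp: algebra_simps)

lemma inverse_ex: "x \<in> F \<Longrightarrow> x \<noteq> 0 \<Longrightarrow> \<exists>y\<in>F. x * y = u"
proof -
  assume "x \<in> F" "x \<noteq> 0"
  then obtain a where a: "x = emb a" "\<not> int p dvd a" by (auto simp: F_def emb_eq_0_iff)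
  hence "coprime a (int p)" using prime by (metis coprime_commute prime_imp_coprime prime_nat_int_transfer)
  then obtain b where "[a * b = 1] (mod int p)" using cong_solve_coprime_int by blast
  hence "emb (a * b) = emb 1" by (simp add: emb_eq_iff)
  hence "emb a * emb b = u" by (simp add: emb_1 emb_mult)
  thus ?thesis using a by (auto simp: F_def)
qed

end

lemma prime_field_in_residues: "prime p \<Longrightarrow> prime_field_in_ring p (component_unit p)"
proof
  show "component_unit p * component_unit p = component_unit p" by transfer auto
  fix z
  show "of_int z * component_unit p = 0 \<longleftrightarrow> int p dvd z"
    unfolding of_int_residues by transfer (auto simp: cong_0_iff)
qed

section \<open>Growth of sets in a prime field\<close>

text \<open>Cauchy--Schwarz for the sizes of the fibres of \<open>f\<close>.\<close>

lemma card_image_collisions: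
  fixes f :: "'a \<Rightarrow> 'b"
  assumes fin: "finite A"
  shows "real (card A) ^ 2 \<le> real (card (f ` A)) * (\<Sum>a\<in>A. \<Sum>b\<in>A. of_bool (f a = f b))"
proof -
  define r where "r = (\<lambda>s. real (card {a \<in> A. f a = s}))"
  have r: "r s = (\<Sum>a\<in>A. of_bool (f a = s))" for s
    unfolding r_def by (rule card_filter_eq_sum[OF fin])
  have one: "(\<Sum>s\<in>f ` A. g s * of_bool (f a = s)) = g (f a)" if "a \<in> A" for a and g :: "'b \<Rightarrow> real"
  proof -
    have "(\<Sum>s\<in>f ` A. g s * of_bool (f a = s)) = (\<Sum>s\<in>{f a}. g s * of_bool (f a = s))"
      using that fin by (intro sum.mono_neutral_right) auto
    thus ?thesis by simp
  qed
  have 1: "(\<Sum>s\<in>f ` A. g s * r s) = (\<Sum>a\<in>A. g (f a))" for g :: "'b \<Rightarrow> real"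
  proof -
    have "(\<Sum>s\<in>f ` A. g s * r s) = (\<Sum>s\<in>f ` A. \<Sum>a\<in>A. g s * of_bool (f a = s))"
      by (simp only: r sum_distrib_left)
    also have "\<dots> = (\<Sum>a\<in>A. \<Sum>s\<in>f ` A. g s * of_bool (f a = s))" by (rule sum.swap)
    also have "\<dots> = (\<Sum>a\<in>A. g (f a))" by (intro sum.cong refl one)
    finally show ?thesis .
  qed
  have "(\<Sum>s\<in>f ` A. r s) = real (card A)" using 1[of "\<lambda>_. 1"] by simp
  moreover have "(\<Sum>s\<in>f ` A. (r s)\<^sup>2) = (\<Sum>a\<in>A. \<Sum>b\<in>A. of_bool (f a = f b))"
    using 1[of r] by (simp add: power2_eq_square r eq_commute)
  ultimately show ?thesis using sum_power2_le_card_mult[of r "f ` A"] by metis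
qed

context prime_field_in_ring
begin

text \<open>For \<open>a + \<xi> b = a' + \<xi> b'\<close> with \<open>(a, b) \<noteq> (a', b')\<close> there is at most one solution \<open>\<xi>\<close>. So the
average number of collisions over \<open>R\<close> is small, and few collisions mean a large sumset.\<close>

lemma large_sumset_of_dilate:
  assumes D: "D \<subseteq> F" "D \<noteq> {}" and R: "R \<subseteq> F" "R \<noteq> {}"
  shows "\<exists>\<xi>\<in>R. real (card D) ^ 2 * real (card R)
    \<le> real (card (sumset D ((*) \<xi> ` D))) * (real (card R) + real (card D) ^ 2)"
proof (rule ccontr)
  assume "\<not> ?thesis"
  hence small: "real (card (sumset D ((*) \<xi> ` D))) * (real (card R) + real (card D) ^ 2)
      < real (card D) ^ 2 * real (card R)" if "\<xi> \<in> R" for \<xi>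
    using that by (auto simp: not_le)
  have fin: "finite D" "finite R" using D R card_F finite_subset by blast+
  define d where "d = real (card D)"
  define r where "r = real (card R)"
  have d: "d > 0" and r: "r > 0" using fin D R by (auto simp: d_def r_def card_gt_0_iff)
  define f where "f = (\<lambda>\<xi>::'a. \<lambda>q. fst q + \<xi> * snd q)"
  define E where "E = (\<lambda>\<xi>. \<Sum>q\<in>D \<times> D. \<Sum>q'\<in>D \<times> D. of_bool (f \<xi> q = f \<xi> q') :: real)"
  have big: "d\<^sup>2 * (r + d\<^sup>2) < E \<xi> * r" if "\<xi> \<in> R" for \<xi>
  proof -
    have im: "f \<xi> ` (D \<times> D) = sumset D ((*) \<xi> ` D)"
    proof (intro equalityI subsetI)
      fix x assume "x \<in> f \<xi> ` (D \<times> D)"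
      then obtain a b where "a \<in> D" "b \<in> D" "x = a + \<xi> * b" by (auto simp: f_def)
      thus "x \<in> sumset D ((*) \<xi> ` D)" by (metis sumsetI imageI)
    next
      fix x assume "x \<in> sumset D ((*) \<xi> ` D)"
      then obtain a b where "a \<in> D" "b \<in> D" "x = a + \<xi> * b" by (auto simp: sumset_iff)
      thus "x \<in> f \<xi> ` (D \<times> D)" by (intro image_eqI[of _ _ "(a, b)"]) (auto simp: f_def)
    qed
    have "d ^ 4 \<le> real (card (sumset D ((*) \<xi> ` D))) * E \<xi>"
      using card_image_collisions[of "D \<times> D" "f \<xi>"] fin
      by (simp add: im E_def d_def card_cartesian_product eval_nat_numeral mult_ac)
    moreover from this have "E \<xi> > 0" using d
      by (smt (verit, best) mult_nonneg_nonpos of_nat_0_le_iff zero_less_power)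
    moreover have "real (card (sumset D ((*) \<xi> ` D))) * (r + d\<^sup>2) < d\<^sup>2 * r"
      using small[OF that] by (simp add: d_def r_def)
    ultimately have "d ^ 4 * (r + d\<^sup>2) < d\<^sup>2 * r * E \<xi>"
      using d r by (smt (verit, ccfv_threshold) mult.commute mult.left_commute mult_less_cancel_right mult_right_mono zero_le_power2)
    moreover have "d ^ 4 * (r + d\<^sup>2) = d\<^sup>2 * (d\<^sup>2 * (r + d\<^sup>2))" by (simp add: eval_nat_numeral)
    ultimately have "d\<^sup>2 * (d\<^sup>2 * (r + d\<^sup>2)) < d\<^sup>2 * (E \<xi> * r)" by (simp only: mult_ac)
    thus ?thesis using d by (simp only: mult_less_cancel_left_pos zero_less_power)
  qed
  have "r * (d\<^sup>2 * (r + d\<^sup>2)) = (\<Sum>\<xi>\<in>R. d\<^sup>2 * (r + d\<^sup>2))" by (simp add: r_def)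
  also have "\<dots> < (\<Sum>\<xi>\<in>R. E \<xi> * r)" using big R fin by (intro sum_strict_mono) auto
  also have "\<dots> = r * (\<Sum>\<xi>\<in>R. E \<xi>)" by (simp add: sum_distrib_left mult.commute)
  also have "(\<Sum>\<xi>\<in>R. E \<xi>) = (\<Sum>q\<in>D \<times> D. \<Sum>\<xi>\<in>R. \<Sum>q'\<in>D \<times> D. of_bool (f \<xi> q = f \<xi> q'))"
    unfolding E_def by (rule sum.swap)
  also have "\<dots> = (\<Sum>q\<in>D \<times> D. \<Sum>q'\<in>D \<times> D. \<Sum>\<xi>\<in>R. of_bool (f \<xi> q = f \<xi> q'))"
    by (intro sum.cong refl sum.swap)
  also have "\<dots> \<le> (\<Sum>q\<in>D \<times> D. \<Sum>q'\<in>D \<times> D. of_bool (q = q') * r + 1)"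
  proof (intro sum_mono)
    fix q q' assume q: "q \<in> D \<times> D" "q' \<in> D \<times> D"
    have c: "(\<Sum>\<xi>\<in>R. of_bool (f \<xi> q = f \<xi> q')) = real (card {\<xi> \<in> R. f \<xi> q = f \<xi> q'})"
      using fin by (simp only: card_filter_eq_sum)
    show "(\<Sum>\<xi>\<in>R. of_bool (f \<xi> q = f \<xi> q')) \<le> of_bool (q = q') * r + (1::real)"
    proof (cases "q = q'")
      case True thus ?thesis by (simp add: r_def)
    next
      case False
      have "card {\<xi> \<in> R. f \<xi> q = f \<xi> q'} \<le> 1"
      proof (rule card_le_Suc0_iff_eq[THEN iffD2, folded One_nat_def], use fin in simp, safe)
        fix \<xi> \<zeta> assume x: "\<xi> \<in> R" "\<zeta> \<in> R" "f \<xi> q = f \<xi> q'" "f \<zeta> q = f \<zeta> q'"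
        have F: "fst q \<in> F" "snd q \<in> F" "fst q' \<in> F" "snd q' \<in> F" "\<xi> \<in> F" "\<zeta> \<in> F"
          using q D R x by auto
        have "snd q - snd q' \<noteq> 0"
        proof
          assume "snd q - snd q' = 0"
          hence "snd q = snd q'" by simp
          with x(3) have "fst q = fst q'" by (simp add: f_def)
          with False \<open>snd q = snd q'\<close> show False by (simp add: prod_eq_iff)
        qed
        moreover have "(snd q - snd q') * \<xi> = (snd q - snd q') * \<zeta>"
        proof -
          have "(snd q - snd q') * \<xi> = fst q' - fst q" using x(3) by (simp add: f_def algebra_simps)
          moreover have "(snd q - snd q') * \<zeta> = fst q' - fst q" using x(4) by (simp add: f_def algebra_simps)
          ultimately show ?thesis by simp
        qed
        ultimately show "\<xi> = \<zeta>" using cancel F F_closed(2) by blast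
      qed
      thus ?thesis using c False by simp
    qed
  qed
  also have "\<dots> = d\<^sup>2 * (r + d\<^sup>2)"
    using fin by (simp add: sum.distrib d_def card_cartesian_product power2_eq_square algebra_simps
        flip: sum_distrib_right)
  finally show False using r by simp
qed

text \<open>The argument of Glibichuk and Konyagin. Let \<open>Q\<close> be the set of quotients of differences of \<open>B\<close>.
If \<open>q\<close> lies in \<open>Q\<close> but \<open>q + 1\<close> does not, then \<open>x + (q + 1) y\<close> determines \<open>x\<close> and \<open>y\<close>, so
these sums take \<open>|B|^2\<close> values; multiplication by the denominator of \<open>q\<close> gives an expression in
elements of \<open>B\<close>. Otherwise \<open>Q\<close> is closed under adding \<open>1\<close> and contains \<open>0\<close>, so it is the whole
prime field, and the multiplier of the preceding lemma is a quotient of differences of \<open>B\<close>.\<close>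

lemma growth:
  assumes B: "B \<subseteq> F" "card B \<ge> 2"
  shows "\<exists>b1\<in>B. \<exists>b2\<in>B. \<exists>b3\<in>B. \<exists>b4\<in>B. \<exists>e \<in> {b1 - b2, (b1 - b2) + (b3 - b4)}.
    min (real (card B) ^ 2) (real p) / 2 \<le> real (card ((\<lambda>(x, y). (b3 - b4) * x + e * y) ` (B \<times> B)))"
proof -
  have fin: "finite B" using B card_F finite_subset by blast
  define Q where "Q = {\<xi> \<in> F. \<exists>b1\<in>B. \<exists>b2\<in>B. \<exists>b3\<in>B. \<exists>b4\<in>B. b3 \<noteq> b4 \<and> \<xi> * (b3 - b4) = b1 - b2}"
  show ?thesis
  proof (cases "\<exists>\<xi>\<in>Q. \<xi> + u \<notin> Q")
    case True
    then obtain \<xi> b1 b2 b3 b4 where b: "\<xi> \<in> F" "\<xi> + u \<notin> Q" "b1 \<in> B" "b2 \<in> B" "b3 \<in> B" "b4 \<in> B"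
      "b3 \<noteq> b4" "\<xi> * (b3 - b4) = b1 - b2" by (auto simp: Q_def)
    define c where "c = b3 - b4"
    define e where "e = (b1 - b2) + (b3 - b4)"
    have cF: "c \<in> F" "c \<noteq> 0" using b B F_closed(2) by (auto simp: c_def)
    have "c * (\<xi> + u) = \<xi> * (b3 - b4) + u * c" by (simp add: c_def algebra_simps)
    also have "\<dots> = e" unfolding b(8) u_mult[OF cF(1)] e_def by (simp only: c_def)
    finally have e: "e = c * (\<xi> + u)" by simp
    have "inj_on (\<lambda>(x, y). c * x + e * y) (B \<times> B)"
    proof (rule inj_onI)
      fix v w assume v: "v \<in> B \<times> B" and w: "w \<in> B \<times> B"
        and eq: "(case v of (x, y) \<Rightarrow> c * x + e * y) = (case w of (x, y) \<Rightarrow> c * x + e * y)"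
      obtain x y x' y' where vw: "v = (x, y)" "w = (x', y')" by (cases v, cases w)
      have F: "x \<in> F" "y \<in> F" "x' \<in> F" "y' \<in> F" and B': "x \<in> B" "y \<in> B" "x' \<in> B" "y' \<in> B"
        using v w vw B by auto
      have "c * ((\<xi> + u) * (y' - y)) = c * (x - x')" using eq by (simp add: vw e algebra_simps)
      hence *: "(\<xi> + u) * (y' - y) = x - x'"
        using cancel[OF cF] F F_closed b(1) by metis
      have "y' = y"
      proof (rule ccontr)
        assume "y' \<noteq> y"
        hence "\<xi> + u \<in> Q" using * B' F_closed b(1) unfolding Q_def by blast
        thus False using b by simp
      qed
      with * show "v = w" by (simp add: vw)
    qed
    hence "card ((\<lambda>(x, y). c * x + e * y) ` (B \<times> B)) = card B ^ 2"
      by (simp add: card_image card_cartesian_product power2_eq_square)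
    hence "min (real (card B) ^ 2) (real p) / 2 \<le> real (card ((\<lambda>(x, y). c * x + e * y) ` (B \<times> B)))"
      using min.cobounded1[of "real (card B) ^ 2" "real p"] zero_le_power2[of "real (card B)"]
      by (simp only: of_nat_power)
    thus ?thesis using b(3-6) unfolding c_def e_def by blast
  next
    case False
    obtain b1 b2 where b12: "b1 \<in> B" "b2 \<in> B" "b1 \<noteq> b2"
      using B(2) by (metis card_le_Suc0_iff_eq fin not_less_eq_eq numeral_2_eq_2)
    have "0 \<in> Q" using b12 F_closed(4) unfolding Q_def by force
    have Qn: "emb (int n) \<in> Q" for n
    proof (induction n)
      case 0 show ?case using \<open>0 \<in> Q\<close> by simp
    next
      case (Suc n)
      have "emb (int (Suc n)) = emb (int n) + u" by (simp add: emb_add emb_1 add.commute)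
      thus ?case using Suc False by auto
    qed
    have QF: "\<xi> \<in> Q" if "\<xi> \<in> F" for \<xi>
    proof -
      from that obtain a where "a \<in> {0..<int p}" "\<xi> = emb a" by (auto simp: F_eq)
      thus ?thesis using Qn[of "nat a"] by simp
    qed
    have "B \<noteq> {}" "F \<noteq> {}" using b12 F_closed by auto
    then obtain \<xi> where x: "\<xi> \<in> F" "real (card B) ^ 2 * real p
      \<le> real (card (sumset B ((*) \<xi> ` B))) * (real p + real (card B) ^ 2)"
      using large_sumset_of_dilate[of B F] B card_F by auto
    obtain b1 b2 b3 b4 where b: "b1 \<in> B" "b2 \<in> B" "b3 \<in> B" "b4 \<in> B"
      "b3 \<noteq> b4" "\<xi> * (b3 - b4) = b1 - b2" using QF[OF x(1)] by (auto simp: Q_def)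
    define c where "c = b3 - b4"
    have cF: "c \<in> F" "c \<noteq> 0" using b B F_closed(2) by (auto simp: c_def)
    have SF: "sumset B ((*) \<xi> ` B) \<subseteq> F" using B(1) x(1) by (auto simp: sumset_iff intro!: F_closed(1,3))
    have "(\<lambda>(x, y). c * x + (b1 - b2) * y) ` (B \<times> B) = (*) c ` sumset B ((*) \<xi> ` B)"
      unfolding b(6)[symmetric] c_def[symmetric] 
      by (force simp: sumset_def image_image algebra_simps)
    moreover have "card ((*) c ` sumset B ((*) \<xi> ` B)) = card (sumset B ((*) \<xi> ` B))"
      using cancel[OF cF] SF by (intro card_image inj_onI) blast
    moreover have "min (real (card B) ^ 2) (real p) / 2 \<le> real (card (sumset B ((*) \<xi> ` B)))"
    proof -
      define s where "s = real (card (sumset B ((*) \<xi> ` B)))"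
      define t where "t = real (card B) ^ 2"
      have t: "t > 0" "real p > 0" using B p_gt by (auto simp: t_def)
      have "max t (real p) * min t (real p) = t * real p" by (auto simp: max_def min_def)
      also have "\<dots> \<le> s * (real p + t)" using x(2) by (simp add: s_def t_def)
      also have "\<dots> \<le> s * (2 * max t (real p))" by (intro mult_left_mono) (auto simp: s_def)
      finally have "max t (real p) * min t (real p) \<le> max t (real p) * (2 * s)" by (simp add: mult_ac)
      hence "min t (real p) \<le> 2 * s" using t by (simp add: max_def split: if_splits)
      thus ?thesis by (simp add: s_def t_def)
    qed
    ultimately have "min (real (card B) ^ 2) (real p) / 2 \<le>
      real (card ((\<lambda>(x, y). c * x + (b1 - b2) * y) ` (B \<times> B)))" by simp
    thus ?thesis using b(1-4) unfolding c_def by blast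
  qed
qed

end

context prime_field_in_ring
begin

text \<open>With \<open>K^5 \<le> k\<close>, an operation on two scalars costs one extra factor \<open>k\<close>: differences of elements
of \<open>B\<close> have constant \<open>k^3\<close>, the coefficient \<open>e\<close> at most \<open>k^7\<close>, the two products \<open>k^8\<close> and
\<open>k^16\<close>, and their sum \<open>k^25\<close>.\<close>

lemma covered_growth:
  assumes D: "finite D" "D \<noteq> {}" "real (card (diffset D D)) \<le> K * real (card D)"
    and k: "K ^ 5 \<le> k" "1 \<le> k" "0 \<le> K"
    and B: "B \<subseteq> F" "card B \<ge> 2" "\<And>x. x \<in> B \<Longrightarrow> covered k D x"
  obtains B' where "B' \<subseteq> F" "min (real (card B) ^ 2) (real p) / 2 \<le> real (card B')"
    "\<And>x. x \<in> B' \<Longrightarrow> covered (k ^ 25) D x"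
proof -
  obtain b1 b2 b3 b4 e where b: "b1 \<in> B" "b2 \<in> B" "b3 \<in> B" "b4 \<in> B"
    and e: "e \<in> {b1 - b2, (b1 - b2) + (b3 - b4)}"
    and big: "min (real (card B) ^ 2) (real p) / 2 \<le> real (card ((\<lambda>(x, y). (b3 - b4) * x + e * y) ` (B \<times> B)))"
    using growth[OF B(1,2)] by blast
  have K5: "0 \<le> K ^ 5" using k(3) by simp
  have add: "covered (k ^ (i + j + 1)) D (x + y)" if "covered (k ^ i) D x" "covered (k ^ j) D y" for i j x y
  proof (rule covered_mono[OF covered_add[OF D that]])
    have "k ^ i * k ^ j * K ^ 5 \<le> k ^ i * k ^ j * k" using k by (intro mult_left_mono) auto
    also have "\<dots> = k ^ (i + j + 1)" by (simp add: power_add)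
    finally show "k ^ i * k ^ j * K ^ 5 \<le> k ^ (i + j + 1)" .
  qed
  have mult: "covered (k ^ (2 * i + j + 1)) D (x * y)" if "covered (k ^ i) D x" "covered (k ^ j) D y" for i j x y
  proof (rule covered_mono[OF covered_mult[OF D that]])
    have "k ^ j * (k ^ i)\<^sup>2 * K ^ 5 \<le> k ^ j * (k ^ i)\<^sup>2 * k" using k by (intro mult_left_mono) auto
    also have "\<dots> = k ^ (2 * i + j + 1)" by (simp add: power_add power_mult mult_ac power2_eq_square)
    finally show "k ^ j * (k ^ i)\<^sup>2 * K ^ 5 \<le> k ^ (2 * i + j + 1)" .
  qed
  have diff: "covered (k ^ 3) D (x - y)" if "x \<in> B" "y \<in> B" for x y
    using add[of 1 x 1 "- y"] covered_uminus[of k D y] B(3) that by (simp add: numeral_3_eq_3)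
  have ce: "covered (k ^ 7) D e"
  proof (cases "e = b1 - b2")
    case True
    have "k ^ 3 \<le> k ^ 7" using k by (intro power_increasing) auto
    thus ?thesis using diff[OF b(1,2)] True covered_mono by metis
  next
    case False
    thus ?thesis using add[OF diff[OF b(1,2)] diff[OF b(3,4)]] e by simp
  qed
  have cov: "covered (k ^ 25) D ((b3 - b4) * x + e * y)" if "x \<in> B" "y \<in> B" for x y
  proof -
    have "covered (k ^ 8) D ((b3 - b4) * x)" using mult[OF diff[OF b(3,4)], of 1 x] B(3) that by simp
    moreover have "covered (k ^ 16) D (e * y)" using mult[OF ce, of 1 y] B(3) that by simp
    ultimately have "covered (k ^ (8 + 16 + 1)) D ((b3 - b4) * x + e * y)" by (rule add)
    thus ?thesis by simp
  qed
  have eF: "e \<in> F" "b3 - b4 \<in> F" using b e B(1) by (auto intro!: F_closed(1,2))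
  show ?thesis
  proof (rule that[OF _ big])
    show "(\<lambda>(x, y). (b3 - b4) * x + e * y) ` (B \<times> B) \<subseteq> F"
      using eF B(1) by (auto intro!: F_closed(1,3))
  qed (use cov in auto)
qed

text \<open>Each step replaces the size \<open>b\<close> by at least \<open>min(b^2, p) / 2\<close>, which for \<open>b \<ge> 4\<close> is at least
\<open>b^(3/2)\<close> until \<open>p/2\<close> is reached.\<close>

lemma covered_growth_iterated:
  assumes D: "finite D" "D \<noteq> {}" "real (card (diffset D D)) \<le> K * real (card D)"
    and k: "K ^ 5 \<le> k" "1 \<le> k" "0 \<le> K"
    and B: "B \<subseteq> F" "card B \<ge> 4" "\<And>x. x \<in> B \<Longrightarrow> covered k D x"
  shows "\<exists>B'\<subseteq>F. min (real p / 2) (real (card B) powr ((3/2) ^ J)) \<le> real (card B') \<and>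
    card B' \<ge> 2 \<and> (\<forall>x\<in>B'. covered (k ^ (25 ^ J)) D x)"
proof (induction J)
  case 0
  show ?case using B by (intro exI[of _ B]) auto
next
  case (Suc J)
  then obtain A where A: "A \<subseteq> F" "min (real p / 2) (real (card B) powr ((3/2) ^ J)) \<le> real (card A)"
    "card A \<ge> 2" "\<And>x. x \<in> A \<Longrightarrow> covered (k ^ (25 ^ J)) D x" by blast
  define b where "b = real (card B)"
  have b: "b \<ge> 4" using B by (simp add: b_def)
  have "card B \<le> card F" using B card_F by (intro card_mono) auto
  hence p4: "real p \<ge> 4" using B card_F by simp
  have kk: "k \<le> k ^ (25 ^ J)" using k by (simp add: self_le_power)
  have "K ^ 5 \<le> k ^ (25 ^ J)" "1 \<le> k ^ (25 ^ J)" using k kk by linarith+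
  from covered_growth[OF D this k(3) A(1,3,4)]
  obtain B' where B': "B' \<subseteq> F" "min (real (card A) ^ 2) (real p) / 2 \<le> real (card B')"
    "\<And>x. x \<in> B' \<Longrightarrow> covered ((k ^ 25 ^ J) ^ 25) D x" by blast
  define e where "e = (3/2 :: real) ^ J"
  have e: "e \<ge> 1" by (simp add: e_def one_le_power)
  have bige: "b powr e \<ge> 4" using b e powr_mono[of 1 e b] by simp
  have m: "min (real p / 2) (b powr ((3/2) ^ Suc J)) \<le> real (card B')"
  proof (cases "real p / 2 \<le> real (card A) ^ 2 / 2")
    case True
    thus ?thesis using B'(2) by (auto simp: min_def split: if_splits)
  next
    case False
    have "real (card A) < real p / 2"
    proof (rule ccontr)
      assume "\<not> real (card A) < real p / 2"
      hence "(real p / 2) ^ 2 \<le> real (card A) ^ 2" by (intro power_mono) auto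
      moreover have "real p * 4 \<le> real p * real p" using p4 by (intro mult_left_mono) auto
      ultimately show False using False by (simp add: power2_eq_square)
    qed
    hence "b powr e \<le> real (card A)" using A(2) by (simp add: b_def e_def min_def split: if_splits)
    hence "(b powr e) ^ 2 \<le> real (card A) ^ 2" by (intro power_mono) auto
    moreover have "b powr ((3/2) ^ Suc J) \<le> (b powr e) ^ 2 / 2"
    proof -
      have "b powr ((3/2) ^ Suc J) * 2 \<le> b powr ((3/2) ^ Suc J) * b powr (1/2)"
      proof (intro mult_left_mono)
        have "4 powr (1/2) \<le> b powr (1/2)" using b by (intro powr_mono2) auto
        moreover have "4 powr (1/2) = (2::real)" by (simp add: powr_half_sqrt)
        ultimately show "2 \<le> b powr (1/2)" by simp
      qed auto
      also have "\<dots> = b powr (3/2 * e + 1/2)" by (simp add: powr_add e_def)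
      also have "\<dots> \<le> b powr (2 * e)" using e b by (intro powr_mono) auto
      also have "\<dots> = (b powr e) ^ 2" by (simp only: power2_eq_square mult_2 powr_add)
      finally show ?thesis by simp
    qed
    moreover have "real (card A) ^ 2 / 2 \<le> real (card B')"
      using B'(2) False by (simp add: min_def split: if_splits)
    ultimately have "b powr ((3/2) ^ Suc J) \<le> real (card B')" by linarith
    thus ?thesis by (rule min.coboundedI2)
  qed
  have "card B' \<ge> 2"
  proof -
    have "b powr ((3/2) ^ Suc J) \<ge> b powr 1" using b e by (intro powr_mono) (auto simp: one_le_power simp flip: power_Suc)
    hence "2 \<le> real (card B')" using m b p4 by (auto simp: min_def split: if_splits)
    thus ?thesis by simp
  qed
  moreover have "(k ^ 25 ^ J) ^ 25 = k ^ 25 ^ Suc J" by (simp add: mult.commute flip: power_mult)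
  ultimately show ?case using B' m by (intro exI[of _ B']) (auto simp: b_def)
qed

text \<open>All dilates \<open>g D\<close> lie in \<open>L\<close>, so by Cauchy--Schwarz they meet in pairs; one of them, \<open>g' D\<close>, meets
many others in a large set. Dividing by \<open>g'\<close> gives the multipliers in \<open>B\<close>.\<close>

lemma many_dilates_meet:
  assumes D: "D \<subseteq> F" "D \<noteq> {}" and G: "G \<subseteq> F" "0 \<notin> G" "G \<noteq> {}"
    and L: "finite L" "\<And>g. g \<in> G \<Longrightarrow> (*) g ` D \<subseteq> L"
  obtains B where "B \<subseteq> F" "real (card G) * real (card D) \<le> 2 * real (card L) * real (card B)"
    "\<And>\<xi>. \<xi> \<in> B \<Longrightarrow> real (card D) ^ 2 \<le> 2 * real (card L) * real (card (D \<inter> (*) \<xi> ` D))"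
proof -
  define d where "d = real (card D)"
  define l where "l = real (card L)"
  define h where "h = real (card G)"
  have fin: "finite D" "finite G" using D G card_F finite_subset by blast+
  have inj: "inj_on ((*) g) F" if "g \<in> F" "g \<noteq> 0" for g
    using cancel[OF that] by (intro inj_onI) blast
  have cd: "card ((*) g ` D) = card D" if "g \<in> G" for g
    using inj[of g] that G D by (metis card_image inj_on_subset subsetD)
  have LD: "L \<noteq> {}" using L(2) D G by blast
  have pos: "d > 0" "l > 0" "h > 0" using D G L LD fin by (auto simp: d_def l_def h_def card_gt_0_iff)
  define m where "m = (\<lambda>z. \<Sum>g\<in>G. of_bool (z \<in> (*) g ` D) :: real)"
  have cL: "(\<Sum>z\<in>L. of_bool (z \<in> A)) = real (card A)" if "A \<subseteq> L" for A
  proof -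
    have "(\<Sum>z\<in>L. of_bool (z \<in> A)) = real (card {z \<in> L. z \<in> A})" by (rule card_filter_eq_sum[OF L(1), symmetric])
    also have "{z \<in> L. z \<in> A} = A" using that by auto
    finally show ?thesis .
  qed
  have "(\<Sum>z\<in>L. m z) = (\<Sum>g\<in>G. \<Sum>z\<in>L. of_bool (z \<in> (*) g ` D))"
    unfolding m_def by (rule sum.swap)
  also have "\<dots> = (\<Sum>g\<in>G. d)" using L(2) cd by (intro sum.cong refl) (simp add: cL d_def)
  finally have m1: "(\<Sum>z\<in>L. m z) = h * d" by (simp add: h_def)
  define I where "I = (\<lambda>g g'. real (card ((*) g ` D \<inter> (*) g' ` D)))"
  have "(\<Sum>z\<in>L. (m z)\<^sup>2) = (\<Sum>z\<in>L. \<Sum>g'\<in>G. \<Sum>g\<in>G. of_bool (z \<in> (*) g ` D \<inter> (*) g' ` D))"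
    unfolding m_def power2_eq_square sum_product by (subst (2) sum.swap) (simp add: of_bool_conj)
  also have "\<dots> = (\<Sum>g'\<in>G. \<Sum>z\<in>L. \<Sum>g\<in>G. of_bool (z \<in> (*) g ` D \<inter> (*) g' ` D))" by (rule sum.swap)
  also have "\<dots> = (\<Sum>g'\<in>G. \<Sum>g\<in>G. \<Sum>z\<in>L. of_bool (z \<in> (*) g ` D \<inter> (*) g' ` D))"
    by (intro sum.cong refl sum.swap)
  also have "\<dots> = (\<Sum>g'\<in>G. \<Sum>g\<in>G. I g g')"
    unfolding I_def using L(2) by (intro sum.cong refl cL) auto
  finally have m2: "(\<Sum>z\<in>L. (m z)\<^sup>2) = (\<Sum>g'\<in>G. \<Sum>g\<in>G. I g g')" .
  have "(h * d)\<^sup>2 \<le> l * (\<Sum>g'\<in>G. \<Sum>g\<in>G. I g g')"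
    using sum_power2_le_card_mult[of m L] unfolding m1 m2 l_def .
  have "\<exists>g'\<in>G. h * d\<^sup>2 \<le> l * (\<Sum>g\<in>G. I g g')"
  proof (rule ccontr)
    assume "\<not> ?thesis"
    hence "(\<Sum>g'\<in>G. l * (\<Sum>g\<in>G. I g g')) < (\<Sum>g'\<in>G. h * d\<^sup>2)"
      using G fin by (intro sum_strict_mono) (auto simp: not_le)
    also have "\<dots> = (h * d)\<^sup>2" by (simp add: h_def power2_eq_square)
    finally show False using \<open>(h * d)\<^sup>2 \<le> l * _\<close> by (simp add: sum_distrib_left)
  qed
  then obtain g' where g': "g' \<in> G" "h * d\<^sup>2 \<le> l * (\<Sum>g\<in>G. I g g')" by blast
  define G1 where "G1 = {g \<in> G. d\<^sup>2 \<le> 2 * l * I g g'}"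
  have G1: "G1 \<subseteq> G" "finite G1" using fin by (auto simp: G1_def)
  have Id: "I g g' \<le> d" if "g \<in> G" for g
  proof -
    have "card ((*) g ` D \<inter> (*) g' ` D) \<le> card ((*) g ` D)" using fin by (intro card_mono) auto
    thus ?thesis using cd[OF that] by (simp add: I_def d_def)
  qed
  have "2 * l * I g g' \<le> d\<^sup>2 + of_bool (g \<in> G1) * (2 * l * d)" if "g \<in> G" for g
    using Id[OF that] that pos by (auto simp: G1_def not_le mult_left_mono intro: add_increasing)
  hence "(\<Sum>g\<in>G. 2 * l * I g g') \<le> (\<Sum>g\<in>G. d\<^sup>2 + of_bool (g \<in> G1) * (2 * l * d))"
    by (rule sum_mono)
  also have "\<dots> = h * d\<^sup>2 + real (card G1) * (2 * l * d)"
  proof -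
    have "(\<Sum>g\<in>G. of_bool (g \<in> G1)) = real (card G1)"
    proof -
      have "{g \<in> G. g \<in> G1} = G1" using G1 by auto
      thus ?thesis using card_filter_eq_sum[OF fin(2), of "\<lambda>g. g \<in> G1"] by simp
    qed
    thus ?thesis by (simp add: sum.distrib h_def flip: sum_distrib_right)
  qed
  finally have up: "(\<Sum>g\<in>G. 2 * l * I g g') \<le> h * d\<^sup>2 + real (card G1) * (2 * l * d)" .
  have "(\<Sum>g\<in>G. 2 * l * I g g') = 2 * (l * (\<Sum>g\<in>G. I g g'))"
    by (simp add: sum_distrib_left mult.assoc)
  hence "2 * (h * d\<^sup>2) \<le> h * d\<^sup>2 + real (card G1) * (2 * l * d)"
    using g'(2) up by linarith
  hence "d * (h * d) \<le> d * (2 * l * real (card G1))" by (simp add: power2_eq_square mult_ac)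
  hence cG1: "h * d \<le> 2 * l * real (card G1)" using pos by simp
  have g'F: "g' \<in> F" "g' \<noteq> 0" using g' G by auto
  obtain i where i: "i \<in> F" "g' * i = u" using inverse_ex[OF g'F] by blast
  have i0: "i \<noteq> 0"
  proof
    assume "i = 0"
    hence "emb 1 = 0" unfolding emb_1 using i(2) by simp
    thus False using p_gt by (simp add: emb_eq_0_iff)
  qed
  show ?thesis
  proof (rule that[of "(*) i ` G1"])
    show "(*) i ` G1 \<subseteq> F" using i(1) G1(1) G(1) by (auto intro!: F_closed(3))
    have "card ((*) i ` G1) = card G1"
      using inj[OF i(1) i0] G1 G by (meson card_image inj_on_subset order_trans)
    thus "real (card G) * real (card D) \<le> 2 * real (card L) * real (card ((*) i ` G1))"
      using cG1 by (simp add: h_def d_def l_def)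
    fix \<xi> assume "\<xi> \<in> (*) i ` G1"
    then obtain g where g: "g \<in> G" "\<xi> = i * g" "d\<^sup>2 \<le> 2 * l * I g g'" by (auto simp: G1_def)
    have "(*) g ` D \<subseteq> F" using g(1) G(1) D(1) by (auto intro!: F_closed(3))
    hence "(*) g ` D \<inter> (*) g' ` D \<subseteq> F" by blast
    hence "card ((*) g ` D \<inter> (*) g' ` D) = card ((*) i ` ((*) g ` D \<inter> (*) g' ` D))"
      using inj[OF i(1) i0] by (metis card_image inj_on_subset)
    also have "\<dots> \<le> card (D \<inter> (*) \<xi> ` D)"
    proof (intro card_mono)
      show "(*) i ` ((*) g ` D \<inter> (*) g' ` D) \<subseteq> D \<inter> (*) \<xi> ` D"
      proof clarify
        fix z a b assume ab: "a \<in> D" "b \<in> D" "g * a = g' * b"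
        have "i * (g' * b) = (g' * i) * b" by (simp only: mult_ac)
        also have "\<dots> = u * b" by (simp only: i(2))
        also have "\<dots> = b" using ab D u_mult by blast
        finally have "i * (g * a) = b" using ab by simp
        moreover have "i * (g * a) = \<xi> * a" by (simp add: g mult.assoc)
        ultimately show "i * (g * a) \<in> D \<inter> (*) \<xi> ` D" using ab by force
      qed
    qed (use fin in auto)
    finally have "I g g' \<le> real (card (D \<inter> (*) \<xi> ` D))" by (simp add: I_def)
    hence "2 * l * I g g' \<le> 2 * l * real (card (D \<inter> (*) \<xi> ` D))" using pos by (intro mult_left_mono) auto
    thus "real (card D) ^ 2 \<le> 2 * real (card L) * real (card (D \<inter> (*) \<xi> ` D))"
      using g(3) by (simp add: d_def l_def)
  qed
qed

end

section \<open>Additive characters\<close>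

definition echar :: "nat \<Rightarrow> int \<Rightarrow> complex" where
  "echar p x = cis (2 * pi * real_of_int x / real p)"

lemma norm_echar [simp]: "norm (echar p x) = 1"
  by (simp add: echar_def)

lemma echar_0 [simp]: "echar p 0 = 1"
  by (simp add: echar_def)

lemma echar_add: "echar p (x + y) = echar p x * echar p y"
  by (simp add: echar_def cis_mult ring_distribs add_divide_distrib)

lemma echar_sum: "echar p (\<Sum>i\<in>A. f i) = (\<Prod>i\<in>A. echar p (f i))"
  by (induction A rule: infinite_finite_induct) (simp_all add: echar_add)

lemma cnj_echar: "cnj (echar p x) = echar p (- x)"
  by (simp add: echar_def cis_cnj)

lemma echar_eq_1_iff: "p > 0 \<Longrightarrow> echar p x = 1 \<longleftrightarrow> int p dvd x"
proof
  assume p: "p > 0" and "echar p x = 1"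
  hence "cos (2 * pi * real_of_int x / real p) = 1" by (simp add: echar_def complex_eq_iff)
  then obtain n :: int where "2 * pi * real_of_int x / real p = real_of_int n * 2 * pi"
    by (auto simp: cos_one_2pi_int)
  hence "real_of_int x = real_of_int (n * int p)" using p by (simp add: field_simps)
  hence "x = n * int p" by (simp only: of_int_eq_iff)
  thus "int p dvd x" by simp
next
  assume p: "p > 0" and "int p dvd x"
  then obtain n where "x = int p * n" by blast
  hence "2 * pi * real_of_int x / real p = 2 * pi * real_of_int n" using p by simp
  thus "echar p x = 1" by (simp add: echar_def cis_multiple_2pi)
qed

lemma echar_cong: "[x = y] (mod int p) \<Longrightarrow> p > 0 \<Longrightarrow> echar p x = echar p y"
proof -
  assume "[x = y] (mod int p)" "p > 0"
  hence "echar p (x - y) = 1" by (simp add: echar_eq_1_iff cong_iff_dvd_diff)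
  thus ?thesis using echar_add[of p "x - y" y] by simp
qed

lemma echar_mult_nat: "echar p (a * int n) = echar p a ^ n"
  by (induction n) (simp_all add: echar_add distrib_left)

lemma sum_echar_linear:
  assumes p: "p > 0"
  shows "(\<Sum>x\<in>{0..<int p}. echar p (a * x + b)) = (if int p dvd a then of_nat p * echar p b else 0)"
proof -
  have "(\<Sum>x\<in>{0..<int p}. echar p (a * x + b)) = (\<Sum>n<p. echar p (a * int n + b))"
    by (rule sum.reindex_bij_witness[of _ int nat]) auto
  also have "\<dots> = (\<Sum>n<p. echar p a ^ n) * echar p b"
    by (simp add: echar_add echar_mult_nat sum_distrib_right)
  also have "(\<Sum>n<p. echar p a ^ n) = (if int p dvd a then of_nat p else 0)"
  proof (cases "int p dvd a")
    case True
    hence "echar p a = 1" using p by (simp add: echar_eq_1_iff)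
    thus ?thesis using True by simp
  next
    case False
    hence "echar p a \<noteq> 1" using p by (simp add: echar_eq_1_iff)
    moreover have "echar p a ^ p = 1" using p by (simp add: echar_eq_1_iff flip: echar_mult_nat)
    ultimately show ?thesis using False by (simp add: sum_gp_strict)
  qed
  finally show ?thesis by simp
qed

context prime_field_in_ring
begin

section \<open>Exponential sums over small multiplicative groups\<close>

text \<open>All losses are powers of one parameter \<open>y\<close>. The set \<open>D\<close> from the lemma of Balog, Szemeredi and
Gowers has doubling constant \<open>y^11\<close>, so multipliers with a large intersection are covered with
constant \<open>y^55 = (y^11)^5\<close>, and after \<open>J\<close> steps of growth the constant is \<open>y^(55 * 25^J)\<close>. Comparing
the upper bound for \<open>D + \<xi> D\<close> that this implies with the lower bound for a typical \<open>\<xi>\<close> forces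
\<open>D\<close>, and with it \<open>L\<close>, to be very small or very large. The number \<open>10923\<close> exceeds
\<open>4096 * 8/3\<close>, so that the constants of that lemma are absorbed by one factor \<open>y\<close>.\<close>

lemma dilation_dichotomy:
  fixes y :: real
  assumes L: "L \<subseteq> F" "L' \<subseteq> F" "L \<noteq> {}"
    and G: "G \<subseteq> F" "0 \<notin> G" "\<And>g. g \<in> G \<Longrightarrow> (*) g ` L' \<subseteq> L'"
    and y: "y \<ge> 10923"
    and growth: "real (card L') \<le> y * real (card L)"
    and many: "1 / y * real (card L) ^ 2 \<le> (\<Sum>x\<in>L. real (card {a \<in> L. a - x \<in> L'}))"
    and big: "4 * y ^ 4 \<le> real (card G)" "real p \<le> (real (card G) / y ^ 4) powr ((3/2) ^ J)"
  shows "real (card L) \<le> y ^ (55 * 25 ^ J + 36) \<or> real p \<le> y ^ (55 * 25 ^ J + 36) * real (card L)"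
proof -
  have fin: "finite L" "finite L'" "finite G" using L G card_F finite_subset by blast+
  have y0: "y > 0" using y by simp
  obtain D where D: "D \<subseteq> L'" "3/8 * (1/y) * real (card L) \<le> real (card D)"
    "real (card (diffset D D)) * ((1/y) ^ 5 * real (card L) ^ 3) \<le> 4096 * real (card L') ^ 4"
    using balog_szemeredi_gowers[OF fin(1,2) L(3) _ many] y0 by auto
  have DF: "D \<subseteq> F" "finite D" using D L fin finite_subset by blast+
  define l where "l = real (card L)"
  define l' where "l' = real (card L')"
  define d where "d = real (card D)"
  define s where "s = real (card (diffset D D))"
  have l: "l > 0" using fin L by (simp add: l_def card_gt_0_iff)
  have ld: "3 * l \<le> 8 * y * d" using D(2) y0 by (simp add: l_def d_def field_simps)
  have d: "d > 0"
  proof -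
    have "0 < y * d" using ld l by linarith
    thus ?thesis using y0 by (simp add: zero_less_mult_iff)
  qed
  have Dne: "D \<noteq> {}" using d by (auto simp: d_def)
  have l': "l' \<le> y * l" using growth by (simp add: l_def l'_def)
  have dl': "d \<le> l'" unfolding d_def l'_def using D fin by (auto intro: card_mono)
  have K: "s \<le> y ^ 11 * d"
  proof -
    have "s * l ^ 3 \<le> y ^ 5 * (4096 * l' ^ 4)"
    proof -
      have "s * l ^ 3 = y ^ 5 * (s * ((1/y) ^ 5 * l ^ 3))" using y0 by (simp add: field_simps)
      also have "\<dots> \<le> y ^ 5 * (4096 * l' ^ 4)"
        using D(3) y0 by (intro mult_left_mono) (auto simp: s_def l_def l'_def)
      finally show ?thesis .
    qed
    also have "\<dots> \<le> y ^ 5 * (4096 * (y * l) ^ 4)"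
      using l' y0 by (intro mult_left_mono power_mono) (auto simp: l'_def)
    also have "\<dots> = (4096 * y ^ 9 * l) * l ^ 3" by (simp add: power_mult_distrib eval_nat_numeral)
    finally have "s \<le> 4096 * y ^ 9 * l" using l by simp
    also have "\<dots> \<le> 4096 * y ^ 9 * (8 / 3 * (y * d))" using ld y0 by (intro mult_left_mono) auto
    also have "\<dots> = (32768 / 3) * (y ^ 10 * d)" by (simp add: eval_nat_numeral)
    also have "\<dots> \<le> y * (y ^ 10 * d)" using y d by (intro mult_right_mono) auto
    finally show ?thesis by (simp add: eval_nat_numeral)
  qed
  have doub: "real (card (diffset D D)) \<le> y ^ 11 * real (card D)" using K by (simp add: s_def d_def)
  have ly: "l \<le> y ^ 2 * d"
  proof -
    have "8 * (y * d) \<le> 3 * (y * (y * d))" using y d by (intro order_trans[OF mult_right_mono[of 8 "3 * y"]]) auto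
    thus ?thesis using ld by (simp add: power2_eq_square)
  qed
  have ly': "l' \<le> y ^ 3 * d"
  proof -
    have "y * l \<le> y * (y ^ 2 * d)" using ly y0 by (intro mult_left_mono) auto
    thus ?thesis using l' by (simp add: eval_nat_numeral)
  qed
  have Gne: "G \<noteq> {}"
  proof
    assume "G = {}"
    hence "4 * y ^ 4 \<le> 0" using big(1) by simp
    moreover have "4 * y ^ 4 > 0" using y0 by simp
    ultimately show False by linarith
  qed
  obtain B where B: "B \<subseteq> F" "real (card G) * real (card D) \<le> 2 * real (card L') * real (card B)"
    "\<And>\<xi>. \<xi> \<in> B \<Longrightarrow> real (card D) ^ 2 \<le> 2 * real (card L') * real (card (D \<inter> (*) \<xi> ` D))"
  proof (rule many_dilates_meet[OF DF(1) Dne G(1,2) Gne fin(2)])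
    show "(*) g ` D \<subseteq> L'" if "g \<in> G" for g using G(3)[OF that] D(1) by blast
  qed blast
  have y3: "2 * l' * x \<le> y ^ 4 * d * x" if "x \<ge> 0" for x
  proof -
    have "2 * l' \<le> 2 * (y ^ 3 * d)" using ly' by simp
    also have "\<dots> \<le> y * (y ^ 3 * d)" using y d by (intro mult_right_mono) auto
    finally show ?thesis using that by (intro mult_right_mono) (auto simp: eval_nat_numeral)
  qed
  have "real (card G) * d \<le> y ^ 4 * d * real (card B)"
    using B(2) y3[of "real (card B)"] by (simp add: d_def l'_def)
  hence "real (card G) \<le> y ^ 4 * real (card B)" using d by simp
  hence GB: "real (card G) / y ^ 4 \<le> real (card B)" using y0 by (simp add: field_simps)
  moreover have "4 \<le> real (card G) / y ^ 4" using big(1) y0 by (simp add: field_simps)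
  ultimately have B4: "card B \<ge> 4" by linarith
  have cov: "covered (y ^ 55) D \<xi>" if "\<xi> \<in> B" for \<xi>
  proof (rule covered_of_large_intersection[OF DF(2) doub, where Y = "D \<inter> (*) \<xi> ` D"])
    let ?Y = "real (card (D \<inter> (*) \<xi> ` D))"
    have "d * d \<le> y ^ 4 * d * ?Y"
      using B(3)[OF that] y3[of ?Y] by (simp add: d_def l'_def power2_eq_square)
    hence dY: "d \<le> y ^ 4 * ?Y" using d by simp
    hence "0 < y ^ 4 * ?Y" using d by linarith
    thus "D \<inter> (*) \<xi> ` D \<noteq> {}" by auto
    have "y ^ 11 * d \<le> y ^ 11 * (y ^ 4 * ?Y)" using dY y0 by (intro mult_left_mono) auto
    also have "\<dots> = y ^ 15 * ?Y" by (simp flip: power_add mult.assoc)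
    also have "\<dots> \<le> y ^ 55 * ?Y" using y by (intro mult_right_mono power_increasing) auto
    finally show "y ^ 11 * real (card D) \<le> y ^ 55 * ?Y" by (simp add: d_def)
  qed auto
  have "(y ^ 11) ^ 5 \<le> y ^ 55" "1 \<le> y ^ 55" "0 \<le> y ^ 11"
    using y by (simp_all flip: power_mult add: one_le_power)
  from covered_growth_iterated[OF DF(2) Dne doub this B(1) B4 cov, of J]
  obtain R where R: "R \<subseteq> F" "min (real p / 2) (real (card B) powr ((3/2) ^ J)) \<le> real (card R)"
    "card R \<ge> 2" "\<And>x. x \<in> R \<Longrightarrow> covered ((y ^ 55) ^ 25 ^ J) D x" by auto
  define r where "r = real (card R)"
  have r: "r > 0" using R by (simp add: r_def)
  have pr: "real p \<le> 2 * r"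
  proof -
    have "(real (card G) / y ^ 4) powr ((3/2) ^ J) \<le> real (card B) powr ((3/2) ^ J)"
      using GB y0 by (intro powr_mono2) auto
    thus ?thesis using R(2) big(2) by (auto simp: r_def min_def split: if_splits)
  qed
  have "R \<noteq> {}" using R by auto
  then obtain \<xi> where x: "\<xi> \<in> R"
    "d ^ 2 * r \<le> real (card (sumset D ((*) \<xi> ` D))) * (r + d ^ 2)"
    using large_sumset_of_dilate[OF DF(1) Dne R(1)] by (auto simp: d_def r_def)
  define Y where "Y = y ^ (55 * 25 ^ J + 33)"
  have Y: "Y > 0" using y0 by (simp add: Y_def)
  have "real (card (sumset D ((*) \<xi> ` D))) \<le> (y ^ 55) ^ 25 ^ J * (y ^ 11) ^ 3 * real (card D)"
    by (rule covered_imp_small_sumset[OF DF(2) Dne doub R(4)[OF x(1)]])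
  also have "\<dots> = Y * d" by (simp add: Y_def d_def power_add flip: power_mult)
  finally have "d ^ 2 * r \<le> Y * d * (r + d ^ 2)"
    using x(2) r by (smt (verit) mult_right_mono zero_le_power2)
  hence "d * (d * r) \<le> d * (Y * (r + d ^ 2))" by (simp add: power2_eq_square mult_ac)
  hence main: "d * r \<le> Y * (r + d ^ 2)" using d by simp
  have Ey: "y ^ (55 * 25 ^ J + 36) = Y * y ^ 3" unfolding Y_def by (subst power_add[symmetric], rule arg_cong[of _ _ "power y"]) simp
  show ?thesis
  proof (cases "d ^ 2 \<le> r")
    case True
    have "Y * (r + d ^ 2) \<le> Y * (2 * r)" using True Y by (intro mult_left_mono) auto
    hence "d * r \<le> (2 * Y) * r" using main by simp
    hence "d \<le> 2 * Y" using r by simp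
    hence "y ^ 2 * d \<le> y ^ 2 * (2 * Y)" using y0 by (intro mult_left_mono) auto
    also have "\<dots> \<le> y ^ 2 * (y * Y)" using y Y by (intro mult_left_mono mult_right_mono) auto
    finally have "l \<le> Y * y ^ 3" using ly by (simp add: eval_nat_numeral mult_ac)
    thus ?thesis unfolding Ey l_def by blast
  next
    case False
    hence "Y * (r + d ^ 2) \<le> Y * (2 * d ^ 2)" using Y by (intro mult_left_mono) auto
    hence "d * r \<le> d * (2 * Y * d)" using main by (simp add: power2_eq_square mult_ac)
    hence "r \<le> 2 * Y * d" using d by simp
    also have "\<dots> \<le> 2 * Y * (y * l)" using Y dl' l' by (intro mult_left_mono) auto
    finally have "real p \<le> 4 * (Y * y * l)" using pr by (simp add: mult_ac)
    also have "\<dots> \<le> y ^ 2 * (Y * y * l)"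
    proof (intro mult_right_mono)
      have "y * 1 \<le> y * y" using y by (intro mult_left_mono) auto
      thus "4 \<le> y ^ 2" unfolding power2_eq_square using y by linarith
    qed (use Y y0 l in auto)
    also have "\<dots> = Y * y ^ 3 * l" by (simp add: eval_nat_numeral mult_ac)
    finally show ?thesis unfolding Ey l_def by blast
  qed
qed

end

definition char_sum :: "nat \<Rightarrow> int set \<Rightarrow> int \<Rightarrow> complex" where
  "char_sum p H a = (\<Sum>h\<in>H. echar p (a * h))"

lemma norm_char_sum_le: "norm (char_sum p H a) \<le> real (card H)"
  unfolding char_sum_def by (rule order_trans[OF norm_sum]) simp

lemma char_sum_mod: "p > 0 \<Longrightarrow> char_sum p H (a mod int p) = char_sum p H a"
  unfolding char_sum_def by (intro sum.cong refl echar_cong cong_mult) auto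

lemma char_sum_parseval:
  assumes p: "p > 0" and H: "H \<subseteq> {0..<int p}"
  shows "(\<Sum>a\<in>{0..<int p}. (norm (char_sum p H a))\<^sup>2) = real p * real (card H)"
proof -
  have fin: "finite H" using H finite_subset by blast
  have "complex_of_real (\<Sum>a\<in>{0..<int p}. (norm (char_sum p H a))\<^sup>2)
      = (\<Sum>a\<in>{0..<int p}. \<Sum>h\<in>H. \<Sum>h'\<in>H. echar p ((h - h') * a + 0))"
    unfolding char_sum_def of_real_sum complex_norm_square cnj_sum sum_product cnj_echar
    by (intro sum.cong refl) (simp add: algebra_simps flip: echar_add)
  also have "\<dots> = (\<Sum>h\<in>H. \<Sum>a\<in>{0..<int p}. \<Sum>h'\<in>H. echar p ((h - h') * a + 0))"
    by (rule sum.swap)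
  also have "\<dots> = (\<Sum>h\<in>H. \<Sum>h'\<in>H. \<Sum>a\<in>{0..<int p}. echar p ((h - h') * a + 0))"
    by (intro sum.cong refl sum.swap)
  also have "\<dots> = (\<Sum>h\<in>H. \<Sum>h'\<in>H. if h = h' then of_nat p else 0)"
  proof (intro sum.cong refl)
    fix h h' assume h: "h \<in> H" "h' \<in> H"
    have "int p dvd h - h' \<longleftrightarrow> h = h'"
      using h H by (metis atLeastLessThan_iff cong_iff_dvd_diff cong_less_imp_eq_int eq_iff_diff_eq_0 dvd_0_right subsetD)
    thus "(\<Sum>a\<in>{0..<int p}. echar p ((h - h') * a + 0)) = (if h = h' then of_nat p else 0)"
      using sum_echar_linear[OF p, of "h - h'" 0] by simp
  qed
  also have "\<dots> = of_real (real p * real (card H))" using fin by simp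
  finally show ?thesis by (simp only: of_real_eq_iff)
qed

text \<open>Multiply each sum by a unimodular factor that makes it positive, exchange the summations and apply
Cauchy--Schwarz to the sum over \<open>H\<close>. If all sums over \<open>A\<close> are large, then so are the sums at many
differences of elements of \<open>A\<close>.\<close>

lemma large_spectrum_differences:
  assumes fin: "finite A"
  shows "(\<Sum>a\<in>A. norm (char_sum p H a))\<^sup>2 \<le> real (card H) * (\<Sum>a\<in>A. \<Sum>b\<in>A. norm (char_sum p H (a - b)))"
proof -
  define c where "c = (\<lambda>a. cnj (sgn (char_sum p H a)))"
  define W where "W = (\<lambda>h. \<Sum>a\<in>A. c a * echar p (a * h))"
  have c1: "norm (c a) \<le> 1" for a by (simp add: c_def norm_sgn)
  have "complex_of_real (\<Sum>a\<in>A. norm (char_sum p H a)) = (\<Sum>a\<in>A. c a * char_sum p H a)"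
    unfolding of_real_sum
  proof (intro sum.cong refl)
    fix a
    have "c a * char_sum p H a = cnj (char_sum p H a) * char_sum p H a / of_real (norm (char_sum p H a))"
      by (simp add: c_def sgn_div_norm scaleR_conv_of_real field_simps)
    also have "\<dots> = of_real ((norm (char_sum p H a))\<^sup>2) / of_real (norm (char_sum p H a))"
      by (simp only: complex_norm_square mult.commute)
    also have "\<dots> = of_real (norm (char_sum p H a))" by (simp add: power2_eq_square)
    finally show "of_real (norm (char_sum p H a)) = c a * char_sum p H a" by simp
  qed
  also have "\<dots> = (\<Sum>a\<in>A. \<Sum>h\<in>H. c a * echar p (a * h))"
    by (simp add: char_sum_def sum_distrib_left)
  also have "\<dots> = (\<Sum>h\<in>H. W h)" unfolding W_def by (rule sum.swap)
  finally have "complex_of_real (\<Sum>a\<in>A. norm (char_sum p H a)) = (\<Sum>h\<in>H. W h)" .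
  hence "norm (complex_of_real (\<Sum>a\<in>A. norm (char_sum p H a))) \<le> (\<Sum>h\<in>H. norm (W h))"
    by (simp only: norm_sum)
  hence "(\<Sum>a\<in>A. norm (char_sum p H a)) \<le> (\<Sum>h\<in>H. norm (W h))"
    by (simp only: norm_of_real)
  hence "(\<Sum>a\<in>A. norm (char_sum p H a))\<^sup>2 \<le> (\<Sum>h\<in>H. norm (W h))\<^sup>2"
    by (intro power_mono sum_nonneg) auto
  also have "\<dots> \<le> real (card H) * (\<Sum>h\<in>H. (norm (W h))\<^sup>2)" by (rule sum_power2_le_card_mult)
  also have "\<dots> \<le> real (card H) * (\<Sum>a\<in>A. \<Sum>b\<in>A. norm (char_sum p H (a - b)))"
  proof (intro mult_left_mono)
    have "complex_of_real (\<Sum>h\<in>H. (norm (W h))\<^sup>2)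
      = (\<Sum>h\<in>H. \<Sum>a\<in>A. \<Sum>b\<in>A. c a * cnj (c b) * echar p ((a - b) * h))"
      unfolding W_def of_real_sum complex_norm_square cnj_sum sum_product complex_cnj_mult cnj_echar
      by (intro sum.cong refl) (simp add: algebra_simps echar_add[of p "_ * _" "- (_ * _)", unfolded add_uminus_conv_diff])
    also have "\<dots> = (\<Sum>a\<in>A. \<Sum>h\<in>H. \<Sum>b\<in>A. c a * cnj (c b) * echar p ((a - b) * h))" by (rule sum.swap)
    also have "\<dots> = (\<Sum>a\<in>A. \<Sum>b\<in>A. \<Sum>h\<in>H. c a * cnj (c b) * echar p ((a - b) * h))"
      by (intro sum.cong refl sum.swap)
    also have "\<dots> = (\<Sum>a\<in>A. \<Sum>b\<in>A. c a * cnj (c b) * char_sum p H (a - b))"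
      by (simp add: char_sum_def sum_distrib_left)
    finally have e: "complex_of_real (\<Sum>h\<in>H. (norm (W h))\<^sup>2) = (\<Sum>a\<in>A. \<Sum>b\<in>A. c a * cnj (c b) * char_sum p H (a - b))" .
    have "(\<Sum>h\<in>H. (norm (W h))\<^sup>2) = norm (complex_of_real (\<Sum>h\<in>H. (norm (W h))\<^sup>2))"
      unfolding norm_of_real by (simp add: sum_nonneg)
    also have "\<dots> \<le> (\<Sum>a\<in>A. norm (\<Sum>b\<in>A. c a * cnj (c b) * char_sum p H (a - b)))"
      unfolding e by (rule norm_sum)
    also have "\<dots> \<le> (\<Sum>a\<in>A. \<Sum>b\<in>A. norm (c a * cnj (c b) * char_sum p H (a - b)))"
      by (intro sum_mono norm_sum)
    also have "\<dots> \<le> (\<Sum>a\<in>A. \<Sum>b\<in>A. norm (char_sum p H (a - b)))"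
    proof (intro sum_mono)
      fix a b
      have "norm (c a) * norm (c b) \<le> 1 * 1" using c1 by (intro mult_mono) auto
      thus "norm (c a * cnj (c b) * char_sum p H (a - b)) \<le> norm (char_sum p H (a - b))"
        by (simp add: norm_mult mult_left_le_one_le)
    qed
    finally show "(\<Sum>h\<in>H. (norm (W h))\<^sup>2) \<le> (\<Sum>a\<in>A. \<Sum>b\<in>A. norm (char_sum p H (a - b)))" .
  qed auto
  finally show ?thesis .
qed

lemma char_sum_invariant:
  assumes p: "prime p" and H: "H \<subseteq> {1..<int p}" "\<And>g h. g \<in> H \<Longrightarrow> h \<in> H \<Longrightarrow> g * h mod int p \<in> H"
    and g: "g \<in> H"
  shows "char_sum p H (g * a) = char_sum p H a"
proof -
  have p0: "p > 0" using p prime_gt_0_nat by blast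
  have fin: "finite H" using H finite_subset by blast
  have ng: "\<not> int p dvd g" using g H(1) zdvd_not_zless by force
  have inj: "inj_on (\<lambda>h. g * h mod int p) H"
  proof (rule inj_onI)
    fix h h' assume h: "h \<in> H" "h' \<in> H" and eq: "g * h mod int p = g * h' mod int p"
    have "int p dvd g * (h - h')" using eq by (simp add: mod_eq_dvd_iff right_diff_distrib)
    hence "int p dvd h - h'" using ng p by (simp add: prime_dvd_mult_iff)
    hence "h mod int p = h' mod int p" by (simp add: mod_eq_dvd_iff)
    moreover have "h mod int p = h" "h' mod int p = h'" using h H(1) by (force intro: mod_pos_pos_trivial)+
    ultimately show "h = h'" by simp
  qed
  hence img: "(\<lambda>h. g * h mod int p) ` H = H"
    using H(2)[OF g] fin by (intro endo_inj_surj) auto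
  have "char_sum p H a = (\<Sum>h\<in>(\<lambda>h. g * h mod int p) ` H. echar p (a * h))"
    unfolding img char_sum_def ..
  also have "\<dots> = (\<Sum>h\<in>H. echar p (a * (g * h mod int p)))"
    by (subst sum.reindex[OF inj]) simp
  also have "\<dots> = (\<Sum>h\<in>H. echar p (g * a * h))"
  proof (intro sum.cong refl echar_cong[OF _ p0])
    fix h
    have "[a * (g * h mod int p) = a * (g * h)] (mod int p)" by (intro cong_mult) auto
    thus "[a * (g * h mod int p) = g * a * h] (mod int p)" by (simp add: mult_ac)
  qed
  finally show ?thesis by (simp add: char_sum_def)
qed

text \<open>The theorem of Bourgain, Glibichuk and Konyagin for multiplicative groups of order at least
\<open>p^\<epsilon>\<close>. A set of nonzero residues that is closed under multiplication is such a group.\<close>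

theorem subgroup_exponential_sum:
  fixes \<epsilon> :: real
  assumes \<epsilon>: "\<epsilon> > 0"
  shows "\<exists>\<gamma>>0. \<exists>P::real. \<forall>(p::nat) H a. prime p \<longrightarrow> P \<le> real p \<longrightarrow> H \<subseteq> {1..<int p} \<longrightarrow>
    (\<forall>g\<in>H. \<forall>h\<in>H. g * h mod int p \<in> H) \<longrightarrow> real p powr \<epsilon> \<le> real (card H) \<longrightarrow> \<not> int p dvd a \<longrightarrow>
    norm (char_sum p H a) \<le> real p powr (- \<gamma>) * real (card H)"
proof -
  obtain J where J: "2 / \<epsilon> < (3/2::real) ^ J" using real_arch_pow[of "3/2" "2 / \<epsilon>"] by auto
  define E where "E = (55 * 25 ^ J + 36 :: nat)"
  define \<delta> where "\<delta> = \<epsilon> / (2 * (real E + 10))"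
  define M where "M = Suc (nat \<lceil>1 / \<delta>\<rceil>)"
  define \<gamma> where "\<gamma> = \<delta> / 3 ^ M"
  \<comment> \<open>\<open>J\<close> steps of growth lead from \<open>p^(\<epsilon>/2)\<close> to \<open>p\<close>. The tolerance \<open>\<delta>\<close> is so small that the
    loss \<open>p^(\<delta> E)\<close> of the dichotomy stays below \<open>p^\<epsilon>\<close>. Among the \<open>M > 1/\<delta>\<close> levels one grows
    by a factor of at most \<open>p^\<delta>\<close>, and all of them have thresholds of at least \<open>p^-\<delta>\<close>.\<close>
  define P where "P = max (10923 powr (1 / \<delta>)) (2 powr (1 / \<gamma>))"
  have E10: "2 * (real E + 10) > 0" by simp
  have \<delta>: "\<delta> > 0" using \<epsilon> E10 by (simp add: \<delta>_def)
  have \<gamma>: "\<gamma> > 0" using \<delta> by (simp add: \<gamma>_def)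
  have \<delta>\<epsilon>: "\<delta> * (real E + 10) = \<epsilon> / 2" using E10 by (simp add: \<delta>_def field_simps)
  have \<delta>1: "\<delta> * real E + \<delta> * 10 = \<epsilon> / 2" using \<delta>\<epsilon> by (simp add: distrib_left)
  have \<delta>E: "\<delta> * real E \<ge> 0" using \<delta> by simp
  have M: "\<delta> * real M > 1"
  proof -
    have "1 / \<delta> < real M" unfolding M_def using real_nat_ceiling_ge[of "1 / \<delta>"] by linarith
    thus ?thesis using \<delta> by (simp add: field_simps)
  qed
  show ?thesis
  proof (rule exI[of _ \<gamma>], intro conjI \<gamma>, rule exI[of _ P], intro allI impI)
    fix p :: nat and H :: "int set" and a :: int
    assume p: "prime p" and pP: "P \<le> real p" and H: "H \<subseteq> {1..<int p}"
      and mult: "\<forall>g\<in>H. \<forall>h\<in>H. g * h mod int p \<in> H"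
      and Hbig: "real p powr \<epsilon> \<le> real (card H)" and a: "\<not> int p dvd a"
    show "norm (char_sum p H a) \<le> real p powr (- \<gamma>) * real (card H)"
    proof (rule ccontr)
      assume "\<not> ?thesis"
      hence anorm: "real p powr (- \<gamma>) * real (card H) < norm (char_sum p H a)" by simp
      interpret prime_field_in_ring p "component_unit p" by (rule prime_field_in_residues[OF p])
      have p0: "p > 0" "real p > 1" using p_gt by auto
      define x where "x = real p"
      define y where "y = x powr \<delta>"
      define h where "h = real (card H)"
      have x1: "x > 1" using p0 by (simp add: x_def)
      have finH: "finite H" using H finite_subset by blast
      have h: "h > 0" "x powr \<epsilon> \<le> h"
      proof -
        show "x powr \<epsilon> \<le> h" using Hbig by (simp add: x_def h_def)
        moreover have "x powr \<epsilon> > 0" using x1 by simp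
        ultimately show "h > 0" by linarith
      qed
      have ypow: "y ^ n = x powr (\<delta> * real n)" for n
        unfolding y_def using x1 by (simp add: powr_powr flip: powr_realpow)
      have y: "y \<ge> 10923"
      proof -
        have "10923 powr (1 / \<delta>) \<le> x" using pP by (simp add: P_def x_def)
        hence "(10923 powr (1 / \<delta>)) powr \<delta> \<le> x powr \<delta>" using \<delta> by (intro powr_mono2) auto
        thus ?thesis using \<delta> by (simp add: powr_powr y_def)
      qed
      have x2: "x powr \<gamma> \<ge> 2"
      proof -
        have "2 powr (1 / \<gamma>) \<le> x" using pP by (simp add: P_def x_def)
        hence "(2 powr (1 / \<gamma>)) powr \<gamma> \<le> x powr \<gamma>" using \<gamma> by (intro powr_mono2) auto
        thus ?thesis using \<gamma> by (simp add: powr_powr)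
      qed
      define \<alpha> where "\<alpha> = (\<lambda>j::nat. x powr (- (\<gamma> * 3 ^ j)))"
      have \<alpha>0: "\<alpha> j > 0" for j using x1 by (simp add: \<alpha>_def)
      have \<alpha>Suc: "\<alpha> (Suc j) = \<alpha> j ^ 3" for j
        unfolding \<alpha>_def using x1 by (simp add: powr_powr mult_ac flip: powr_realpow)
      have \<alpha>half: "\<alpha> j \<le> 1 / 2" for j
      proof -
        have "\<alpha> j \<le> x powr (- \<gamma>)" unfolding \<alpha>_def using x1 \<gamma> by (intro powr_mono) auto
        also have "\<dots> \<le> 1 / 2" using x2 x1 by (simp add: powr_minus field_simps)
        finally show ?thesis .
      qed
      have \<alpha>y: "1 / y \<le> \<alpha> j" if "j \<le> M" for j
      proof -
        have "\<gamma> * 3 ^ j \<le> \<gamma> * 3 ^ M" using that \<gamma> by (intro mult_left_mono power_increasing) auto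
        hence "- \<delta> \<le> - (\<gamma> * 3 ^ j)" by (simp add: \<gamma>_def)
        hence "x powr (- \<delta>) \<le> \<alpha> j" unfolding \<alpha>_def using x1 by (intro powr_mono) auto
        thus ?thesis by (simp add: y_def powr_minus field_simps)
      qed
      define N where "N = (\<lambda>b. norm (char_sum p H b))"
      define Sp where "Sp = (\<lambda>j. {b \<in> {0..<int p}. \<alpha> j * h \<le> N b})"
      have Sp: "Sp j \<subseteq> {0..<int p}" "finite (Sp j)" for j
        unfolding Sp_def by (auto intro: finite_subset[of _ "{0..<int p}"])
      have Nmod: "N (b mod int p) = N b" for b by (simp add: N_def char_sum_mod[OF p0(1)])
      have inv: "N (g * b) = N b" if "g \<in> H" for g b
        using char_sum_invariant[OF p H _ that] mult by (simp add: N_def)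
      have modSp: "b mod int p \<in> Sp j \<longleftrightarrow> \<alpha> j * h \<le> N b" for b j
        using p0 by (simp add: Sp_def Nmod)
      have ngH: "\<not> int p dvd g" if "g \<in> H" for g using that H zdvd_not_zless by force
      \<comment> \<open>The spectrum is invariant under \<open>H\<close>, so it contains the orbit of \<open>a\<close>.\<close>
      have hSp: "h \<le> real (card (Sp j))" for j
      proof -
        have inj: "inj_on (\<lambda>g. g * a mod int p) H"
        proof (rule inj_onI)
          fix g g' assume g: "g \<in> H" "g' \<in> H" and eq: "g * a mod int p = g' * a mod int p"
          have "int p dvd (g - g') * a" using eq by (simp add: mod_eq_dvd_iff left_diff_distrib)
          hence "int p dvd g - g'" using a p by (simp add: prime_dvd_mult_iff)
          hence "g mod int p = g' mod int p" by (simp add: mod_eq_dvd_iff)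
          moreover have "g mod int p = g" "g' mod int p = g'" using g H by (force intro: mod_pos_pos_trivial)+
          ultimately show "g = g'" by simp
        qed
        have "\<alpha> j \<le> x powr (- \<gamma>)" unfolding \<alpha>_def using x1 \<gamma> by (intro powr_mono) auto
        hence "\<alpha> j * h \<le> x powr (- \<gamma>) * h" using h by (intro mult_right_mono) auto
        also have "\<dots> \<le> N a" using anorm by (simp add: x_def h_def N_def)
        finally have "(\<lambda>g. g * a mod int p) ` H \<subseteq> Sp j" by (auto simp: modSp inv)
        hence "card ((\<lambda>g. g * a mod int p) ` H) \<le> card (Sp j)" using Sp by (intro card_mono)
        thus ?thesis by (simp add: card_image[OF inj] h_def)
      qed
      have h1: "h \<ge> 1" using h by (simp add: h_def)
      have "\<exists>j<M. real (card (Sp (Suc j))) \<le> y * real (card (Sp j))"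
      proof (rule ccontr)
        assume "\<not> ?thesis"
        hence step: "y * real (card (Sp j)) \<le> real (card (Sp (Suc j)))" if "j < M" for j
          using that by (auto simp: not_le intro: less_imp_le)
        have "y ^ j \<le> real (card (Sp j))" if "j \<le> M" for j
          using that
        proof (induction j)
          case 0
          thus ?case using hSp[of 0] h1 by simp
        next
          case (Suc j)
          have "y * y ^ j \<le> y * real (card (Sp j))" using Suc y by (intro mult_left_mono) auto
          thus ?case using step[of j] Suc by simp
        qed
        hence "y ^ M \<le> real (card (Sp M))" by simp
        also have "card (Sp M) \<le> card {0..<int p}" using Sp by (intro card_mono) auto
        finally have "y ^ M \<le> x" by (simp add: x_def)
        moreover have "x powr 1 < x powr (\<delta> * real M)" using M x1 by (intro powr_less_mono) auto
        ultimately show False using x1 by (simp add: ypow)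
      qed
      then obtain j where j: "j < M" "real (card (Sp (Suc j))) \<le> y * real (card (Sp j))" by blast
      define l where "l = real (card (Sp j))"
      have l: "h \<le> l" "l > 0" using hSp[of j] h by (auto simp: l_def)
      \<comment> \<open>Parseval's identity bounds \<open>l\<close> by about \<open>x / h\<close>, which excludes the second alternative
        of the dichotomy.\<close>
      have "l * (\<alpha> j * h)\<^sup>2 = (\<Sum>b\<in>Sp j. (\<alpha> j * h)\<^sup>2)" by (simp add: l_def)
      also have "\<dots> \<le> (\<Sum>b\<in>Sp j. (N b)\<^sup>2)"
        using \<alpha>0[of j] h by (intro sum_mono power_mono) (auto simp: Sp_def)
      also have "\<dots> \<le> (\<Sum>b\<in>{0..<int p}. (N b)\<^sup>2)" using Sp by (intro sum_mono2) auto
      also have "\<dots> = x * h"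
        unfolding N_def x_def h_def using H by (intro char_sum_parseval p0) auto
      finally have pars: "l * (\<alpha> j) ^ 2 * h \<le> x" using h by (simp add: power2_eq_square)
      have lx: "l * x powr \<epsilon> \<le> x * y ^ 2"
      proof -
        have "1 / y \<le> \<alpha> j" using \<alpha>y j by simp
        hence "(1 / y) ^ 2 \<le> (\<alpha> j) ^ 2" using y by (intro power_mono) auto
        hence "l * (1 / y) ^ 2 * x powr \<epsilon> \<le> l * (\<alpha> j) ^ 2 * h" using l h by (intro mult_mono) auto
        hence "l * (1 / y) ^ 2 * x powr \<epsilon> \<le> x" using pars by linarith
        thus ?thesis using y by (simp add: power_divide field_simps)
      qed
      \<comment> \<open>A difference outside the next level contributes less than half of the average.\<close>
      have cnt: "1 / y * l\<^sup>2 \<le> (\<Sum>c\<in>Sp j. real (card {b \<in> Sp j. (b - c) mod int p \<in> Sp (Suc j)}))"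
        (is "_ \<le> ?cnt")
      proof -
        have "l * (\<alpha> j * h) = (\<Sum>b\<in>Sp j. \<alpha> j * h)" by (simp add: l_def)
        also have "\<dots> \<le> (\<Sum>b\<in>Sp j. N b)" by (intro sum_mono) (auto simp: Sp_def)
        finally have "(l * (\<alpha> j * h))\<^sup>2 \<le> (\<Sum>b\<in>Sp j. N b)\<^sup>2"
          using l \<alpha>0[of j] h by (intro power_mono) auto
        also have "\<dots> \<le> h * (\<Sum>b\<in>Sp j. \<Sum>c\<in>Sp j. N (b - c))"
          unfolding N_def h_def by (rule large_spectrum_differences[OF Sp(2)])
        also have "\<dots> \<le> h * (\<Sum>b\<in>Sp j. \<Sum>c\<in>Sp j. of_bool ((b - c) mod int p \<in> Sp (Suc j)) * h + (\<alpha> j)\<^sup>2 / 2 * h)"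
        proof (intro mult_left_mono sum_mono)
          fix b c
          show "N (b - c) \<le> of_bool ((b - c) mod int p \<in> Sp (Suc j)) * h + (\<alpha> j)\<^sup>2 / 2 * h"
          proof (cases "(b - c) mod int p \<in> Sp (Suc j)")
            case True
            have "N (b - c) \<le> h" by (simp add: N_def h_def norm_char_sum_le)
            moreover have "(\<alpha> j)\<^sup>2 / 2 * h \<ge> 0" using h by simp
            ultimately show ?thesis using True by simp
          next
            case False
            have "\<alpha> (Suc j) = \<alpha> j * (\<alpha> j)\<^sup>2" by (simp add: \<alpha>Suc eval_nat_numeral)
            also have "\<dots> \<le> 1 / 2 * (\<alpha> j)\<^sup>2" using \<alpha>half by (intro mult_right_mono) auto
            finally have "\<alpha> (Suc j) * h \<le> (\<alpha> j)\<^sup>2 / 2 * h" using h by (intro mult_right_mono) auto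
            thus ?thesis using False by (simp add: modSp)
          qed
        qed (use h in auto)
        also have "\<dots> = h * (h * ?cnt + l\<^sup>2 * ((\<alpha> j)\<^sup>2 / 2 * h))"
        proof -
          have "(\<Sum>b\<in>Sp j. \<Sum>c\<in>Sp j. of_bool ((b - c) mod int p \<in> Sp (Suc j)) * h)
             = (\<Sum>c\<in>Sp j. \<Sum>b\<in>Sp j. of_bool ((b - c) mod int p \<in> Sp (Suc j)) * h)" by (rule sum.swap)
          also have "\<dots> = h * ?cnt"
            unfolding sum_distrib_left by (intro sum.cong refl) (simp add: card_filter_eq_sum[OF Sp(2)] mult.commute flip: sum_distrib_left)
          finally show ?thesis by (simp add: sum.distrib l_def power2_eq_square)
        qed
        finally have "(h * h) * (l\<^sup>2 * (\<alpha> j)\<^sup>2) \<le> (h * h) * (?cnt + l\<^sup>2 * (\<alpha> j)\<^sup>2 / 2)"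
          by (simp add: power_mult_distrib power2_eq_square algebra_simps)
        hence "l\<^sup>2 * ((\<alpha> j)\<^sup>2 / 2) \<le> ?cnt" using h by simp
        moreover have "1 / y \<le> (\<alpha> j)\<^sup>2 / 2"
        proof -
          have "1 / y \<le> \<alpha> (Suc j)" using \<alpha>y j by simp
          also have "\<alpha> (Suc j) = \<alpha> j * (\<alpha> j)\<^sup>2" by (simp add: \<alpha>Suc eval_nat_numeral)
          also have "\<dots> \<le> 1 / 2 * (\<alpha> j)\<^sup>2" using \<alpha>half by (intro mult_right_mono) auto
          finally show ?thesis by simp
        qed
        hence "l\<^sup>2 * (1 / y) \<le> l\<^sup>2 * ((\<alpha> j)\<^sup>2 / 2)" by (intro mult_left_mono) auto
        ultimately show ?thesis by (simp add: mult.commute)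
      qed
      have inje: "inj_on emb (Sp i)" for i using emb_inj Sp inj_on_subset by blast
      have ce: "card (emb ` Sp i) = card (Sp i)" for i by (rule card_image[OF inje])
      have mem: "emb b \<in> emb ` Sp i \<longleftrightarrow> b mod int p \<in> Sp i" for b i
      proof
        assume "emb b \<in> emb ` Sp i"
        then obtain c where c: "c \<in> Sp i" "emb b = emb c" by blast
        hence "b mod int p = c mod int p" by (simp add: emb_eq_iff cong_def)
        moreover have "c mod int p = c" using c Sp(1)[of i] by (force intro: mod_pos_pos_trivial)
        ultimately show "b mod int p \<in> Sp i" using c by simp
      next
        assume "b mod int p \<in> Sp i"
        hence "emb (b mod int p) \<in> emb ` Sp i" by (rule imageI)
        thus "emb b \<in> emb ` Sp i" by (simp add: emb_mod)
      qed
      have embH: "inj_on emb H" using emb_inj H by (rule_tac inj_on_subset[OF emb_inj]) auto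
      have cH: "real (card (emb ` H)) = h" by (simp add: card_image[OF embH] h_def)
      have y45: "4 * y ^ 4 \<le> y ^ 5"
        using y by (simp add: eval_nat_numeral mult_right_mono)
      have "y ^ 5 \<le> h"
      proof -
        have "y ^ 5 \<le> x powr \<epsilon>" unfolding ypow using x1 \<delta>1 \<delta>E \<epsilon> \<delta> by (intro powr_mono) auto
        thus ?thesis using h by linarith
      qed
      hence big1: "4 * y ^ 4 \<le> real (card (emb ` H))" using y45 by (simp add: cH)
      have big2: "real p \<le> (real (card (emb ` H)) / y ^ 4) powr ((3/2) ^ J)"
      proof -
        have "x powr (\<epsilon> / 2) * y ^ 4 = x powr (\<epsilon> / 2 + \<delta> * 4)" by (simp add: ypow powr_add)
        also have "\<dots> \<le> x powr \<epsilon>" using x1 \<delta>1 \<delta>E \<epsilon> \<delta> by (intro powr_mono) auto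
        also have "\<dots> \<le> h" by (rule h)
        finally have "x powr (\<epsilon> / 2) \<le> h / y ^ 4" using y by (simp add: field_simps)
        hence "(x powr (\<epsilon> / 2)) powr ((3/2) ^ J) \<le> (h / y ^ 4) powr ((3/2) ^ J)"
          by (intro powr_mono2) auto
        moreover have "x powr 1 \<le> (x powr (\<epsilon> / 2)) powr ((3/2) ^ J)"
          unfolding powr_powr using J \<epsilon> x1 by (intro powr_mono) (auto simp: field_simps)
        ultimately show ?thesis using x1 by (simp add: cH x_def)
      qed
      have "real (card (emb ` Sp j)) \<le> y ^ E \<or> real p \<le> y ^ E * real (card (emb ` Sp j))"
        unfolding E_def
      proof (rule dilation_dichotomy[where L' = "emb ` Sp (Suc j)" and G = "emb ` H"])
        show "emb ` Sp j \<subseteq> F" "emb ` Sp (Suc j) \<subseteq> F" "emb ` H \<subseteq> F" by (auto simp: F_def)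
        show "emb ` Sp j \<noteq> {}" using l by (auto simp: l_def)
        show "0 \<notin> emb ` H"
        proof
          assume "0 \<in> emb ` H"
          then obtain g where "g \<in> H" "emb g = 0" by (metis imageE)
          thus False using ngH by (simp add: emb_eq_0_iff)
        qed
        show "(*) g ` emb ` Sp (Suc j) \<subseteq> emb ` Sp (Suc j)" if "g \<in> emb ` H" for g
        proof -
          from that obtain g' where g': "g' \<in> H" "g = emb g'" by blast
          have "g * emb b \<in> emb ` Sp (Suc j)" if b: "b \<in> Sp (Suc j)" for b
          proof -
            have "g' * b mod int p \<in> Sp (Suc j)" using b unfolding modSp inv[OF g'(1)] by (simp add: Sp_def)
            hence "emb (g' * b) \<in> emb ` Sp (Suc j)" by (simp only: mem)
            thus ?thesis by (simp only: g' emb_mult)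
          qed
          thus ?thesis by blast
        qed
        show "10923 \<le> y" by (rule y)
        show "real (card (emb ` Sp (Suc j))) \<le> y * real (card (emb ` Sp j))" using j by (simp add: ce)
        show "4 * y ^ 4 \<le> real (card (emb ` H))" by (rule big1)
        show "real p \<le> (real (card (emb ` H)) / y ^ 4) powr ((3/2) ^ J)" by (rule big2)
        have "(\<Sum>z\<in>emb ` Sp j. real (card {w \<in> emb ` Sp j. w - z \<in> emb ` Sp (Suc j)})) = ?cnt"
        proof (subst sum.reindex[OF inje], intro sum.cong refl, unfold comp_def)
          fix c
          have "{w \<in> emb ` Sp j. w - emb c \<in> emb ` Sp (Suc j)}
             = emb ` {b \<in> Sp j. emb b - emb c \<in> emb ` Sp (Suc j)}" by blast
          hence "{w \<in> emb ` Sp j. w - emb c \<in> emb ` Sp (Suc j)}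
             = emb ` {b \<in> Sp j. (b - c) mod int p \<in> Sp (Suc j)}"
            by (simp only: emb_diff[symmetric] mem)
          moreover have "inj_on emb {b \<in> Sp j. (b - c) mod int p \<in> Sp (Suc j)}"
            by (rule inj_on_subset[OF inje[of j]]) auto
          ultimately show "real (card {w \<in> emb ` Sp j. w - emb c \<in> emb ` Sp (Suc j)})
             = real (card {b \<in> Sp j. (b - c) mod int p \<in> Sp (Suc j)})" by (simp add: card_image)
        qed
        thus "1 / y * (real (card (emb ` Sp j)))\<^sup>2 \<le> (\<Sum>z\<in>emb ` Sp j. real (card {w \<in> emb ` Sp j. w - z \<in> emb ` Sp (Suc j)}))"
          using cnt by (simp add: ce l_def)
      qed
      hence "l \<le> y ^ E \<or> x \<le> y ^ E * l" by (simp add: ce l_def x_def)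
      thus False
      proof
        assume "l \<le> y ^ E"
        hence "x powr \<epsilon> \<le> x powr (\<delta> * real E)" using h l by (simp add: ypow)
        hence "\<epsilon> \<le> \<delta> * real E" using x1 by simp
        thus False using \<delta>1 \<delta> \<epsilon> by linarith
      next
        assume "x \<le> y ^ E * l"
        hence "x * x powr \<epsilon> \<le> y ^ E * (l * x powr \<epsilon>)" using x1 by (simp add: mult_right_mono flip: mult.assoc)
        also have "\<dots> \<le> y ^ E * (x * y ^ 2)" using lx y by (intro mult_left_mono) auto
        finally have "x * x powr \<epsilon> \<le> x * y ^ (E + 2)" by (simp only: power_add mult_ac)
        hence "x powr \<epsilon> \<le> y ^ (E + 2)" using x1 by simp
        hence "x powr \<epsilon> \<le> x powr (\<delta> * real (E + 2))" by (simp only: ypow)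
        hence "\<epsilon> \<le> \<delta> * real (E + 2)" using x1 by (simp only: powr_le_cancel_iff)
        thus False using \<delta>1 \<delta> \<epsilon> by (simp add: distrib_left)
      qed
    qed
  qed
qed

section \<open>Counting states and roots\<close>

definition states :: "nat \<Rightarrow> nat \<Rightarrow> (nat \<Rightarrow> int) set" where
  "states p m = {..m} \<rightarrow>\<^sub>E {0..<int p}"

lemma finite_states [simp]: "finite (states p m)"
  unfolding states_def by (intro finite_PiE) auto

lemma card_states: "card (states p m) = p ^ (m + 1)"
  unfolding states_def by (simp add: card_PiE)

lemma states_upd: "v \<in> states p m \<Longrightarrow> i \<le> m \<Longrightarrow> x \<in> {0..<int p} \<Longrightarrow> v(i := x) \<in> states p m"
  unfolding states_def by (auto simp: PiE_def extensional_def)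

lemma statesD: "v \<in> states p m \<Longrightarrow> i \<le> m \<Longrightarrow> v i \<in> {0..<int p}"
  unfolding states_def by auto

text \<open>Fixing all coordinates but the \<open>i\<close>-th decomposes the states into lines; the factor \<open>p\<close> appears
because every line is counted once for each of its points.\<close>

lemma sum_states_lines:
  fixes f :: "(nat \<Rightarrow> int) \<Rightarrow> 'a::comm_semiring_1"
  assumes i: "i \<le> m"
  shows "(\<Sum>v\<in>states p m. \<Sum>x\<in>{0..<int p}. f (v(i := x))) = of_nat p * (\<Sum>v\<in>states p m. f v)"
proof -
  have "(\<Sum>v\<in>states p m. \<Sum>x\<in>{0..<int p}. f (v(i := x))) = (\<Sum>q\<in>states p m \<times> {0..<int p}. f ((fst q)(i := snd q)))"
    by (simp add: sum.cartesian_product case_prod_unfold)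
  also have "\<dots> = (\<Sum>q\<in>states p m \<times> {0..<int p}. f (fst q))"
    by (rule sum.reindex_bij_witness[of _ "\<lambda>q. ((fst q)(i := snd q), fst q i)" "\<lambda>q. ((fst q)(i := snd q), fst q i)"])
      (use i in \<open>auto intro: states_upd dest: statesD\<close>)
  also have "\<dots> = (\<Sum>v\<in>states p m. \<Sum>x\<in>{0..<int p}. f v)"
    by (simp only: sum.cartesian_product case_prod_unfold)
  also have "\<dots> = of_nat p * (\<Sum>v\<in>states p m. f v)" by (simp add: sum_distrib_left)
  finally show ?thesis .
qed

lemma card_states_le:
  assumes i: "i \<le> m" and p: "p > 0"
    and B: "\<And>v. v \<in> states p m \<Longrightarrow> card {x \<in> {0..<int p}. P (v(i := x))} \<le> B"
  shows "card {v \<in> states p m. P v} \<le> B * p ^ m"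
proof -
  have "p * card {v \<in> states p m. P v} = p * (\<Sum>v\<in>states p m. of_bool (P v))"
    by (simp add: of_bool_def sum.If_cases Int_def)
  also have "\<dots> = (\<Sum>v\<in>states p m. \<Sum>x\<in>{0..<int p}. of_bool (P (v(i := x))))"
    using sum_states_lines[OF i, of "\<lambda>v. of_bool (P v) :: nat" p] by simp
  also have "\<dots> \<le> (\<Sum>v\<in>states p m. B)"
    using B by (intro sum_mono) (simp add: of_bool_def sum.If_cases Int_def)
  also have "\<dots> = p * (B * p ^ m)" by (simp add: card_states)
  finally show ?thesis using p by simp
qed

lemma card_roots_mod_prime:
  fixes q :: "int poly"
  assumes p: "prime p" and "degree q \<le> n" and "\<not> int p dvd coeff q n"
  shows "card {x \<in> {0..<int p}. int p dvd poly q x} \<le> n"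
  using assms(2,3)
proof (induction n arbitrary: q)
  case 0
  then obtain a where "q = [:a:]" by (auto elim: degree_eq_zeroE)
  thus ?case using 0 by simp
next
  case (Suc n)
  show ?case
  proof (cases "\<exists>r\<in>{0..<int p}. int p dvd poly q r")
    case False
    hence "{x \<in> {0..<int p}. int p dvd poly q x} = {}" by auto
    thus ?thesis by (simp only: card.empty)
  next
    case True
    then obtain r where r: "r \<in> {0..<int p}" "int p dvd poly q r" by blast
    define t where "t = synthetic_div q r"
    have q: "q = [:-r, 1:] * t + [:poly q r:]"
      unfolding t_def by (rule synthetic_div_correct'[symmetric])
    have dt: "degree t \<le> n" using Suc.prems(1) by (simp add: t_def degree_synthetic_div)
    have "coeff q (Suc n) = coeff ([:-r, 1:] * t + [:poly q r:]) (Suc n)" using q by metis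
    also have "\<dots> = coeff t n - r * coeff t (Suc n)" by (simp add: coeff_pCons)
    also have "coeff t (Suc n) = 0" using dt by (intro coeff_eq_0) auto
    finally have ct: "\<not> int p dvd coeff t n" using Suc.prems(2) by simp
    have "{x \<in> {0..<int p}. int p dvd poly q x} \<subseteq> insert r {x \<in> {0..<int p}. int p dvd poly t x}"
    proof
      fix x assume x: "x \<in> {x \<in> {0..<int p}. int p dvd poly q x}"
      have "poly q x = poly ([:-r, 1:] * t + [:poly q r:]) x" using q by metis
      also have "\<dots> = (x - r) * poly t x + poly q r" by (simp add: algebra_simps)
      finally have "int p dvd (x - r) * poly t x" using x r
        by (simp add: dvd_add_left_iff)
      hence "int p dvd x - r \<or> int p dvd poly t x" using p by (simp add: prime_dvd_mult_iff)
      thus "x \<in> insert r {x \<in> {0..<int p}. int p dvd poly t x}"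
      proof
        assume "int p dvd x - r"
        hence "x mod int p = r mod int p" by (simp add: mod_eq_dvd_iff)
        thus ?thesis using x r by simp
      qed (use x in auto)
    qed
    hence "card {x \<in> {0..<int p}. int p dvd poly q x} \<le> card (insert r {x \<in> {0..<int p}. int p dvd poly t x})"
      by (intro card_mono finite.insertI) (auto intro: finite_subset[of _ "{0..<int p}"])
    also have "\<dots> \<le> Suc (card {x \<in> {0..<int p}. int p dvd poly t x})" by (rule card_insert_le_m1) auto
    also have "\<dots> \<le> Suc n" using Suc.IH[OF dt ct] by simp
    finally show ?thesis .
  qed
qed

lemma cong_poly: "[x = y] (mod n) \<Longrightarrow> [poly q x = poly q y] (mod (n::int))"
  by (induction q) (auto intro!: cong_add cong_mult)

section \<open>Iterates of triangular systems\<close>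

text \<open>The properties of the polynomials that matter for the dynamics: the \<open>i\<close>-th coordinate is mapped by
an affine map whose coefficients depend on the later coordinates only, and \<open>G i\<close> is a polynomial
in the next coordinate, of degree \<open>s i\<close> with a unit as leading coefficient as long as none of the
coordinates after the next one vanishes. Values are integers, and all statements are modulo
\<open>p\<close>.\<close>

locale triangular_system =
  fixes p m d :: nat and G H :: "nat \<Rightarrow> (nat \<Rightarrow> int) \<Rightarrow> int" and s :: "nat \<Rightarrow> nat"
  assumes prime: "prime p"
    and G_cong: "\<And>i v v'. i \<le> m \<Longrightarrow> (\<And>j. i < j \<Longrightarrow> j \<le> m \<Longrightarrow> [v j = v' j] (mod int p)) \<Longrightarrow>
      [G i v = G i v'] (mod int p)"
    and H_cong: "\<And>i v v'. i \<le> m \<Longrightarrow> (\<And>j. i < j \<Longrightarrow> j \<le> m \<Longrightarrow> [v j = v' j] (mod int p)) \<Longrightarrow>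
      [H i v = H i v'] (mod int p)"
    and G_last: "\<And>v. \<not> int p dvd G m v"
    and s: "\<And>i. i < m \<Longrightarrow> 0 < s i" "\<And>i. i < m \<Longrightarrow> s i \<le> d"
    and G_poly: "\<And>i v. i < m \<Longrightarrow> \<exists>q::int poly. degree q \<le> s i \<and>
      (\<forall>x. [G i (v(Suc i := x)) = poly q x] (mod int p)) \<and>
      ((\<forall>j. Suc i < j \<and> j \<le> m \<longrightarrow> \<not> int p dvd v j) \<longrightarrow> \<not> int p dvd coeff q (s i))"
begin

lemma p0: "p > 0" using prime prime_gt_0_nat by blast

abbreviation V where "V \<equiv> states p m"

definition step :: "(nat \<Rightarrow> int) \<Rightarrow> nat \<Rightarrow> int" where
  "step v = (\<lambda>i\<in>{..m}. (v i * G i v + H i v) mod int p)"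

definition it :: "nat \<Rightarrow> (nat \<Rightarrow> int) \<Rightarrow> nat \<Rightarrow> int" where
  "it k = step ^^ k"

lemma it_0 [simp]: "it 0 v = v" by (simp add: it_def)
lemma it_Suc: "it (Suc k) v = step (it k v)" by (simp add: it_def)

lemma step_states: "step v \<in> V"
  using p0 by (auto simp: step_def states_def)

lemma step_cong: "i \<le> m \<Longrightarrow> [step v i = v i * G i v + H i v] (mod int p)"
  by (simp add: step_def)

lemma it_upper:
  assumes "\<And>j. i \<le> j \<Longrightarrow> j \<le> m \<Longrightarrow> v j = v' j" and "i \<le> j" "j \<le> m"
  shows "it k v j = it k v' j"
  using assms(2,3)
proof (induction k arbitrary: j)
  case (Suc k)
  have "[G j (it k v) = G j (it k v')] (mod int p)" "[H j (it k v) = H j (it k v')] (mod int p)"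
    using Suc by (auto intro!: G_cong H_cong)
  hence "[it k v j * G j (it k v) + H j (it k v) = it k v' j * G j (it k v') + H j (it k v')] (mod int p)"
    using Suc by (intro cong_add cong_mult) auto
  thus ?case using Suc.prems by (simp add: it_Suc step_def cong_def)
qed (use assms in simp)

lemma it_upd_upper: "i < j \<Longrightarrow> j \<le> m \<Longrightarrow> it k (v(i := x)) j = it k v j"
  by (rule it_upper[of "Suc i"]) auto

lemma G_it_upd: "i \<le> j \<Longrightarrow> j \<le> m \<Longrightarrow> [G j (it k (v(i := x))) = G j (it k v)] (mod int p)"
  by (intro G_cong) (auto simp: it_upd_upper)

lemma H_it_upd: "i \<le> j \<Longrightarrow> j \<le> m \<Longrightarrow> [H j (it k (v(i := x))) = H j (it k v)] (mod int p)"
  by (intro H_cong) (auto simp: it_upd_upper)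

text \<open>The coefficient of \<open>v i\<close> in the \<open>i\<close>-th coordinate of the \<open>k\<close>-th iterate, see \<open>it_affine\<close>.\<close>

definition slope :: "nat \<Rightarrow> nat \<Rightarrow> (nat \<Rightarrow> int) \<Rightarrow> int" where
  "slope i k v = (\<Prod>l<k. G i (it l v))"

lemma it_affine:
  assumes i: "i \<le> m"
  shows "\<exists>c. \<forall>x. [it k (v(i := x)) i = x * slope i k v + c] (mod int p)"
proof (induction k)
  case 0 show ?case by (auto simp: slope_def intro!: exI[of _ 0])
next
  case (Suc k)
  then obtain c where c: "\<And>x. [it k (v(i := x)) i = x * slope i k v + c] (mod int p)" by blast
  have "[it (Suc k) (v(i := x)) i = x * slope i (Suc k) v + (c * G i (it k v) + H i (it k v))] (mod int p)" for x
  proof -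
    have "[it (Suc k) (v(i := x)) i = it k (v(i := x)) i * G i (it k (v(i := x))) + H i (it k (v(i := x)))] (mod int p)"
      unfolding it_Suc by (rule step_cong[OF i])
    also have "[it k (v(i := x)) i * G i (it k (v(i := x))) + H i (it k (v(i := x)))
        = (x * slope i k v + c) * G i (it k v) + H i (it k v)] (mod int p)"
      using i by (intro cong_add cong_mult c G_it_upd H_it_upd) auto
    also have "(x * slope i k v + c) * G i (it k v) + H i (it k v)
        = x * slope i (Suc k) v + (c * G i (it k v) + H i (it k v))"
      by (simp add: slope_def algebra_simps)
    finally show ?thesis .
  qed
  thus ?case by blast
qed

text \<open>The states that are excluded before lines in direction \<open>i\<close> are considered: at all others, during
\<open>K\<close> steps, the slope of index \<open>i\<close> is a unit and \<open>G (i - 1)\<close> keeps its degree in the coordinate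
\<open>i\<close>. The condition depends on the coordinates after the \<open>i\<close>-th only, so it is constant on these
lines.\<close>

definition degenerate :: "nat \<Rightarrow> nat \<Rightarrow> (nat \<Rightarrow> int) \<Rightarrow> bool" where
  "degenerate K i v \<longleftrightarrow> (\<exists>l<K. (\<exists>j. i < j \<and> j \<le> m \<and> int p dvd it l v j) \<or>
     (\<exists>j. i \<le> j \<and> j < m \<and> int p dvd G j (it l v)))"

lemma degenerate_upd: "i \<le> j \<Longrightarrow> degenerate K j (v(i := x)) \<longleftrightarrow> degenerate K j v"
proof -
  assume ij: "i \<le> j"
  have "int p dvd it l (v(i := x)) j' \<longleftrightarrow> int p dvd it l v j'" if "j < j'" "j' \<le> m" for l j'
    using it_upd_upper that ij by simp
  moreover have "int p dvd G j' (it l (v(i := x))) \<longleftrightarrow> int p dvd G j' (it l v)" if "j \<le> j'" "j' < m" for l j'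
    using G_it_upd[of i j' l v x] that ij by (simp add: cong_dvd_iff)
  ultimately show ?thesis unfolding degenerate_def by meson
qed

lemma slope_not_dvd:
  assumes "\<not> degenerate K i v" "k \<le> K" "i \<le> m"
  shows "\<not> int p dvd slope i k v"
proof
  assume "int p dvd slope i k v"
  then obtain l where l: "l < k" "int p dvd G i (it l v)"
    using prime by (auto simp: slope_def prime_dvd_prod_iff)
  show False
  proof (cases "i = m")
    case True thus False using l G_last by simp
  next
    case False
    thus False using assms l unfolding degenerate_def by (meson le_neq_implies_less less_le_trans order_refl)
  qed
qed

text \<open>The coordinate \<open>i + 1\<close> of the \<open>l\<close>-th iterate is an affine function of \<open>x\<close> with a slope that is a
unit. Substituting it into \<open>G i\<close> preserves the degree.\<close>

lemma G_line:
  assumes i: "i < m" and nd: "\<not> degenerate K (Suc i) v" and l: "l < K"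
  shows "\<exists>q. degree q = s i \<and> \<not> int p dvd lead_coeff q \<and>
    (\<forall>x. [G i (it l (v(Suc i := x))) = poly q x] (mod int p))"
proof -
  obtain q where q: "degree q \<le> s i" "\<And>x. [G i ((it l v)(Suc i := x)) = poly q x] (mod int p)"
    "(\<forall>j. Suc i < j \<and> j \<le> m \<longrightarrow> \<not> int p dvd it l v j) \<longrightarrow> \<not> int p dvd coeff q (s i)"
    using G_poly[OF i, of "it l v"] by blast
  have cq: "\<not> int p dvd coeff q (s i)" using q(3) nd l unfolding degenerate_def by blast
  hence dq: "degree q = s i" using q(1) by (metis dvd_0_right le_degree le_antisym)
  obtain c where c: "\<And>x. [it l (v(Suc i := x)) (Suc i) = x * slope (Suc i) l v + c] (mod int p)"
    using it_affine[of "Suc i" l v] i by auto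
  define g where "g = slope (Suc i) l v"
  have g: "\<not> int p dvd g" unfolding g_def using slope_not_dvd[OF nd] l i by auto
  hence g0: "g \<noteq> 0" by auto
  define r where "r = pcompose q [:c, g:]"
  have dr: "degree r = s i" using g0 by (simp add: r_def dq degree_pcompose)
  have "lead_coeff r = lead_coeff q * g ^ degree q"
    unfolding r_def using g0 by (subst lead_coeff_comp) auto
  hence "\<not> int p dvd lead_coeff r" using cq g prime dq
    by (simp add: prime_dvd_mult_iff prime_dvd_power_iff s i)
  moreover have "[G i (it l (v(Suc i := x))) = poly r x] (mod int p)" for x
  proof -
    have "[G i (it l (v(Suc i := x))) = G i ((it l v)(Suc i := it l (v(Suc i := x)) (Suc i)))] (mod int p)"
      using i by (intro G_cong) (auto simp: it_upd_upper)
    also have "[G i ((it l v)(Suc i := it l (v(Suc i := x)) (Suc i))) = poly q (it l (v(Suc i := x)) (Suc i))] (mod int p)"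
      by (rule q(2))
    also have "[poly q (it l (v(Suc i := x)) (Suc i)) = poly q (x * g + c)] (mod int p)"
      using c by (intro cong_poly) (simp add: g_def)
    also have "poly q (x * g + c) = poly r x" by (simp add: r_def poly_pcompose algebra_simps)
    finally show ?thesis .
  qed
  ultimately show ?thesis using dr by blast
qed

text \<open>Descend from \<open>i = m\<close>, where nothing is degenerate. Off the states that are degenerate at \<open>i + 1\<close>,
each line in direction \<open>i + 1\<close> carries, for each of the \<open>K\<close> times, at most one zero of the
coordinate \<open>i + 1\<close> and at most \<open>d\<close> zeros of \<open>G i\<close>.\<close>

lemma card_degenerate:
  assumes "i \<le> m"
  shows "card {v \<in> V. degenerate K i v} \<le> (m - i) * (K * (d + 1)) * p ^ m"
  using assms
proof (induction "m - i" arbitrary: i)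
  case 0
  hence "\<not> degenerate K i v" for v unfolding degenerate_def by auto
  thus ?case by simp
next
  case (Suc n)
  hence i: "i < m" by linarith
  let ?A = "\<lambda>l. {v \<in> V. \<not> degenerate K (Suc i) v \<and> int p dvd it l v (Suc i)}"
  let ?B = "\<lambda>l. {v \<in> V. \<not> degenerate K (Suc i) v \<and> int p dvd G i (it l v)}"
  have A: "card (?A l) \<le> 1 * p ^ m" if l: "l < K" for l
  proof (rule card_states_le[of "Suc i"])
    fix v assume v: "v \<in> V"
    show "card {x \<in> {0..<int p}. \<not> degenerate K (Suc i) (v(Suc i := x)) \<and> int p dvd it l (v(Suc i := x)) (Suc i)} \<le> 1"
    proof (cases "degenerate K (Suc i) v")
      case True thus ?thesis by (simp add: degenerate_upd)
    next
      case False
      obtain c where c: "\<And>x. [it l (v(Suc i := x)) (Suc i) = x * slope (Suc i) l v + c] (mod int p)"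
        using it_affine[of "Suc i" l v] i by auto
      have "\<not> int p dvd slope (Suc i) l v" using slope_not_dvd[OF False] l i by auto
      hence "card {x \<in> {0..<int p}. int p dvd poly [:c, slope (Suc i) l v:] x} \<le> 1"
        by (intro card_roots_mod_prime prime) auto
      moreover have "int p dvd it l (v(Suc i := x)) (Suc i) \<longleftrightarrow> int p dvd poly [:c, slope (Suc i) l v:] x" for x
        using c[of x] by (simp add: cong_dvd_iff add.commute)
      ultimately show ?thesis using False by (simp add: degenerate_upd)
    qed
  qed (use i p0 in auto)
  have B: "card (?B l) \<le> d * p ^ m" if l: "l < K" for l
  proof (rule card_states_le[of "Suc i"])
    fix v assume v: "v \<in> V"
    show "card {x \<in> {0..<int p}. \<not> degenerate K (Suc i) (v(Suc i := x)) \<and> int p dvd G i (it l (v(Suc i := x)))} \<le> d"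
    proof (cases "degenerate K (Suc i) v")
      case True thus ?thesis by (simp add: degenerate_upd)
    next
      case False
      obtain q where q: "degree q = s i" "\<not> int p dvd lead_coeff q"
        "\<And>x. [G i (it l (v(Suc i := x))) = poly q x] (mod int p)"
        using G_line[OF i False l] by blast
      have "card {x \<in> {0..<int p}. int p dvd poly q x} \<le> s i"
        using q by (intro card_roots_mod_prime prime) auto
      moreover have "int p dvd G i (it l (v(Suc i := x))) \<longleftrightarrow> int p dvd poly q x" for x
        using q(3)[of x] by (simp add: cong_dvd_iff)
      ultimately show ?thesis using False s(2)[OF i] by (simp add: degenerate_upd)
    qed
  qed (use i p0 in auto)
  have "{v \<in> V. degenerate K i v} \<subseteq> {v \<in> V. degenerate K (Suc i) v} \<union> (\<Union>l<K. ?A l) \<union> (\<Union>l<K. ?B l)"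
  proof
    fix v assume v: "v \<in> {v \<in> V. degenerate K i v}"
    then obtain l where l: "l < K" "(\<exists>j. i < j \<and> j \<le> m \<and> int p dvd it l v j) \<or>
     (\<exists>j. i \<le> j \<and> j < m \<and> int p dvd G j (it l v))" by (auto simp: degenerate_def)
    show "v \<in> {v \<in> V. degenerate K (Suc i) v} \<union> (\<Union>l<K. ?A l) \<union> (\<Union>l<K. ?B l)"
    proof (cases "degenerate K (Suc i) v")
      case True thus ?thesis using v by simp
    next
      case False
      from l(2) have "int p dvd it l v (Suc i) \<or> int p dvd G i (it l v)"
        using False l(1) unfolding degenerate_def by (metis Suc_leI le_neq_implies_less)
      thus ?thesis using v False l(1) by blast
    qed
  qed
  hence "card {v \<in> V. degenerate K i v} \<le> card ({v \<in> V. degenerate K (Suc i) v} \<union> (\<Union>l<K. ?A l) \<union> (\<Union>l<K. ?B l))"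
    by (intro card_mono) auto
  also have "\<dots> \<le> card {v \<in> V. degenerate K (Suc i) v} + card (\<Union>l<K. ?A l) + card (\<Union>l<K. ?B l)"
    by (meson add_le_mono card_Un_le le_refl order_trans)
  also have "\<dots> \<le> (m - Suc i) * (K * (d + 1)) * p ^ m + K * p ^ m + K * (d * p ^ m)"
  proof (intro add_mono)
    show "card {v \<in> V. degenerate K (Suc i) v} \<le> (m - Suc i) * (K * (d + 1)) * p ^ m"
      using Suc i by (intro Suc.hyps) auto
    have "card (\<Union>l<K. ?A l) \<le> (\<Sum>l<K. card (?A l))" by (rule card_UN_le) simp
    also have "\<dots> \<le> (\<Sum>l<K. 1 * p ^ m)" by (intro sum_mono A) simp
    finally show "card (\<Union>l<K. ?A l) \<le> K * p ^ m" by simp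
    have "card (\<Union>l<K. ?B l) \<le> (\<Sum>l<K. card (?B l))" by (rule card_UN_le) simp
    also have "\<dots> \<le> (\<Sum>l<K. d * p ^ m)" by (intro sum_mono B) simp
    finally show "card (\<Union>l<K. ?B l) \<le> K * (d * p ^ m)" by simp
  qed
  also have "\<dots> = (m - i) * (K * (d + 1)) * p ^ m"
  proof -
    have "m - i = Suc (m - Suc i)" using i by simp
    thus ?thesis by (simp add: algebra_simps)
  qed
  finally show ?case .
qed

text \<open>On a line in direction \<open>i + 1\<close> that is not degenerate, \<open>slope i k\<close> is a polynomial of degree
\<open>k * s i\<close> whose leading coefficient is a unit. The largest \<open>k\<close> with \<open>c k \<noteq> 0\<close> therefore
determines the degree of the combination, and \<open>\<bar>c k\<bar> < p\<close> makes its leading coefficient a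
unit.\<close>

lemma card_slope_relation:
  fixes c :: "nat \<Rightarrow> int"
  assumes i: "i < m" and c: "\<And>k. \<bar>c k\<bar> < int p" and nz: "\<exists>k<K. c k \<noteq> 0"
  shows "card {v \<in> V. int p dvd (\<Sum>k<K. c k * slope i k v)} \<le> (m + 1) * (K * (d + 1)) * p ^ m"
proof -
  let ?Z = "\<lambda>v. int p dvd (\<Sum>k<K. c k * slope i k v)"
  define k where "k = Max {k. k < K \<and> c k \<noteq> 0}"
  have kmem: "k \<in> {k. k < K \<and> c k \<noteq> 0}" unfolding k_def using nz by (intro Max_in) auto
  have kmax: "c k' = 0" if "k < k'" "k' < K" for k'
  proof (rule ccontr)
    assume "c k' \<noteq> 0"
    hence "k' \<le> k" unfolding k_def using that by (intro Max_ge) auto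
    thus False using that by simp
  qed
  have ck: "\<not> int p dvd c k" using kmem c[of k] by (auto dest: zdvd_imp_le simp: abs_if split: if_splits)
      (metis abs_if abs_less_iff dvd_minus_iff neg_0_less_iff_less not_less_iff_gr_or_eq zdvd_not_zless)
  have "card {v \<in> V. \<not> degenerate K (Suc i) v \<and> ?Z v} \<le> (K * d) * p ^ m"
  proof (rule card_states_le[of "Suc i"])
    fix v assume v: "v \<in> V"
    show "card {x \<in> {0..<int p}. \<not> degenerate K (Suc i) (v(Suc i := x)) \<and> ?Z (v(Suc i := x))} \<le> K * d"
    proof (cases "degenerate K (Suc i) v")
      case True thus ?thesis by (simp add: degenerate_upd)
    next
      case False
      have "\<forall>l. \<exists>q. l < K \<longrightarrow> degree q = s i \<and> \<not> int p dvd lead_coeff q \<and>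
        (\<forall>x. [G i (it l (v(Suc i := x))) = poly q x] (mod int p))"
        using G_line[OF i False] by blast
      then obtain q where q: "\<And>l. l < K \<Longrightarrow> degree (q l) = s i" "\<And>l. l < K \<Longrightarrow> \<not> int p dvd lead_coeff (q l)"
        "\<And>l x. l < K \<Longrightarrow> [G i (it l (v(Suc i := x))) = poly (q l) x] (mod int p)" by metis
      define r where "r = (\<lambda>k. \<Prod>l<k. q l)"
      have r: "degree (r k) = k * s i \<and> \<not> int p dvd lead_coeff (r k)" if "k \<le> K" for k
        using that
      proof (induction k)
        case 0
        have "\<not> int p dvd 1" using prime by (metis not_prime_1 of_nat_1 of_nat_dvd_iff prime_nat_iff nat_dvd_1_iff_1)
        thus ?case by (simp add: r_def)
      next
        case (Suc k)
        have "r (Suc k) = r k * q k" by (simp add: r_def)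
        moreover have "r k \<noteq> 0" "q k \<noteq> 0" using Suc q(2)[of k] by auto
        ultimately have "degree (r (Suc k)) = degree (r k) + degree (q k)"
          "lead_coeff (r (Suc k)) = lead_coeff (r k) * lead_coeff (q k)"
          by (metis degree_mult_eq, metis lead_coeff_mult)
        moreover have ih: "degree (r k) = k * s i" "\<not> int p dvd lead_coeff (r k)"
          using Suc.IH Suc.prems by (metis Suc_leD)+
        moreover have "degree (q k) = s i" "\<not> int p dvd lead_coeff (q k)" using Suc.prems q(1,2)[of k] by auto
        moreover have "prime (int p)" using prime by simp
        ultimately show ?case by (metis add.commute mult_Suc prime_dvd_mult_iff)
      qed
      define Q where "Q = (\<Sum>k<K. Polynomial.smult (c k) (r k))"
      have cf: "coeff (Polynomial.smult (c k') (r k')) n = 0" if "k' < K" "k * s i \<le> n" "k' \<noteq> k" for k' n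
      proof (cases "k' < k")
        case True
        hence "k' * s i < k * s i" using s(1)[OF i] by simp
        moreover have "degree (r k') = k' * s i" using r[of k'] that by auto
        ultimately have "degree (r k') < n" using that(2) by linarith
        thus ?thesis by (simp add: coeff_eq_0)
      next
        case False
        thus ?thesis using kmax[of k'] that by simp
      qed
      have Qn: "coeff Q n = coeff (Polynomial.smult (c k) (r k)) n" if "k * s i \<le> n" for n
      proof -
        have "(\<Sum>k'\<in>{..<K} - {k}. coeff (Polynomial.smult (c k') (r k')) n) = 0"
          using cf[OF _ that] by (intro sum.neutral) blast
        thus ?thesis unfolding Q_def coeff_sum using kmem by (subst sum.remove[of _ k]) auto
      qed
      have "degree Q \<le> k * s i"
      proof (rule degree_le, intro allI impI)
        fix n assume "k * s i < n"
        thus "coeff Q n = 0" using Qn[of n] r[of k] kmem by (simp add: coeff_eq_0)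
      qed
      moreover have "\<not> int p dvd coeff Q (k * s i)"
        using Qn[of "k * s i"] r[of k] kmem ck prime by (auto simp: prime_dvd_mult_iff)
      ultimately have "card {x \<in> {0..<int p}. int p dvd poly Q x} \<le> k * s i"
        by (intro card_roots_mod_prime prime)
      also have "\<dots> \<le> K * d" using kmem s(2)[OF i] by (intro mult_mono) auto
      finally have "card {x \<in> {0..<int p}. int p dvd poly Q x} \<le> K * d" .
      moreover have "?Z (v(Suc i := x)) \<longleftrightarrow> int p dvd poly Q x" for x
      proof (rule cong_dvd_iff)
        have "[slope i k' (v(Suc i := x)) = poly (r k') x] (mod int p)" if "k' < K" for k'
          unfolding slope_def r_def poly_prod using that by (intro cong_prod q) auto
        thus "[(\<Sum>k<K. c k * slope i k (v(Suc i := x))) = poly Q x] (mod int p)"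
          unfolding Q_def poly_sum poly_smult by (intro cong_sum cong_mult) auto
      qed
      ultimately show ?thesis using False by (simp add: degenerate_upd)
    qed
  qed (use i p0 in auto)
  moreover have "card {v \<in> V. degenerate K (Suc i) v} \<le> (m - Suc i) * (K * (d + 1)) * p ^ m"
    by (rule card_degenerate) (use i in auto)
  moreover have "card {v \<in> V. ?Z v} \<le> card ({v \<in> V. \<not> degenerate K (Suc i) v \<and> ?Z v} \<union> {v \<in> V. degenerate K (Suc i) v})"
    by (intro card_mono) auto
  moreover have "\<dots> \<le> card {v \<in> V. \<not> degenerate K (Suc i) v \<and> ?Z v} + card {v \<in> V. degenerate K (Suc i) v}"
    by (rule card_Un_le)
  moreover have "(K * d) * p ^ m + (m - Suc i) * (K * (d + 1)) * p ^ m \<le> (m + 1) * (K * (d + 1)) * p ^ m"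
  proof -
    have "K * d + (m - Suc i) * (K * (d + 1)) \<le> K * (d + 1) + m * (K * (d + 1))"
      by (intro add_mono mult_mono) auto
    hence "(K * d + (m - Suc i) * (K * (d + 1))) * p ^ m \<le> (K * (d + 1) + m * (K * (d + 1))) * p ^ m"
      by (rule mult_right_mono) simp
    thus ?thesis by (simp only: ring_distribs mult_1_left add.commute)
  qed
  ultimately show ?thesis by linarith
qed

end

section \<open>Moments of sums along orbits\<close>

lemma sum_shift_le:
  fixes z :: "nat \<Rightarrow> complex"
  assumes z: "\<And>n. norm (z n) \<le> 1"
  shows "norm ((\<Sum>n<N. z n) - (\<Sum>n<N. z (n + k))) \<le> 2 * real k"
proof (induction k)
  case (Suc k)
  have tele: "(\<Sum>n<N. z (n + Suc k)) = (\<Sum>n<N. z (n + k)) - z k + z (N + k)" for N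
    by (induction N) auto
  have "(\<Sum>n<N. z n) - (\<Sum>n<N. z (n + Suc k)) = ((\<Sum>n<N. z n) - (\<Sum>n<N. z (n + k))) + (z k - z (N + k))"
    unfolding tele by simp
  hence "norm ((\<Sum>n<N. z n) - (\<Sum>n<N. z (n + Suc k)))
      \<le> norm ((\<Sum>n<N. z n) - (\<Sum>n<N. z (n + k))) + norm (z k - z (N + k))"
    by (metis norm_triangle_ineq)
  also have "norm (z k - z (N + k)) \<le> norm (z k) + norm (z (N + k))" by (rule norm_triangle_ineq4)
  also have "\<dots> \<le> 2" using z[of k] z[of "N + k"] by linarith
  finally show ?case using Suc by simp
qed simp

lemma mean_power_le:
  fixes x :: "nat \<Rightarrow> real"
  assumes N: "N > 0"
  shows "((\<Sum>n<N. x n) / real N) ^ (2 * k) \<le> (\<Sum>n<N. x n ^ (2 * k)) / real N"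
proof -
  have "(\<Sum>n<N. (1 / real N) *\<^sub>R x n) ^ (2 * k) \<le> (\<Sum>n<N. (1 / real N) * x n ^ (2 * k))"
    by (rule convex_on_sum[of "{..<N}" UNIV "\<lambda>x. x ^ (2 * k)"]) (use N in \<open>auto intro!: convex_power_even\<close>)
  thus ?thesis by (simp add: sum_divide_distrib)
qed

definition mult_of :: "nat \<Rightarrow> (nat \<Rightarrow> nat) \<Rightarrow> nat \<Rightarrow> nat" where
  "mult_of \<nu> \<kappa> k = card {j. j < \<nu> \<and> \<kappa> j = k}"

lemma mult_of_le: "mult_of \<nu> \<kappa> k \<le> \<nu>"
proof -
  have "mult_of \<nu> \<kappa> k \<le> card {..<\<nu>}" unfolding mult_of_def by (intro card_mono) auto
  thus ?thesis by simp
qed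

lemma sum_via_multiplicity:
  fixes f :: "nat \<Rightarrow> int"
  assumes "\<kappa> \<in> {..<\<nu>} \<rightarrow>\<^sub>E {..<K}"
  shows "(\<Sum>j<\<nu>. f (\<kappa> j)) = (\<Sum>k<K. int (mult_of \<nu> \<kappa> k) * f k)"
proof -
  have "(\<Sum>j<\<nu>. f (\<kappa> j)) = (\<Sum>k<K. \<Sum>j\<in>{j \<in> {..<\<nu>}. \<kappa> j = k}. f (\<kappa> j))"
    using assms by (intro sum.group[symmetric]) auto
  also have "\<dots> = (\<Sum>k<K. int (mult_of \<nu> \<kappa> k) * f k)"
    by (intro sum.cong refl) (simp add: mult_of_def)
  finally show ?thesis .
qed

text \<open>All values of \<open>\<kappa>\<close> are values of \<open>\<mu>\<close>, of which there are at most \<open>\<nu>\<close>.\<close>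

lemma card_same_multiplicities:
  assumes l: "\<mu> \<in> {..<\<nu>} \<rightarrow>\<^sub>E {..<K}"
  shows "card {\<kappa> \<in> {..<\<nu>} \<rightarrow>\<^sub>E {..<K}. \<forall>k<K. mult_of \<nu> \<kappa> k = mult_of \<nu> \<mu> k} \<le> \<nu> ^ \<nu>"
proof -
  have "{\<kappa> \<in> {..<\<nu>} \<rightarrow>\<^sub>E {..<K}. \<forall>k<K. mult_of \<nu> \<kappa> k = mult_of \<nu> \<mu> k} \<subseteq> {..<\<nu>} \<rightarrow>\<^sub>E \<mu> ` {..<\<nu>}"
  proof clarify
    fix \<kappa> assume k: "\<kappa> \<in> {..<\<nu>} \<rightarrow>\<^sub>E {..<K}" and eq: "\<forall>k<K. mult_of \<nu> \<kappa> k = mult_of \<nu> \<mu> k"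
    have "\<kappa> j \<in> \<mu> ` {..<\<nu>}" if j: "j < \<nu>" for j
    proof -
      have "j \<in> {j'. j' < \<nu> \<and> \<kappa> j' = \<kappa> j}" using j by simp
      hence "mult_of \<nu> \<kappa> (\<kappa> j) > 0" unfolding mult_of_def by (intro card_gt_0_iff[THEN iffD2]) auto
      moreover have "\<kappa> j < K" using k j by auto
      ultimately have "mult_of \<nu> \<mu> (\<kappa> j) > 0" using eq by simp
      hence "{j'. j' < \<nu> \<and> \<mu> j' = \<kappa> j} \<noteq> {}" unfolding mult_of_def by (metis card.empty less_irrefl)
      thus ?thesis by force
    qed
    thus "\<kappa> \<in> {..<\<nu>} \<rightarrow>\<^sub>E \<mu> ` {..<\<nu>}" using k by (auto simp: PiE_def)
  qed
  hence "card {\<kappa> \<in> {..<\<nu>} \<rightarrow>\<^sub>E {..<K}. \<forall>k<K. mult_of \<nu> \<kappa> k = mult_of \<nu> \<mu> k}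
      \<le> card ({..<\<nu>} \<rightarrow>\<^sub>E \<mu> ` {..<\<nu>})"
    by (intro card_mono finite_PiE) auto
  also have "\<dots> = card (\<mu> ` {..<\<nu>}) ^ \<nu>" by (simp add: card_PiE)
  also have "\<dots> \<le> \<nu> ^ \<nu>"
    using card_image_le[of "{..<\<nu>}" \<mu>] by (intro power_mono) auto
  finally show ?thesis .
qed

context triangular_system
begin

definition phase :: "(nat \<Rightarrow> int) \<Rightarrow> (nat \<Rightarrow> int) \<Rightarrow> int" where
  "phase a v = (\<Sum>j\<le>m. a j * v j)"

lemma phase_affine:
  assumes i: "i \<le> m" and a: "\<And>j. j < i \<Longrightarrow> a j = 0"
  shows "\<exists>c. \<forall>x. [phase a (it k (v(i := x))) = x * (a i * slope i k v) + c] (mod int p)"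
proof -
  obtain c where c: "\<And>x. [it k (v(i := x)) i = x * slope i k v + c] (mod int p)"
    using it_affine[OF i] by blast
  define D where "D = (\<Sum>j\<in>{i<..m}. a j * it k v j)"
  have split: "phase a u = a i * u i + (\<Sum>j\<in>{i<..m}. a j * u j)" for u
  proof -
    have "{..m} = {..<i} \<union> insert i {i<..m}" using i by auto
    hence "phase a u = (\<Sum>j<i. a j * u j) + (\<Sum>j\<in>insert i {i<..m}. a j * u j)"
      unfolding phase_def by (simp only:) (rule sum.union_disjoint, auto)
    thus ?thesis using a by simp
  qed
  have "[phase a (it k (v(i := x))) = x * (a i * slope i k v) + (a i * c + D)] (mod int p)" for x
  proof -
    have "phase a (it k (v(i := x))) = a i * it k (v(i := x)) i + D"
      unfolding split D_def by (simp add: it_upd_upper)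
    also have "[\<dots> = a i * (x * slope i k v + c) + D] (mod int p)"
      by (intro cong_add cong_mult c) auto
    also have "a i * (x * slope i k v + c) + D = x * (a i * slope i k v) + (a i * c + D)"
      by (simp add: algebra_simps)
    finally show ?thesis .
  qed
  thus ?thesis by blast
qed

text \<open>On each line in direction \<open>i\<close> the phase is affine, so the sum over the line vanishes unless the
combination of slopes is divisible by \<open>p\<close>.\<close>

lemma norm_sum_phases_le:
  assumes i: "i \<le> m" and a: "\<And>j. j < i \<Longrightarrow> a j = 0" "\<not> int p dvd a i"
  shows "norm (\<Sum>v\<in>V. echar p (\<Sum>k<K. c k * phase a (it k v)))
    \<le> real (card {v \<in> V. int p dvd (\<Sum>k<K. c k * slope i k v)})"
proof -
  let ?f = "\<lambda>v. echar p (\<Sum>k<K. c k * phase a (it k v))"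
  let ?Z = "\<lambda>v. int p dvd (\<Sum>k<K. c k * slope i k v)"
  have line: "norm (\<Sum>x\<in>{0..<int p}. ?f (v(i := x))) = real p * of_bool (?Z v)" for v
  proof -
    have "\<forall>k. \<exists>e. \<forall>x. [phase a (it k (v(i := x))) = x * (a i * slope i k v) + e] (mod int p)"
    proof
      fix k show "\<exists>e. \<forall>x. [phase a (it k (v(i := x))) = x * (a i * slope i k v) + e] (mod int p)"
        by (rule phase_affine[OF i]) (rule a(1))
    qed
    then obtain e where e: "\<And>k x. [phase a (it k (v(i := x))) = x * (a i * slope i k v) + e k] (mod int p)"
      by metis
    define A where "A = a i * (\<Sum>k<K. c k * slope i k v)"
    define E where "E = (\<Sum>k<K. c k * e k)"
    have "?f (v(i := x)) = echar p (A * x + E)" for x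
    proof (rule echar_cong[OF _ p0])
      have "[(\<Sum>k<K. c k * phase a (it k (v(i := x)))) = (\<Sum>k<K. c k * (x * (a i * slope i k v) + e k))] (mod int p)"
        by (intro cong_sum cong_mult e) auto
      also have "(\<Sum>k<K. c k * (x * (a i * slope i k v) + e k)) = A * x + E"
        by (simp add: A_def E_def sum.distrib algebra_simps sum_distrib_left)
      finally show "[(\<Sum>k<K. c k * phase a (it k (v(i := x)))) = A * x + E] (mod int p)" .
    qed
    hence "(\<Sum>x\<in>{0..<int p}. ?f (v(i := x))) = (if int p dvd A then of_nat p * echar p E else 0)"
      by (simp add: sum_echar_linear[OF p0])
    moreover have "int p dvd A \<longleftrightarrow> ?Z v" using a(2) prime by (simp add: A_def prime_dvd_mult_iff)
    ultimately show ?thesis by (simp add: norm_mult)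
  qed
  have "real p * norm (\<Sum>v\<in>V. ?f v) = norm (of_nat p * (\<Sum>v\<in>V. ?f v))" by (simp add: norm_mult)
  also have "of_nat p * (\<Sum>v\<in>V. ?f v) = (\<Sum>v\<in>V. \<Sum>x\<in>{0..<int p}. ?f (v(i := x)))"
    by (rule sum_states_lines[OF i, symmetric])
  also have "norm \<dots> \<le> (\<Sum>v\<in>V. norm (\<Sum>x\<in>{0..<int p}. ?f (v(i := x))))" by (rule norm_sum)
  also have "\<dots> = real p * (\<Sum>v\<in>V. of_bool (?Z v))" by (simp only: line sum_distrib_left)
  also have "(\<Sum>v\<in>V. of_bool (?Z v)) = real (card {v \<in> V. ?Z v})"
    by (simp add: of_bool_def sum.If_cases Int_def)
  finally show ?thesis using p0 by simp
qed

definition orbit_sum :: "nat \<Rightarrow> (nat \<Rightarrow> int) \<Rightarrow> (nat \<Rightarrow> int) \<Rightarrow> complex" where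
  "orbit_sum K a v = (\<Sum>k<K. echar p (phase a (it k v)))"

text \<open>Expand the power into pairs of tuples of times. The pairs with equal multiplicities contribute the
first term, with the trivial bound for each of them; \<open>\<nu> < p\<close> makes the coefficients of the other
pairs small enough for the bound on relations between slopes.\<close>

lemma moment_bound:
  assumes i: "i < m" and a: "\<And>j. j < i \<Longrightarrow> a j = 0" "\<not> int p dvd a i" and \<nu>: "\<nu> < p"
  shows "(\<Sum>v\<in>V. norm (orbit_sum K a v) ^ (2 * \<nu>))
    \<le> real \<nu> ^ \<nu> * real K ^ \<nu> * real p ^ (m + 1) + real K ^ (2 * \<nu>) * (real (m + 1) * (real K * real (d + 1)) * real p ^ m)"
proof -
  define P where "P = {..<\<nu>} \<rightarrow>\<^sub>E {..<K}"
  define B where "B = real (m + 1) * (real K * real (d + 1)) * real p ^ m"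
  define c where "c = (\<lambda>\<kappa> \<mu> k. int (mult_of \<nu> \<kappa> k) - int (mult_of \<nu> \<mu> k))"
  have finP: "finite P" unfolding P_def by (intro finite_PiE) auto
  have cP: "card P = K ^ \<nu>" by (simp add: P_def card_PiE)
  have B: "B \<ge> 0" by (simp add: B_def)
  have pow: "orbit_sum K a v ^ \<nu> = (\<Sum>\<kappa>\<in>P. echar p (\<Sum>j<\<nu>. phase a (it (\<kappa> j) v)))" for v
  proof -
    have "orbit_sum K a v ^ \<nu> = (\<Prod>j<\<nu>. \<Sum>k<K. echar p (phase a (it k v)))" by (simp add: orbit_sum_def)
    also have "\<dots> = (\<Sum>\<kappa>\<in>P. \<Prod>j<\<nu>. echar p (phase a (it (\<kappa> j) v)))"
      unfolding P_def by (rule prod_sum_PiE) auto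
    finally show ?thesis by (simp add: echar_sum)
  qed
  have expand: "complex_of_real (norm (orbit_sum K a v) ^ (2 * \<nu>))
    = (\<Sum>\<mu>\<in>P. \<Sum>\<kappa>\<in>P. echar p (\<Sum>k<K. c \<kappa> \<mu> k * phase a (it k v)))" for v
  proof -
    have "complex_of_real (norm (orbit_sum K a v) ^ (2 * \<nu>)) = of_real ((norm (orbit_sum K a v ^ \<nu>))\<^sup>2)"
      by (simp add: norm_power power_mult mult.commute)
    also have "\<dots> = orbit_sum K a v ^ \<nu> * cnj (orbit_sum K a v ^ \<nu>)" by (rule complex_norm_square)
    also have "\<dots> = (\<Sum>\<kappa>\<in>P. \<Sum>\<mu>\<in>P. echar p (\<Sum>j<\<nu>. phase a (it (\<kappa> j) v)) * echar p (- (\<Sum>j<\<nu>. phase a (it (\<mu> j) v))))"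
      unfolding pow cnj_sum cnj_echar sum_product ..
    also have "\<dots> = (\<Sum>\<mu>\<in>P. \<Sum>\<kappa>\<in>P. echar p (\<Sum>j<\<nu>. phase a (it (\<kappa> j) v)) * echar p (- (\<Sum>j<\<nu>. phase a (it (\<mu> j) v))))"
      by (rule sum.swap)
    also have "\<dots> = (\<Sum>\<mu>\<in>P. \<Sum>\<kappa>\<in>P. echar p (\<Sum>k<K. c \<kappa> \<mu> k * phase a (it k v)))"
    proof (intro sum.cong refl)
      fix \<kappa> \<mu> assume "\<kappa> \<in> P" "\<mu> \<in> P"
      hence "(\<Sum>j<\<nu>. phase a (it (\<kappa> j) v)) + - (\<Sum>j<\<nu>. phase a (it (\<mu> j) v))
          = (\<Sum>k<K. c \<kappa> \<mu> k * phase a (it k v))"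
        unfolding P_def c_def
        by (simp only: sum_via_multiplicity[of _ _ _ "\<lambda>k. phase a (it k v)"] left_diff_distrib sum_subtractf add_uminus_conv_diff)
      thus "echar p (\<Sum>j<\<nu>. phase a (it (\<kappa> j) v)) * echar p (- (\<Sum>j<\<nu>. phase a (it (\<mu> j) v)))
          = echar p (\<Sum>k<K. c \<kappa> \<mu> k * phase a (it k v))"
        by (simp only: echar_add[symmetric])
    qed
    finally show ?thesis .
  qed
  have bound: "norm (\<Sum>v\<in>V. echar p (\<Sum>k<K. c \<kappa> \<mu> k * phase a (it k v)))
    \<le> of_bool (\<forall>k<K. mult_of \<nu> \<kappa> k = mult_of \<nu> \<mu> k) * real p ^ (m + 1) + B" for \<kappa> \<mu>
  proof (cases "\<forall>k<K. mult_of \<nu> \<kappa> k = mult_of \<nu> \<mu> k")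
    case True
    have "norm (\<Sum>v\<in>V. echar p (\<Sum>k<K. c \<kappa> \<mu> k * phase a (it k v))) \<le> (\<Sum>v\<in>V. 1)"
      by (rule order_trans[OF norm_sum]) simp
    also have "\<dots> = real p ^ (m + 1)" by (simp add: card_states)
    finally show ?thesis using True B by simp
  next
    case False
    have "norm (\<Sum>v\<in>V. echar p (\<Sum>k<K. c \<kappa> \<mu> k * phase a (it k v)))
      \<le> real (card {v \<in> V. int p dvd (\<Sum>k<K. c \<kappa> \<mu> k * slope i k v)})"
      using i by (intro norm_sum_phases_le a) auto
    also have "\<dots> \<le> real ((m + 1) * (K * (d + 1)) * p ^ m)"
    proof (intro of_nat_mono card_slope_relation[OF i])
      fix k
      show "\<bar>c \<kappa> \<mu> k\<bar> < int p" using mult_of_le[of \<nu> \<kappa> k] mult_of_le[of \<nu> \<mu> k] \<nu> by (simp add: c_def)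
    next
      show "\<exists>k<K. c \<kappa> \<mu> k \<noteq> 0" using False by (auto simp: c_def)
    qed
    also have "\<dots> = B" by (simp only: B_def of_nat_mult of_nat_power)
    finally have "norm (\<Sum>v\<in>V. echar p (\<Sum>k<K. c \<kappa> \<mu> k * phase a (it k v))) \<le> B" .
    thus ?thesis by (simp only: False of_bool_eq mult_zero_left add_0)
  qed
  have "(\<Sum>v\<in>V. norm (orbit_sum K a v) ^ (2 * \<nu>)) = norm (complex_of_real (\<Sum>v\<in>V. norm (orbit_sum K a v) ^ (2 * \<nu>)))"
    by (simp only: norm_of_real) (simp add: sum_nonneg)
  also have "complex_of_real (\<Sum>v\<in>V. norm (orbit_sum K a v) ^ (2 * \<nu>))
    = (\<Sum>\<mu>\<in>P. \<Sum>\<kappa>\<in>P. \<Sum>v\<in>V. echar p (\<Sum>k<K. c \<kappa> \<mu> k * phase a (it k v)))"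
    unfolding of_real_sum expand by (subst sum.swap, intro sum.cong refl, rule sum.swap)
  also have "norm \<dots> \<le> (\<Sum>\<mu>\<in>P. norm (\<Sum>\<kappa>\<in>P. \<Sum>v\<in>V. echar p (\<Sum>k<K. c \<kappa> \<mu> k * phase a (it k v))))"
    by (rule norm_sum)
  also have "\<dots> \<le> (\<Sum>\<mu>\<in>P. \<Sum>\<kappa>\<in>P. norm (\<Sum>v\<in>V. echar p (\<Sum>k<K. c \<kappa> \<mu> k * phase a (it k v))))"
    by (intro sum_mono norm_sum)
  also have "\<dots> \<le> (\<Sum>\<mu>\<in>P. \<Sum>\<kappa>\<in>P. of_bool (\<forall>k<K. mult_of \<nu> \<kappa> k = mult_of \<nu> \<mu> k) * real p ^ (m + 1) + B)"
    by (intro sum_mono bound)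
  also have "\<dots> = (\<Sum>\<mu>\<in>P. real (card {\<kappa> \<in> P. \<forall>k<K. mult_of \<nu> \<kappa> k = mult_of \<nu> \<mu> k}) * real p ^ (m + 1) + real (card P) * B)"
  proof -
    have "(\<Sum>\<kappa>\<in>P. of_bool (Q \<kappa>)) = real (card {\<kappa> \<in> P. Q \<kappa>})" for Q
      using finP by (simp add: of_bool_def sum.If_cases Int_def)
    thus ?thesis by (simp only: sum.distrib sum_distrib_right[symmetric] sum_constant)
  qed
  also have "\<dots> \<le> (\<Sum>\<mu>\<in>P. real \<nu> ^ \<nu> * real p ^ (m + 1) + real (card P) * B)"
  proof (intro sum_mono add_mono mult_right_mono order_refl)
    fix \<mu> assume "\<mu> \<in> P"
    hence "card {\<kappa> \<in> P. \<forall>k<K. mult_of \<nu> \<kappa> k = mult_of \<nu> \<mu> k} \<le> \<nu> ^ \<nu>"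
      unfolding P_def by (rule card_same_multiplicities)
    thus "real (card {\<kappa> \<in> P. \<forall>k<K. mult_of \<nu> \<kappa> k = mult_of \<nu> \<mu> k}) \<le> real \<nu> ^ \<nu>"
      by (simp only: of_nat_power[symmetric] of_nat_le_iff)
  qed (use B in auto)
  also have "\<dots> = real \<nu> ^ \<nu> * real K ^ \<nu> * real p ^ (m + 1) + real K ^ (2 * \<nu>) * B"
  proof -
    have "real K ^ (2 * \<nu>) = real K ^ \<nu> * real K ^ \<nu>" by (simp add: mult_2 power_add)
    thus ?thesis by (simp only: sum_constant cP of_nat_power distrib_left mult_ac)
  qed
  finally show ?thesis unfolding B_def .
qed

text \<open>The sum differs by at most \<open>2 k\<close> from its shift by \<open>k\<close>, so it can be replaced by an average over \<open>K\<close>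
shifts at the cost subtracted in \<open>x\<close>. The injectivity of \<open>w\<close> allows the mean of the powers over
the sequence to be bounded by the sum over all states.\<close>

lemma sequence_bound:
  fixes w :: "nat \<Rightarrow> nat \<Rightarrow> int"
  assumes i: "i < m" and a: "\<And>j. j < i \<Longrightarrow> a j = 0" "\<not> int p dvd a i" and \<nu>: "\<nu> < p"
    and w: "\<And>n. w n \<in> V" "\<And>n. w (Suc n) = step (w n)" and inj: "inj_on w {..<N}"
    and N: "N > 0" and K: "K > 0"
    and x: "x = norm (\<Sum>n<N. echar p (phase a (w n))) / real N - 2 * real K / real N" "x \<ge> 0"
  shows "x ^ (2 * \<nu>) \<le> real \<nu> ^ \<nu> * real p ^ (m + 1) / (real K ^ \<nu> * real N)
    + real (m + 1) * real (d + 1) * real K * real p ^ m / real N"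
proof -
  define z where "z = (\<lambda>n. echar p (phase a (w n)))"
  define S where "S = (\<Sum>n<N. z n)"
  have wit: "w (n + k) = it k (w n)" for n k
    by (induction k) (simp_all add: it_Suc w)
  have orb: "orbit_sum K a (w n) = (\<Sum>k<K. z (n + k))" for n
    by (simp add: orbit_sum_def z_def wit)
  have "of_nat K * S - (\<Sum>n<N. orbit_sum K a (w n)) = (\<Sum>k<K. S - (\<Sum>n<N. z (n + k)))"
    unfolding orb by (subst sum.swap) (simp add: sum_subtractf)
  also have "norm \<dots> \<le> (\<Sum>k<K. norm (S - (\<Sum>n<N. z (n + k))))" by (rule norm_sum)
  also have "\<dots> \<le> (\<Sum>k<K. 2 * real K)"
  proof (intro sum_mono)
    fix k assume "k \<in> {..<K}"
    moreover have "norm (S - (\<Sum>n<N. z (n + k))) \<le> 2 * real k"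
      unfolding S_def by (rule sum_shift_le) (simp add: z_def)
    ultimately show "norm (S - (\<Sum>n<N. z (n + k))) \<le> 2 * real K" by simp
  qed
  finally have "norm (of_nat K * S - (\<Sum>n<N. orbit_sum K a (w n))) \<le> 2 * real K * real K" by simp
  hence "norm (of_nat K * S) \<le> norm (\<Sum>n<N. orbit_sum K a (w n)) + 2 * real K * real K"
    using norm_triangle_sub[of "of_nat K * S" "\<Sum>n<N. orbit_sum K a (w n)"] by linarith
  also have "norm (\<Sum>n<N. orbit_sum K a (w n)) \<le> (\<Sum>n<N. norm (orbit_sum K a (w n)))" by (rule norm_sum)
  finally have "real K * (norm S - 2 * real K) \<le> (\<Sum>n<N. norm (orbit_sum K a (w n)))"
    by (simp add: norm_mult algebra_simps)
  moreover have "norm S - 2 * real K = x * real N" using N by (simp add: x S_def z_def field_simps)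
  ultimately have "real K * x \<le> (\<Sum>n<N. norm (orbit_sum K a (w n))) / real N"
    using N by (simp add: field_simps)
  hence "(real K * x) ^ (2 * \<nu>) \<le> ((\<Sum>n<N. norm (orbit_sum K a (w n))) / real N) ^ (2 * \<nu>)"
    using x(2) by (intro power_mono) auto
  also have "\<dots> \<le> (\<Sum>n<N. norm (orbit_sum K a (w n)) ^ (2 * \<nu>)) / real N" by (rule mean_power_le[OF N])
  also have "\<dots> \<le> (\<Sum>v\<in>V. norm (orbit_sum K a v) ^ (2 * \<nu>)) / real N"
  proof (intro divide_right_mono)
    have "(\<Sum>n<N. norm (orbit_sum K a (w n)) ^ (2 * \<nu>)) = (\<Sum>v\<in>w ` {..<N}. norm (orbit_sum K a v) ^ (2 * \<nu>))"
      by (simp add: sum.reindex[OF inj])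
    also have "\<dots> \<le> (\<Sum>v\<in>V. norm (orbit_sum K a v) ^ (2 * \<nu>))"
      using w(1) by (intro sum_mono2) auto
    finally show "(\<Sum>n<N. norm (orbit_sum K a (w n)) ^ (2 * \<nu>)) \<le> (\<Sum>v\<in>V. norm (orbit_sum K a v) ^ (2 * \<nu>))" .
  qed simp
  also have "\<dots> \<le> (real \<nu> ^ \<nu> * real K ^ \<nu> * real p ^ (m + 1) + real K ^ (2 * \<nu>) * (real (m + 1) * (real K * real (d + 1)) * real p ^ m)) / real N"
  proof (rule divide_right_mono)
    show "(\<Sum>v\<in>V. norm (orbit_sum K a v) ^ (2 * \<nu>)) \<le> real \<nu> ^ \<nu> * real K ^ \<nu> * real p ^ (m + 1)
        + real K ^ (2 * \<nu>) * (real (m + 1) * (real K * real (d + 1)) * real p ^ m)"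
      by (rule moment_bound[where a = a, OF i _ a(2) \<nu>]) (rule a(1))
  qed simp
  finally have up: "(real K * x) ^ (2 * \<nu>) \<le> (real \<nu> ^ \<nu> * real K ^ \<nu> * real p ^ (m + 1) + real K ^ (2 * \<nu>) * (real (m + 1) * (real K * real (d + 1)) * real p ^ m)) / real N"
    (is "_ \<le> ?R") .
  have "real K ^ (2 * \<nu>) > 0" using K by simp
  moreover have "x ^ (2 * \<nu>) * real K ^ (2 * \<nu>) \<le> ?R"
    using up by (simp only: power_mult_distrib mult.commute[of "x ^ (2 * \<nu>)"])
  ultimately have "x ^ (2 * \<nu>) \<le> ?R / real K ^ (2 * \<nu>)" by (simp only: pos_le_divide_eq)
  also have "\<dots> = real \<nu> ^ \<nu> * real p ^ (m + 1) / (real K ^ \<nu> * real N)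
    + real (m + 1) * real (d + 1) * real K * real p ^ m / real N"
  proof -
    define k where "k = real K ^ \<nu>"
    have k2: "real K ^ (2 * \<nu>) = k * k" by (simp add: k_def mult_2 power_add)
    have k: "k > 0" "real N > 0" using K N by (simp_all add: k_def)
    have "(A * k * B + k * k * (C * (real K * D) * E)) / real N / (k * k)
        = A * B / (k * real N) + C * D * real K * E / real N" for A B C D E :: real
      using k by (simp add: add_divide_distrib) (simp add: field_simps)
    thus ?thesis unfolding k2 k_def .
  qed
  finally show ?thesis .
qed

end

section \<open>From exponential sums to discrepancy\<close>

text \<open>The norm equals \<open>2 sin (\<pi> a / p)\<close>, and \<open>sin x \<ge> x - x^3/6 \<ge> x/3\<close> for
\<open>0 \<le> x \<le> 2\<close>.\<close>

lemma norm_one_minus_echar: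
  assumes a: "0 < a" "2 * a \<le> int p"
  shows "2 * real_of_int a / real p \<le> norm (1 - echar p a)"
proof -
  define x where "x = pi * real_of_int a / real p"
  have p: "p > 0" using a by simp
  have x: "0 \<le> x" "x \<le> 2"
  proof -
    show "0 \<le> x" using a by (simp add: x_def)
    have "real_of_int a / real p \<le> 1 / 2" using a p by (simp add: field_simps)
    hence "pi * (real_of_int a / real p) \<le> 4 * (1 / 2)"
      using a pi_less_4 by (intro mult_mono) auto
    thus "x \<le> 2" by (simp add: x_def)
  qed
  have "\<bar>sin x - (\<Sum>m<3. sin_coeff m * x ^ m)\<bar> \<le> inverse (fact 3) * \<bar>x\<bar> ^ 3"
    by (rule Maclaurin_sin_bound)
  hence "\<bar>sin x - x\<bar> \<le> x ^ 3 / 6"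
    using x by (simp add: eval_nat_numeral sin_coeff_def fact_numeral)
  moreover have "x ^ 3 / 6 \<le> x * (2 / 3)"
  proof -
    have "x * (x * x) \<le> x * (2 * 2)" using x by (intro mult_left_mono mult_mono) auto
    thus ?thesis by (simp add: eval_nat_numeral)
  qed
  ultimately have s: "x / 3 \<le> sin x" by linarith
  have "2 * x = 2 * pi * real_of_int a / real p" by (simp add: x_def)
  hence e: "echar p a = cis (2 * x)" by (simp add: echar_def)
  have "(norm (1 - echar p a))\<^sup>2 = (1 - cos (2 * x))\<^sup>2 + (sin (2 * x))\<^sup>2"
    by (simp add: e cmod_power2)
  also have "\<dots> = (2 * sin x)\<^sup>2"
  proof -
    have c: "(cos x)\<^sup>2 = 1 - (sin x)\<^sup>2" using sin_cos_squared_add[of x] by linarith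
    have "(1 - cos (2 * x))\<^sup>2 + (sin (2 * x))\<^sup>2 = (2 * (sin x)\<^sup>2)\<^sup>2 + 4 * (sin x)\<^sup>2 * (cos x)\<^sup>2"
      by (simp add: cos_double_sin sin_double power_mult_distrib)
    thus ?thesis unfolding c by (simp add: algebra_simps power2_eq_square)
  qed
  finally have "norm (1 - echar p a) = 2 * sin x"
    using s x by (subst (asm) power2_eq_iff_nonneg) auto
  moreover have "2 * real_of_int a / real p \<le> 2 * (x / 3)"
  proof -
    have "3 * real_of_int a / real p \<le> pi * real_of_int a / real p"
      using a pi_gt3 by (intro divide_right_mono mult_right_mono) auto
    thus ?thesis by (simp add: x_def)
  qed
  ultimately show ?thesis using s by linarith
qed

text \<open>A geometric sum has norm at most \<open>2 / |1 - e(a/p)| \<le> p / min a (p - a)\<close>; the sum of the two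
reciprocals is easier to add up over \<open>a\<close>.\<close>

lemma norm_interval_sum_le:
  assumes a: "0 < a" "a < int p"
  shows "norm (\<Sum>y\<in>{lo..<hi}. echar p (- (a * y))) \<le> real p * (1 / real_of_int a + 1 / real_of_int (int p - a))"
proof (cases "lo \<le> hi")
  case False
  thus ?thesis using a by simp
next
  case True
  define z where "z = echar p (- a)"
  define k where "k = nat (hi - lo)"
  have p: "p > 0" using a by simp
  have nz: "norm (1 - z) = norm (1 - echar p a)"
  proof -
    have "1 - z = cnj (1 - echar p a)" by (simp add: z_def cnj_echar)
    thus ?thesis by (simp only: complex_mod_cnj)
  qed
  have nz': "norm (1 - echar p a) = norm (1 - echar p (int p - a))"
  proof -
    have "echar p (int p - a) = z" unfolding z_def by (intro echar_cong[OF _ p]) (simp add: cong_def)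
    thus ?thesis by (simp add: nz)
  qed
  define b where "b = min a (int p - a)"
  have b: "0 < b" "2 * b \<le> int p" using a by (auto simp: b_def min_def)
  have low: "2 * real_of_int b / real p \<le> norm (1 - z)"
    using norm_one_minus_echar[OF b] nz nz' by (auto simp: b_def min_def split: if_splits)
  have z1: "z \<noteq> 1" using a p by (auto simp: z_def echar_eq_1_iff zdvd_not_zless)
  have "(\<Sum>y\<in>{lo..<hi}. echar p (- (a * y))) = (\<Sum>n<k. echar p (- (a * (lo + int n))))"
    by (rule sum.reindex_bij_witness[of _ "\<lambda>n. lo + int n" "\<lambda>y. nat (y - lo)"]) (auto simp: k_def)
  also have "\<dots> = (\<Sum>n<k. echar p (- (a * lo)) * z ^ n)"
  proof (intro sum.cong refl)
    fix n
    have "echar p (- (a * (lo + int n))) = echar p (- (a * lo) + (- a) * int n)" by (simp add: algebra_simps)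
    also have "\<dots> = echar p (- (a * lo)) * z ^ n" by (simp only: echar_add echar_mult_nat z_def)
    finally show "echar p (- (a * (lo + int n))) = echar p (- (a * lo)) * z ^ n" .
  qed
  also have "\<dots> = echar p (- (a * lo)) * ((1 - z ^ k) / (1 - z))"
    using z1 by (simp add: sum_gp_strict flip: sum_distrib_left)
  finally have "norm (\<Sum>y\<in>{lo..<hi}. echar p (- (a * y))) = norm (1 - z ^ k) / norm (1 - z)"
    by (simp add: norm_mult norm_divide)
  also have "\<dots> \<le> 2 / norm (1 - z)"
  proof (intro divide_right_mono)
    have "norm (1 - z ^ k) \<le> norm (1::complex) + norm (z ^ k)" by (rule norm_triangle_ineq4)
    also have "norm (z ^ k) = 1" by (simp add: norm_power z_def)
    finally show "norm (1 - z ^ k) \<le> 2" by simp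
  qed simp
  also have "\<dots> \<le> 2 / (2 * real_of_int b / real p)"
    using low b p z1 by (intro divide_left_mono) (auto intro!: mult_pos_pos)
  also have "\<dots> = real p * (1 / real_of_int b)" by simp
  also have "\<dots> \<le> real p * (1 / real_of_int a + 1 / real_of_int (int p - a))"
    using a by (intro mult_left_mono) (auto simp: b_def min_def)
  finally show ?thesis .
qed

lemma harm_le_one_plus_ln: "n > 0 \<Longrightarrow> (harm n :: real) \<le> 1 + ln (real n)"
  using decseqD[OF decseq_harm_diff_ln, of 0 "n - 1"] by (simp add: harm_Suc harm_def)

definition fourier_coeff :: "nat \<Rightarrow> int set \<Rightarrow> int \<Rightarrow> complex" where
  "fourier_coeff p I a = (\<Sum>y\<in>I. echar p (- (a * y))) / of_nat p"

lemma fourier_inversion: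
  assumes p: "p > 0" and I: "I \<subseteq> {0..<int p}" and x: "x \<in> {0..<int p}"
  shows "(\<Sum>a\<in>{0..<int p}. fourier_coeff p I a * echar p (a * x)) = of_bool (x \<in> I)"
proof -
  have fin: "finite I" using I finite_subset by blast
  have "(\<Sum>a\<in>{0..<int p}. fourier_coeff p I a * echar p (a * x))
      = (\<Sum>a\<in>{0..<int p}. \<Sum>y\<in>I. echar p ((x - y) * a + 0) / of_nat p)"
    unfolding fourier_coeff_def sum_divide_distrib sum_distrib_right
    by (intro sum.cong refl) (simp add: algebra_simps flip: echar_add)
  also have "\<dots> = (\<Sum>y\<in>I. \<Sum>a\<in>{0..<int p}. echar p ((x - y) * a + 0) / of_nat p)" by (rule sum.swap)
  also have "\<dots> = (\<Sum>y\<in>I. of_bool (y = x))"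
  proof (intro sum.cong refl)
    fix y assume y: "y \<in> I"
    have "int p dvd x - y \<longleftrightarrow> y = x"
    proof
      assume "int p dvd x - y"
      hence "x mod int p = y mod int p" by (simp add: mod_eq_dvd_iff)
      thus "y = x" using x y I by (auto simp: subset_iff)
    qed simp
    thus "(\<Sum>a\<in>{0..<int p}. echar p ((x - y) * a + 0) / of_nat p) = of_bool (y = x)"
      using p sum_echar_linear[OF p, of "x - y" 0] by (simp flip: sum_divide_distrib)
  qed
  also have "\<dots> = of_bool (x \<in> I)" using fin by (auto simp: of_bool_def)
  finally show ?thesis .
qed

lemma fourier_coeff_l1:
  assumes p: "p > 0" and I: "{lo..<hi} \<subseteq> {0..<int p}"
  shows "(\<Sum>a\<in>{0..<int p}. norm (fourier_coeff p {lo..<hi} a)) \<le> 3 + 2 * ln (real p)"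
proof -
  have "(\<Sum>a\<in>{0..<int p}. norm (fourier_coeff p {lo..<hi} a))
      = norm (fourier_coeff p {lo..<hi} 0) + (\<Sum>a\<in>{1..<int p}. norm (fourier_coeff p {lo..<hi} a))"
  proof -
    have "{0..<int p} = insert 0 {1..<int p}" using p by auto
    thus ?thesis by simp
  qed
  also have "norm (fourier_coeff p {lo..<hi} 0) \<le> 1"
  proof -
    have "card {lo..<hi} \<le> card {0..<int p}" using I by (intro card_mono) auto
    thus ?thesis using p by (simp add: fourier_coeff_def norm_divide)
  qed
  also have "(\<Sum>a\<in>{1..<int p}. norm (fourier_coeff p {lo..<hi} a))
      \<le> (\<Sum>a\<in>{1..<int p}. 1 / real_of_int a + 1 / real_of_int (int p - a))"
  proof (intro sum_mono)
    fix a assume "a \<in> {1..<int p}"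
    hence "norm (\<Sum>y\<in>{lo..<hi}. echar p (- (a * y))) \<le> real p * (1 / real_of_int a + 1 / real_of_int (int p - a))"
      by (intro norm_interval_sum_le) auto
    thus "norm (fourier_coeff p {lo..<hi} a) \<le> 1 / real_of_int a + 1 / real_of_int (int p - a)"
      using p by (simp add: fourier_coeff_def norm_divide divide_le_eq mult.commute)
  qed
  also have "\<dots> = harm (p - 1) + harm (p - 1)"
  proof -
    have "(\<Sum>a\<in>{1..<int p}. 1 / real_of_int a) = harm (p - 1)"
      unfolding harm_def by (rule sum.reindex_bij_witness[of _ int nat]) (auto simp: field_simps)
    moreover have "(\<Sum>a\<in>{1..<int p}. 1 / real_of_int (int p - a)) = (\<Sum>a\<in>{1..<int p}. 1 / real_of_int a)"
      by (rule sum.reindex_bij_witness[of _ "\<lambda>a. int p - a" "\<lambda>a. int p - a"]) auto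
    ultimately show ?thesis by (simp only: sum.distrib)
  qed
  also have "harm (p - 1) \<le> 1 + ln (real p)"
  proof (cases "p = 1")
    case True thus ?thesis by (simp add: harm_def)
  next
    case False
    hence "harm (p - 1) \<le> 1 + ln (real (p - 1))" using p by (intro harm_le_one_plus_ln) auto
    also have "\<dots> \<le> 1 + ln (real p)" using p False by simp
    finally show ?thesis .
  qed
  finally show ?thesis by simp
qed

text \<open>Expand the indicator of each interval in characters. The zero frequency gives the expected number of
points, and the rest is at most \<open>\<eta>\<close> times a product of sums of absolute values of Fourier
coefficients.\<close>

lemma box_count:
  fixes u :: "nat \<Rightarrow> nat \<Rightarrow> int" and lo hi :: "nat \<Rightarrow> int"
  assumes p: "p > 0" and N: "N > 0"
    and u: "\<And>n k. n < N \<Longrightarrow> k < s \<Longrightarrow> u n k \<in> {0..<int p}"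
    and I: "\<And>k. k < s \<Longrightarrow> {lo k..<hi k} \<subseteq> {0..<int p}"
    and sums: "\<And>a. a \<in> {..<s} \<rightarrow>\<^sub>E {0..<int p} \<Longrightarrow> \<exists>k<s. a k \<noteq> 0 \<Longrightarrow>
      norm (\<Sum>n<N. echar p (\<Sum>k<s. a k * u n k)) \<le> \<eta> * real N"
    and \<eta>: "\<eta> \<ge> 0"
  shows "\<bar>real (card {n. n < N \<and> (\<forall>k<s. u n k \<in> {lo k..<hi k})}) / real N
    - (\<Prod>k<s. real (card {lo k..<hi k}) / real p)\<bar> \<le> \<eta> * (3 + 2 * ln (real p)) ^ s"
proof -
  define c where "c = (\<lambda>k. fourier_coeff p {lo k..<hi k})"
  define A where "A = {..<s} \<rightarrow>\<^sub>E {0..<int p}"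
  define C where "C = (\<lambda>a. \<Prod>k<s. c k (a k))"
  define S where "S = (\<lambda>a. \<Sum>n<N. echar p (\<Sum>k<s. a k * u n k))"
  define a0 where "a0 = (\<lambda>k\<in>{..<s}. 0::int)"
  have finA: "finite A" unfolding A_def by (intro finite_PiE) auto
  have a0: "a0 \<in> A" using p by (auto simp: A_def a0_def)
  have "complex_of_real (real (card {n. n < N \<and> (\<forall>k<s. u n k \<in> {lo k..<hi k})}))
     = (\<Sum>n<N. of_bool (\<forall>k<s. u n k \<in> {lo k..<hi k}))"
  proof -
    have "{n. n < N \<and> (\<forall>k<s. u n k \<in> {lo k..<hi k})} = {..<N} \<inter> {n. \<forall>k<s. u n k \<in> {lo k..<hi k}}" by auto
    thus ?thesis by (simp add: of_bool_def sum.If_cases)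
  qed
  also have "\<dots> = (\<Sum>n<N. \<Prod>k<s. of_bool (u n k \<in> {lo k..<hi k}))"
  proof (intro sum.cong refl)
    fix n
    have "of_bool (\<forall>k<s. P k) = (\<Prod>k<s. of_bool (P k) :: complex)" for P
      by (induction s) (auto simp: less_Suc_eq)
    thus "of_bool (\<forall>k<s. u n k \<in> {lo k..<hi k}) = (\<Prod>k<s. of_bool (u n k \<in> {lo k..<hi k}) :: complex)" .
  qed
  also have "\<dots> = (\<Sum>n<N. \<Prod>k<s. \<Sum>x\<in>{0..<int p}. c k x * echar p (x * u n k))"
    unfolding c_def using u by (intro sum.cong prod.cong refl fourier_inversion[OF p I, symmetric]) auto
  also have "\<dots> = (\<Sum>n<N. \<Sum>a\<in>A. \<Prod>k<s. c k (a k) * echar p (a k * u n k))"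
    unfolding A_def by (intro sum.cong refl prod_sum_PiE) auto
  also have "\<dots> = (\<Sum>a\<in>A. \<Sum>n<N. \<Prod>k<s. c k (a k) * echar p (a k * u n k))" by (rule sum.swap)
  also have "\<dots> = (\<Sum>a\<in>A. C a * S a)"
    unfolding C_def S_def sum_distrib_left by (intro sum.cong refl) (simp add: prod.distrib echar_sum)
  also have "\<dots> = C a0 * S a0 + (\<Sum>a\<in>A - {a0}. C a * S a)"
    using finA a0 by (simp add: sum.remove)
  finally have e: "complex_of_real (real (card {n. n < N \<and> (\<forall>k<s. u n k \<in> {lo k..<hi k})}))
    = C a0 * S a0 + (\<Sum>a\<in>A - {a0}. C a * S a)" .
  have "C a0 = of_real (\<Prod>k<s. real (card {lo k..<hi k}) / real p)"
    unfolding C_def c_def of_real_prod by (intro prod.cong refl) (simp add: a0_def fourier_coeff_def)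
  moreover have "S a0 = of_nat N" by (simp add: S_def a0_def)
  ultimately have e2: "complex_of_real (real (card {n. n < N \<and> (\<forall>k<s. u n k \<in> {lo k..<hi k})})
      - (\<Prod>k<s. real (card {lo k..<hi k}) / real p) * real N) = (\<Sum>a\<in>A - {a0}. C a * S a)"
    using e by simp
  have "\<bar>real (card {n. n < N \<and> (\<forall>k<s. u n k \<in> {lo k..<hi k})})
      - (\<Prod>k<s. real (card {lo k..<hi k}) / real p) * real N\<bar> = norm (\<Sum>a\<in>A - {a0}. C a * S a)"
    unfolding e2[symmetric] norm_of_real ..
  also have "\<dots> \<le> (\<Sum>a\<in>A - {a0}. norm (C a) * norm (S a))"
    by (rule order_trans[OF norm_sum]) (simp add: norm_mult)
  also have "\<dots> \<le> (\<Sum>a\<in>A - {a0}. norm (C a) * (\<eta> * real N))"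
  proof (intro sum_mono mult_left_mono)
    fix a assume a: "a \<in> A - {a0}"
    have "\<exists>k<s. a k \<noteq> 0"
    proof (rule ccontr)
      assume "\<not> ?thesis"
      hence "a = a0" using a by (auto simp: A_def a0_def PiE_def extensional_def fun_eq_iff)
      thus False using a by simp
    qed
    thus "norm (S a) \<le> \<eta> * real N" unfolding S_def using a by (intro sums) (auto simp: A_def)
  qed simp
  also have "\<dots> \<le> (\<Sum>a\<in>A. norm (C a) * (\<eta> * real N))"
    using finA \<eta> by (intro sum_mono2) auto
  also have "\<dots> = (\<Sum>a\<in>A. \<Prod>k<s. norm (c k (a k))) * (\<eta> * real N)"
    by (simp add: C_def prod_norm sum_distrib_right)
  also have "(\<Sum>a\<in>A. \<Prod>k<s. norm (c k (a k))) = (\<Prod>k<s. \<Sum>x\<in>{0..<int p}. norm (c k x))"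
    unfolding A_def by (rule prod_sum_PiE[symmetric]) auto
  also have "(\<Prod>k<s. \<Sum>x\<in>{0..<int p}. norm (c k x)) * (\<eta> * real N) \<le> (3 + 2 * ln (real p)) ^ s * (\<eta> * real N)"
  proof (intro mult_right_mono)
    have "(\<Prod>k<s. \<Sum>x\<in>{0..<int p}. norm (c k x)) \<le> (\<Prod>k<s. 3 + 2 * ln (real p))"
      unfolding c_def using fourier_coeff_l1[OF p I] by (intro prod_mono conjI sum_nonneg) auto
    thus "(\<Prod>k<s. \<Sum>x\<in>{0..<int p}. norm (c k x)) \<le> (3 + 2 * ln (real p)) ^ s" by simp
  qed (use \<eta> in auto)
  finally have "\<bar>real (card {n. n < N \<and> (\<forall>k<s. u n k \<in> {lo k..<hi k})})
      - (\<Prod>k<s. real (card {lo k..<hi k}) / real p) * real N\<bar> \<le> (3 + 2 * ln (real p)) ^ s * (\<eta> * real N)" .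
  hence "\<bar>real (card {n. n < N \<and> (\<forall>k<s. u n k \<in> {lo k..<hi k})})
      - (\<Prod>k<s. real (card {lo k..<hi k}) / real p) * real N\<bar> / real N \<le> \<eta> * (3 + 2 * ln (real p)) ^ s"
    using N by (simp add: divide_le_eq mult_ac)
  moreover have "\<bar>x - y * real N\<bar> / real N = \<bar>x / real N - y\<bar>" for x y
  proof -
    have "x / real N - y = (x - y * real N) / real N" using N by (simp add: field_simps)
    thus ?thesis by simp
  qed
  ultimately show ?thesis by simp
qed

text \<open>A box and the grid box of the residues in it have volumes that differ by at most \<open>1/p\<close> in each
coordinate.\<close>

lemma discrepancy_le:
  fixes u :: "nat \<Rightarrow> nat \<Rightarrow> int"
  assumes p: "p > 0" and N: "N > 0"
    and u: "\<And>n k. n < N \<Longrightarrow> k < s \<Longrightarrow> u n k \<in> {0..<int p}"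
    and sums: "\<And>a. a \<in> {..<s} \<rightarrow>\<^sub>E {0..<int p} \<Longrightarrow> \<exists>k<s. a k \<noteq> 0 \<Longrightarrow>
      norm (\<Sum>n<N. echar p (\<Sum>k<s. a k * u n k)) \<le> \<eta> * real N"
    and \<eta>: "\<eta> \<ge> 0"
  shows "discrepancy s N (\<lambda>n k. real_of_int (u n k) / real p) \<le> \<eta> * (3 + 2 * ln (real p)) ^ s + real s / real p"
  unfolding discrepancy_def
proof (rule cSUP_least)
  show "{(\<alpha>, \<beta>). \<forall>k<s. 0 \<le> \<alpha> k \<and> \<alpha> k \<le> \<beta> k \<and> \<beta> k \<le> (1::real)} \<noteq> {}"
    by (auto intro!: exI[of _ "\<lambda>_. 0"])
  fix q :: "(nat \<Rightarrow> real) \<times> (nat \<Rightarrow> real)"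
  assume "q \<in> {(\<alpha>, \<beta>). \<forall>k<s. 0 \<le> \<alpha> k \<and> \<alpha> k \<le> \<beta> k \<and> \<beta> k \<le> (1::real)}"
  then obtain \<alpha> \<beta> where q: "q = (\<alpha>, \<beta>)" and ab: "\<And>k. k < s \<Longrightarrow> 0 \<le> \<alpha> k \<and> \<alpha> k \<le> \<beta> k \<and> \<beta> k \<le> 1"
    by auto
  define lo where "lo = (\<lambda>k. \<lceil>real p * \<alpha> k\<rceil>)"
  define hi where "hi = (\<lambda>k. \<lceil>real p * \<beta> k\<rceil>)"
  have p1: "real p \<ge> 1" using p by simp
  have I: "{lo k..<hi k} \<subseteq> {0..<int p}" "lo k \<le> hi k" if "k < s" for k
  proof -
    have "0 \<le> lo k" using ab[OF that] p by (simp add: lo_def zero_le_mult_iff) (smt (verit) mult_nonneg_nonneg of_nat_0_le_iff)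
    moreover have "hi k \<le> int p" unfolding hi_def using ab[OF that] p
      by (simp add: ceiling_le_iff mult_left_le)
    ultimately show "{lo k..<hi k} \<subseteq> {0..<int p}" by auto
    show "lo k \<le> hi k" unfolding lo_def hi_def using ab[OF that] p by (intro ceiling_mono mult_left_mono) auto
  qed
  have mem: "real_of_int x / real p \<in> {\<alpha> k..<\<beta> k} \<longleftrightarrow> x \<in> {lo k..<hi k}" for x k
    using p by (simp add: lo_def hi_def ceiling_le_iff less_ceiling_iff field_simps)
  have set: "{n. n < N \<and> (\<lambda>k. real_of_int (u n k) / real p) \<in> Pi {..<s} (\<lambda>k. {\<alpha> k..<\<beta> k})}
    = {n. n < N \<and> (\<forall>k<s. u n k \<in> {lo k..<hi k})}"
    unfolding Pi_iff mem by (simp only: lessThan_iff Ball_def)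
  have "\<bar>(\<Prod>k<s. real (card {lo k..<hi k}) / real p) - (\<Prod>k<s. \<beta> k - \<alpha> k)\<bar> \<le> (\<Sum>k<s. 1 / real p)"
  proof -
    have "norm ((\<Prod>k<s. real (card {lo k..<hi k}) / real p) - (\<Prod>k<s. \<beta> k - \<alpha> k))
      \<le> (\<Sum>k<s. norm (real (card {lo k..<hi k}) / real p - (\<beta> k - \<alpha> k)))"
    proof (rule norm_prod_diff)
      fix k assume k: "k \<in> {..<s}"
      have "card {lo k..<hi k} \<le> card {0..<int p}" using I k by (intro card_mono) auto
      thus "norm (real (card {lo k..<hi k}) / real p) \<le> 1" using p by simp
      show "norm (\<beta> k - \<alpha> k) \<le> 1" using ab[of k] k by auto
    qed
    also have "\<dots> \<le> (\<Sum>k<s. 1 / real p)"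
    proof (intro sum_mono)
      fix k assume k: "k \<in> {..<s}"
      have "real (card {lo k..<hi k}) = real_of_int (hi k) - real_of_int (lo k)" using I(2)[of k] k by simp
      hence "\<bar>real (card {lo k..<hi k}) - (real p * \<beta> k - real p * \<alpha> k)\<bar> \<le> 1"
        unfolding lo_def hi_def by linarith
      hence "\<bar>real (card {lo k..<hi k}) - (real p * \<beta> k - real p * \<alpha> k)\<bar> / real p \<le> 1 / real p"
        by (intro divide_right_mono) auto
      moreover have "real (card {lo k..<hi k}) / real p - (\<beta> k - \<alpha> k) = (real (card {lo k..<hi k}) - (real p * \<beta> k - real p * \<alpha> k)) / real p"
        using p by (simp add: field_simps)
      ultimately show "norm (real (card {lo k..<hi k}) / real p - (\<beta> k - \<alpha> k)) \<le> 1 / real p" by simp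
    qed
    finally show ?thesis by simp
  qed
  moreover have "\<bar>real (card {n. n < N \<and> (\<forall>k<s. u n k \<in> {lo k..<hi k})}) / real N
    - (\<Prod>k<s. real (card {lo k..<hi k}) / real p)\<bar> \<le> \<eta> * (3 + 2 * ln (real p)) ^ s"
  proof (rule box_count[OF p N _ _ _ \<eta>])
    show "u n k \<in> {0..<int p}" if "n < N" "k < s" for n k by (rule u[OF that])
    show "{lo k..<hi k} \<subseteq> {0..<int p}" if "k < s" for k by (rule I(1)[OF that])
  qed (rule sums)
  ultimately show "(case q of (\<alpha>, \<beta>) \<Rightarrow> \<bar>real (card {n. n < N \<and> (\<lambda>k. real_of_int (u n k) / real p) \<in> Pi {..<s} (\<lambda>k. {\<alpha> k..<\<beta> k})}) / real N
      - (\<Prod>k<s. \<beta> k - \<alpha> k)\<bar>) \<le> \<eta> * (3 + 2 * ln (real p)) ^ s + real s / real p"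
    unfolding q prod.case set by simp
qed

section \<open>Polynomial systems are triangular\<close>

abbreviation "lookup \<equiv> Poly_Mapping.lookup"
abbreviation "keys \<equiv> Poly_Mapping.keys"
abbreviation "single \<equiv> Poly_Mapping.single"

definition mono_eval :: "(nat \<Rightarrow>\<^sub>0 nat) \<Rightarrow> (nat \<Rightarrow> int) \<Rightarrow> int" where
  "mono_eval t x = (\<Prod>j\<in>keys t. x j ^ lookup t j)"

lemma mpoly_eval_eq: "mpoly_eval P x = (\<Sum>t\<in>keys P. lookup P t * mono_eval t x)"
  by (simp add: mpoly_eval_def mono_eval_def)

lemma mono_eval_superset:
  assumes "finite A" "keys t \<subseteq> A"
  shows "mono_eval t x = (\<Prod>j\<in>A. x j ^ lookup t j)"
  unfolding mono_eval_def using assms by (intro prod.mono_neutral_left) (auto simp: in_keys_iff)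

lemma mono_eval_add: "mono_eval (s + t) x = mono_eval s x * mono_eval t x"
proof -
  have "keys (s + t) \<subseteq> keys s \<union> keys t" by (rule keys_add)
  hence "mono_eval (s + t) x = (\<Prod>j\<in>keys s \<union> keys t. x j ^ lookup (s + t) j)"
    by (intro mono_eval_superset) auto
  also have "\<dots> = (\<Prod>j\<in>keys s \<union> keys t. x j ^ lookup s j) * (\<Prod>j\<in>keys s \<union> keys t. x j ^ lookup t j)"
    by (simp add: lookup_add power_add prod.distrib)
  also have "\<dots> = mono_eval s x * mono_eval t x"
    by (simp add: mono_eval_superset[of "keys s \<union> keys t"])
  finally show ?thesis .
qed

lemma mpoly_eval_superset:
  assumes "finite A" "keys P \<subseteq> A"
  shows "mpoly_eval P x = (\<Sum>t\<in>A. lookup P t * mono_eval t x)"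
  unfolding mpoly_eval_eq using assms by (intro sum.mono_neutral_left) (auto simp: in_keys_iff)

lemma mpoly_eval_add: "mpoly_eval (P + Q) x = mpoly_eval P x + mpoly_eval Q x"
proof -
  have "keys (P + Q) \<subseteq> keys P \<union> keys Q" by (rule keys_add)
  thus ?thesis
    by (simp add: mpoly_eval_superset[of "keys P \<union> keys Q"] lookup_add distrib_right sum.distrib)
qed

lemma mpoly_eval_0 [simp]: "mpoly_eval 0 x = 0"
  by (simp add: mpoly_eval_eq)

lemma mpoly_eval_sum: "mpoly_eval (\<Sum>i\<in>A. f i) x = (\<Sum>i\<in>A. mpoly_eval (f i) x)"
  by (induction A rule: infinite_finite_induct) (simp_all add: mpoly_eval_add)

lemma mpoly_eval_single: "mpoly_eval (single t a) x = a * mono_eval t x"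
  by (subst mpoly_eval_superset[of "{t}"]) auto

lemma mpoly_monomials: "P = (\<Sum>t\<in>keys P. single t (lookup P t))"
  by (rule poly_mapping_eqI) (auto simp: lookup_sum lookup_single when_def in_keys_iff)

lemma single_mult_monomials: "single s a * Q = (\<Sum>t\<in>keys Q. single (s + t) (a * lookup Q t))"
  by (subst mpoly_monomials[of Q]) (simp add: sum_distrib_left mult_single)

lemma mpoly_eval_single_mult: "mpoly_eval (single s a * Q) x = a * mono_eval s x * mpoly_eval Q x"
  unfolding single_mult_monomials mpoly_eval_sum mpoly_eval_single mono_eval_add mpoly_eval_eq[of Q]
  by (simp add: sum_distrib_left mult_ac)

lemma lookup_single_mult:
  fixes Q :: int_mpoly
  shows "lookup (single s a * Q) (s + t) = a * lookup Q t"
proof -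
  have "s + x = s + t \<longleftrightarrow> x = t" for x
    by (metis add_left_cancel lookup_add poly_mapping_eqI)
  thus ?thesis
    unfolding single_mult_monomials lookup_sum lookup_single by (simp add: when_def in_keys_iff)
qed

lemma mpoly_eval_poly_cong:
  assumes "poly_cong p P Q"
  shows "[mpoly_eval P x = mpoly_eval Q x] (mod int p)"
proof -
  have "[(\<Sum>t\<in>keys P \<union> keys Q. lookup P t * mono_eval t x) = (\<Sum>t\<in>keys P \<union> keys Q. lookup Q t * mono_eval t x)] (mod int p)"
    using assms by (intro cong_sum cong_mult) (auto simp: poly_cong_def)
  thus ?thesis by (simp add: mpoly_eval_superset[of "keys P \<union> keys Q"])
qed

lemma mpoly_eval_cong:
  assumes P: "P \<in> Fp_polys p A" and v: "\<And>j. j \<in> A \<Longrightarrow> [v j = v' j] (mod int p)"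
  shows "[mpoly_eval P v = mpoly_eval P v'] (mod int p)"
  unfolding mpoly_eval_def using assms
  by (intro cong_sum cong_mult cong_prod cong_pow) (auto simp: Fp_polys_def)

lemma prod_X_power: "(\<Prod>j\<in>A. X j ^ f j) = single (\<Sum>j\<in>A. single j (f j)) 1"
proof -
  have "X j ^ n = single (single j n) 1" for j n
    by (induction n) (simp_all add: X_def mult_single flip: single_add)
  thus ?thesis
    by (induction A rule: infinite_finite_induct) (simp_all add: mult_single)
qed

lemma lookup_sum_single:
  "finite A \<Longrightarrow> lookup (\<Sum>j\<in>A. single j (f j)) i = (if i \<in> A then f i else (0::nat))"
  by (simp add: lookup_sum lookup_single when_def)

lemma lookup_lt_of_deg_in_lt:
  assumes "deg_in j P < ereal (real n)" "t \<in> keys P"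
  shows "lookup t j < n"
proof -
  have "ereal (real (lookup t j)) \<le> deg_in j P" unfolding deg_in_def using assms(2) by (rule SUP_upper)
  hence "ereal (real (lookup t j)) < ereal (real n)" using assms(1) by (rule le_less_trans)
  thus ?thesis by simp
qed

text \<open>This is how the total degree enters: it bounds the degree of \<open>G i\<close> in the next variable.\<close>

lemma exponent_le_system_deg:
  assumes "system_deg m F = ereal (real d)" "i \<le> m" "t \<in> keys (F i)"
  shows "lookup t j \<le> d"
proof -
  have "lookup t j \<le> (\<Sum>j\<in>keys t. lookup t j)"
  proof (cases "j \<in> keys t")
    case True thus ?thesis by (intro member_le_sum) auto
  qed (simp add: in_keys_iff)
  hence "ereal (real (lookup t j)) \<le> ereal (real (\<Sum>j\<in>keys t. lookup t j))" by (simp only: ereal_less_eq of_nat_le_iff)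
  also have "\<dots> \<le> total_deg (F i)" unfolding total_deg_def using assms(3) by (rule SUP_upper)
  also have "\<dots> \<le> system_deg m F" unfolding system_deg_def using assms(2) by (intro SUP_upper) auto
  finally show ?thesis using assms(1) by simp
qed

text \<open>The degree conditions on the remainder of \<open>G i\<close> make its leading monomial dominant in every variable,
in particular in the variable \<open>i + 1\<close>. That monomial, multiplied by the variable \<open>i\<close>, survives in the
reduction of \<open>F i\<close>, so its exponents are at most \<open>d\<close>.\<close>

lemma poly_system_triangular:
  assumes p: "prime p" and S: "(\<Prod>i<m. S $$ (i, i + 1)) \<noteq> 0" and F: "F \<in> poly_systems p S m"
    and deg: "system_deg m F = ereal (real d)"
  obtains G H where "triangular_system p m d G H (\<lambda>i. S $$ (i, Suc i))"
    "\<And>i v. i \<le> m \<Longrightarrow> [mpoly_eval (F i) v = v i * G i v + H i v] (mod int p)"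
    "\<And>v v'. G m v = G m v'" "\<And>v v'. H m v = H m v'"
proof -
  note conj = F[unfolded poly_systems_def mem_Collect_eq]
  define Q where "Q = (\<lambda>i G H G' g. G \<in> Fp_polys p {i+1..m} \<and> H \<in> Fp_polys p {i+1..m} \<and>
     G' \<in> Fp_polys p {i+1..m} \<and> g \<in> {1..<int p} \<and> poly_cong p (F i) (X i * G + H) \<and>
     poly_cong p G (const g * (\<Prod>j=i+1..m. X j ^ (S $$ (i, j))) + G') \<and>
     (\<forall>j\<in>{i+1..m}. deg_in j G' < ereal (real (S $$ (i, j)))))"
  have "\<exists>G H G' g. Q i G H G' g" if i: "i < m" for i
    using conj[THEN conjunct2, THEN conjunct1, rule_format, OF i] unfolding Q_def
    by (elim bexE conjE) (intro exI conjI; assumption?; blast)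
  hence "\<forall>i. \<exists>G H G' g. i < m \<longrightarrow> Q i G H G' g" by blast
  then obtain G H G' g where "\<And>i. i < m \<Longrightarrow> Q i (G i) (H i) (G' i) (g i)" by metis
  hence GH: "\<And>i. i < m \<Longrightarrow> G i \<in> Fp_polys p {i+1..m}" "\<And>i. i < m \<Longrightarrow> H i \<in> Fp_polys p {i+1..m}"
     "\<And>i. i < m \<Longrightarrow> G' i \<in> Fp_polys p {i+1..m}" "\<And>i. i < m \<Longrightarrow> g i \<in> {1..<int p}"
     "\<And>i. i < m \<Longrightarrow> poly_cong p (F i) (X i * G i + H i)"
     "\<And>i. i < m \<Longrightarrow> poly_cong p (G i) (const (g i) * (\<Prod>j=i+1..m. X j ^ (S $$ (i, j))) + G' i)"
     "\<And>i j. i < m \<Longrightarrow> j \<in> {i+1..m} \<Longrightarrow> deg_in j (G' i) < ereal (real (S $$ (i, j)))"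
    unfolding Q_def by blast+
  obtain a b where ab: "a \<in> {1..<int p}" "b \<in> {0..<int p}" "poly_cong p (F m) (const a * X m + const b)"
    using conj[THEN conjunct2, THEN conjunct2] by blast
  define \<G> where "\<G> = (\<lambda>i v. if i = m then a else mpoly_eval (G i) v)"
  define \<H> where "\<H> = (\<lambda>i v. if i = m then b else mpoly_eval (H i) v)"
  define T where "T = (\<lambda>i. \<Sum>j\<in>{i+1..m}. single j (S $$ (i, j)))"
  have lT: "lookup (T i) j = (if j \<in> {i+1..m} then S $$ (i, j) else 0)" for i j
    unfolding T_def by (rule lookup_sum_single) simp
  have lead: "const (g i) * (\<Prod>j=i+1..m. X j ^ (S $$ (i, j))) = single (T i) (g i)" for i
    unfolding prod_X_power const_def T_def by (simp add: mult_single)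
  have ndvd: "\<not> int p dvd c" if "c \<in> {1..<int p}" for c using that zdvd_not_zless by auto
  have spos: "0 < S $$ (i, Suc i)" if "i < m" for i using S that by simp
  have mX: "mono_eval (single i 1) v = v i" for i v by (subst mono_eval_superset[of "{i}"]) auto
  have sd: "S $$ (i, Suc i) \<le> d" if i: "i < m" for i
  proof -
    have "T i \<notin> keys (G' i)"
      using lookup_lt_of_deg_in_lt[OF GH(7)[OF i, of "Suc i"], of "T i"] i by (auto simp: lT)
    hence "lookup (G' i) (T i) = 0" by (simp add: in_keys_iff)
    hence c1: "[lookup (G i) (T i) = g i] (mod int p)"
      using GH(6)[OF i] unfolding lead poly_cong_def by (metis (no_types, lifting) add.right_neutral lookup_add lookup_single_eq)
    have "lookup (H i) (single i 1 + T i) = 0"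
    proof (rule ccontr)
      assume "lookup (H i) (single i 1 + T i) \<noteq> 0"
      hence "keys (single i 1 + T i) \<subseteq> {i+1..m}" using GH(2)[OF i] by (auto simp: Fp_polys_def in_keys_iff)
      moreover have "i \<in> keys (single i 1 + T i)" by (simp add: in_keys_iff lookup_add)
      ultimately show False by auto
    qed
    moreover have "lookup (X i * G i) (single i 1 + T i) = lookup (G i) (T i)"
      unfolding X_def lookup_single_mult by simp
    ultimately have "[lookup (F i) (single i 1 + T i) = lookup (G i) (T i)] (mod int p)"
      using GH(5)[OF i] unfolding poly_cong_def by (metis (no_types, lifting) add.right_neutral lookup_add)
    hence "[lookup (F i) (single i 1 + T i) = g i] (mod int p)" using c1 by (rule cong_trans)
    hence "lookup (F i) (single i 1 + T i) \<noteq> 0"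
      using ndvd[OF GH(4)[OF i]] by (metis cong_0_iff cong_sym)
    hence "single i 1 + T i \<in> keys (F i)" by (simp add: in_keys_iff)
    hence "lookup (single i 1 + T i) (Suc i) \<le> d"
      by (rule exponent_le_system_deg[OF deg less_imp_le[OF i]])
    thus ?thesis using i by (simp add: lookup_add lookup_single lT)
  qed
  have Gpoly: "\<exists>q::int poly. degree q \<le> S $$ (i, Suc i) \<and>
      (\<forall>x. [\<G> i (v(Suc i := x)) = poly q x] (mod int p)) \<and>
      ((\<forall>j. Suc i < j \<and> j \<le> m \<longrightarrow> \<not> int p dvd v j) \<longrightarrow> \<not> int p dvd coeff q (S $$ (i, Suc i)))"
    if i: "i < m" for i v
  proof -
    define s where "s = S $$ (i, Suc i)"
    define R where "R = (\<lambda>t. \<Prod>j\<in>keys t - {Suc i}. v j ^ lookup t j)"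
    have mR: "mono_eval t (v(Suc i := x)) = R t * x ^ lookup t (Suc i)" for t x
    proof -
      have "mono_eval t (v(Suc i := x)) = (\<Prod>j\<in>insert (Suc i) (keys t - {Suc i}). (v(Suc i := x)) j ^ lookup t j)"
        by (rule mono_eval_superset) auto
      also have "\<dots> = x ^ lookup t (Suc i) * (\<Prod>j\<in>keys t - {Suc i}. (v(Suc i := x)) j ^ lookup t j)"
        by (subst prod.insert) auto
      also have "(\<Prod>j\<in>keys t - {Suc i}. (v(Suc i := x)) j ^ lookup t j) = R t"
        unfolding R_def by (intro prod.cong refl) auto
      finally show ?thesis by (simp only: mult.commute)
    qed
    define q' where "q' = (\<Sum>t\<in>keys (G' i). Polynomial.monom (lookup (G' i) t * R t) (lookup t (Suc i)))"
    define q where "q = Polynomial.monom (g i * R (T i)) s + q'"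
    have lt: "lookup t (Suc i) < s" if "t \<in> keys (G' i)" for t
      using lookup_lt_of_deg_in_lt[OF GH(7)[OF i, of "Suc i"] that] i by (simp add: s_def)
    have cq': "coeff q' n = 0" if "s \<le> n" for n
      unfolding q'_def coeff_sum
    proof (intro sum.neutral ballI)
      fix t assume "t \<in> keys (G' i)"
      from lt[OF this] that show "coeff (Polynomial.monom (lookup (G' i) t * R t) (lookup t (Suc i))) n = 0"
        by (simp add: coeff_monom)
    qed
    have "degree q \<le> s"
      unfolding q_def using cq' by (intro degree_add_le degree_monom_le degree_le) auto
    moreover have "[\<G> i (v(Suc i := x)) = poly q x] (mod int p)" for x
    proof -
      have "[\<G> i (v(Suc i := x)) = mpoly_eval (single (T i) (g i) + G' i) (v(Suc i := x))] (mod int p)"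
        using mpoly_eval_poly_cong[OF GH(6)[OF i, unfolded lead], of "v(Suc i := x)"] i by (simp add: \<G>_def)
      also have "mpoly_eval (single (T i) (g i) + G' i) (v(Suc i := x)) = poly q x"
      proof -
        have "lookup (T i) (Suc i) = s" using i by (simp add: lT s_def)
        thus ?thesis
          by (simp add: mpoly_eval_add mpoly_eval_single mR mpoly_eval_eq[of "G' i"] q_def q'_def poly_monom poly_sum mult_ac)
      qed
      finally show ?thesis .
    qed
    moreover have "\<not> int p dvd coeff q s" if nz: "\<forall>j. Suc i < j \<and> j \<le> m \<longrightarrow> \<not> int p dvd v j"
    proof -
      have "coeff q s = g i * R (T i)" using cq'[of s] by (simp add: q_def)
      moreover have "\<not> int p dvd R (T i)"
      proof
        assume "int p dvd R (T i)"
        then obtain j where j: "j \<in> keys (T i) - {Suc i}" "int p dvd v j ^ lookup (T i) j"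
          using p by (auto simp: R_def prime_dvd_prod_iff)
        hence "int p dvd v j" using p prime_dvd_power[of "int p"] by auto
        moreover have "Suc i < j" "j \<le> m" using j(1) by (auto simp: in_keys_iff lT split: if_splits)
        ultimately show False using nz by blast
      qed
      ultimately show ?thesis using p ndvd[OF GH(4)[OF i]] by (simp add: prime_dvd_mult_iff)
    qed
    ultimately show ?thesis unfolding s_def by blast
  qed
  show ?thesis
  proof (rule that[of \<G> \<H>])
    show "triangular_system p m d \<G> \<H> (\<lambda>i. S $$ (i, Suc i))"
    proof
      show "prime p" by (rule p)
      fix v show "\<not> int p dvd \<G> m v" using ndvd[OF ab(1)] by (simp add: \<G>_def)
    next
      fix i v v' assume i: "i \<le> m" and vv: "\<And>j. i < j \<Longrightarrow> j \<le> m \<Longrightarrow> [v j = v' j] (mod int p)"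
      show "[\<G> i v = \<G> i v'] (mod int p)"
      proof (cases "i = m")
        case False
        hence "G i \<in> Fp_polys p {i+1..m}" using GH i by simp
        thus ?thesis using False vv by (auto simp: \<G>_def intro: mpoly_eval_cong)
      qed (simp add: \<G>_def)
      show "[\<H> i v = \<H> i v'] (mod int p)"
      proof (cases "i = m")
        case False
        hence "H i \<in> Fp_polys p {i+1..m}" using GH i by simp
        thus ?thesis using False vv by (auto simp: \<H>_def intro: mpoly_eval_cong)
      qed (simp add: \<H>_def)
    qed (use spos sd Gpoly in auto)
  next
    fix i v assume i: "i \<le> m"
    show "[mpoly_eval (F i) v = v i * \<G> i v + \<H> i v] (mod int p)"
    proof (cases "i = m")
      case True
      have "mpoly_eval (const a * X m + const b) v = v m * a + b"
        unfolding const_def X_def mpoly_eval_add mpoly_eval_single_mult mpoly_eval_single mX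
        by (simp add: mono_eval_def)
      thus ?thesis using mpoly_eval_poly_cong[OF ab(3), of v] True by (simp add: \<G>_def \<H>_def)
    next
      case False
      have "mpoly_eval (X i * G i + H i) v = v i * mpoly_eval (G i) v + mpoly_eval (H i) v"
        unfolding X_def mpoly_eval_add mpoly_eval_single_mult mX by simp
      thus ?thesis using mpoly_eval_poly_cong[OF GH(5), of i v] False i by (simp add: \<G>_def \<H>_def)
    qed
  qed (simp_all add: \<G>_def \<H>_def)
qed

section \<open>Sums along a sequence of distinct states\<close>

lemma periodic_sum_le:
  fixes z :: "nat \<Rightarrow> complex"
  assumes z: "\<And>n. norm (z n) \<le> 1" and t: "t > 0" "\<And>n. z (n + t) = z n"
    and block: "norm (\<Sum>n<t. z n) \<le> \<delta> * real t" and \<delta>: "\<delta> \<ge> 0"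
  shows "norm (\<Sum>n<N. z n) \<le> \<delta> * real N + real t"
proof (induction N rule: less_induct)
  case (less N)
  show ?case
  proof (cases "N < t")
    case True
    have "norm (\<Sum>n<N. z n) \<le> (\<Sum>n<N. 1)" by (rule order_trans[OF norm_sum sum_mono[OF z]])
    moreover have "0 \<le> \<delta> * real N" using \<delta> by simp
    ultimately show ?thesis using True by simp
  next
    case False
    define M where "M = N - t"
    have N: "N = t + M" using False by (simp add: M_def)
    have "(\<Sum>n<N. z n) = (\<Sum>n<t. z n) + (\<Sum>n<M. z (n + t))"
      unfolding N by (induction M) (simp_all add: add.commute algebra_simps)
    hence "norm (\<Sum>n<N. z n) \<le> norm (\<Sum>n<t. z n) + norm (\<Sum>n<M. z n)"
      by (simp add: t(2) norm_triangle_ineq)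
    also have "\<dots> \<le> \<delta> * real t + (\<delta> * real M + real t)"
      using less.IH[of M] N t block by (intro add_mono) auto
    also have "\<dots> = \<delta> * real N + real t" by (simp add: N algebra_simps)
    finally show ?thesis .
  qed
qed

context triangular_system
begin

text \<open>With \<open>K\<close> about \<open>p^(\<epsilon>/2)\<close>, the second term of the moment bound is of size \<open>p^(-\<epsilon>/2)\<close> because
\<open>N \<ge> p^(m+\<epsilon>)\<close>, and \<open>\<nu> \<ge> 2/\<epsilon>\<close> brings the first one below that. Taking the root of order
\<open>2\<nu>\<close> gives the exponent \<open>\<epsilon> / (4\<nu>)\<close>.\<close>

lemma sequence_asymptotic:
  fixes w :: "nat \<Rightarrow> nat \<Rightarrow> int" and \<epsilon> :: real
  assumes i: "i < m" and a: "\<And>j. j < i \<Longrightarrow> a j = 0" "\<not> int p dvd a i"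
    and \<epsilon>: "\<epsilon> > 0" and \<nu>: "2 / \<epsilon> \<le> real \<nu>" "\<nu> < p"
    and w: "\<And>n. w n \<in> V" "\<And>n. w (Suc n) = step (w n)" and inj: "inj_on w {..<N}"
    and N: "real p powr (real m + \<epsilon>) \<le> real N"
  shows "norm (\<Sum>n<N. echar p (phase a (w n)))
    \<le> (real \<nu> ^ \<nu> + 2 * real (m + 1) * real (d + 1) + 4) * real p powr (- (\<epsilon> / (4 * real \<nu>))) * real N"
proof -
  define q where "q = real p"
  define C where "C = real \<nu> ^ \<nu> + 2 * real (m + 1) * real (d + 1)"
  define K where "K = nat \<lceil>q powr (\<epsilon> / 2)\<rceil>"
  have q: "q > 1" using prime prime_gt_1_nat by (simp add: q_def)
  have \<nu>0: "real \<nu> > 0" using \<nu>(1) \<epsilon> by (smt (verit) divide_pos_pos)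
  have Nq: "q powr (real m + \<epsilon>) \<le> real N" using N by (simp add: q_def)
  have N0: "real N > 0" using Nq q by (smt (verit) powr_gt_zero)
  have m1: "real m \<ge> 1" using i by simp
  have q1: "q powr (\<epsilon> / 2) \<ge> 1" using q \<epsilon> by (intro ge_one_powr_ge_zero) auto
  have K: "q powr (\<epsilon> / 2) \<le> real K" "real K \<le> 2 * q powr (\<epsilon> / 2)" "K > 0"
    unfolding K_def using q1 by linarith+
  have C1: "C \<ge> 1"
  proof -
    have "1 * 1 \<le> real (m + 1) * real (d + 1)" by (intro mult_mono) auto
    thus ?thesis unfolding C_def using zero_le_power[of "real \<nu>" \<nu>] by linarith
  qed
  define \<gamma> where "\<gamma> = \<epsilon> / (4 * real \<nu>)"
  define x where "x = norm (\<Sum>n<N. echar p (phase a (w n))) / real N - 2 * real K / real N"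
  have x: "x \<le> C * q powr (- \<gamma>)"
  proof (rule ccontr)
    assume neg: "\<not> x \<le> C * q powr (- \<gamma>)"
    have C0: "0 < C * q powr (- \<gamma>)" using C1 q by simp
    hence x0: "x \<ge> 0" using neg by linarith
    have "x ^ (2 * \<nu>) \<le> real \<nu> ^ \<nu> * real p ^ (m + 1) / (real K ^ \<nu> * real N)
      + real (m + 1) * real (d + 1) * real K * real p ^ m / real N"
      by (rule sequence_bound[where a = a and w = w, OF i _ a(2) \<nu>(2) w inj _ K(3) x_def x0])
        (use a(1) N0 in auto)
    also have "real \<nu> ^ \<nu> * real p ^ (m + 1) / (real K ^ \<nu> * real N) \<le> real \<nu> ^ \<nu> * q powr (- (\<epsilon> / 2))"
    proof -
      have "q powr 1 \<le> q powr (\<epsilon> / 2 * real \<nu>)"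
        using q \<nu>(1) \<epsilon> by (intro powr_mono) (auto simp: field_simps)
      also have "\<dots> = (q powr (\<epsilon> / 2)) ^ \<nu>" using q by (simp add: powr_powr flip: powr_realpow)
      also have "\<dots> \<le> real K ^ \<nu>" using K by (intro power_mono) auto
      finally have Kq: "q powr 1 \<le> real K ^ \<nu>" .
      have "real p ^ (m + 1) = q powr (real m + 1)" using q by (simp add: q_def powr_add powr_realpow)
      also have "\<dots> = q powr 1 * q powr (real m + \<epsilon>) * q powr (- \<epsilon>)"
        by (simp only: powr_add[symmetric]) (simp add: add.commute)
      also have "\<dots> \<le> (real K ^ \<nu> * real N) * q powr (- (\<epsilon> / 2))"
        using Kq Nq q \<epsilon> by (intro mult_mono powr_mono) auto
      finally have "real p ^ (m + 1) / (real K ^ \<nu> * real N) \<le> q powr (- (\<epsilon> / 2))"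
        using K(3) N0 by (simp add: divide_le_eq mult.commute)
      hence "real \<nu> ^ \<nu> * (real p ^ (m + 1) / (real K ^ \<nu> * real N)) \<le> real \<nu> ^ \<nu> * q powr (- (\<epsilon> / 2))"
        by (rule mult_left_mono) simp
      thus ?thesis by simp
    qed
    also have "real (m + 1) * real (d + 1) * real K * real p ^ m / real N
      \<le> 2 * real (m + 1) * real (d + 1) * q powr (- (\<epsilon> / 2))"
    proof -
      have "real K * real p ^ m \<le> (2 * q powr (\<epsilon> / 2)) * q powr real m"
        using K q by (intro mult_mono) (auto simp: q_def powr_realpow)
      also have "\<dots> = 2 * (q powr (real m + \<epsilon>) * q powr (- (\<epsilon> / 2)))" by (simp flip: powr_add)
      also have "\<dots> \<le> 2 * (real N * q powr (- (\<epsilon> / 2)))" using Nq by (intro mult_left_mono mult_right_mono) auto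
      finally have "real K * real p ^ m / real N \<le> 2 * q powr (- (\<epsilon> / 2))"
        using N0 by (simp add: divide_le_eq mult_ac)
      hence "(real (m + 1) * real (d + 1)) * (real K * real p ^ m / real N) \<le> (real (m + 1) * real (d + 1)) * (2 * q powr (- (\<epsilon> / 2)))"
        by (rule mult_left_mono) simp
      thus ?thesis by (simp only: mult_ac times_divide_eq_right)
    qed
    finally have "x ^ (2 * \<nu>) \<le> C * q powr (- (\<epsilon> / 2))" by (simp add: C_def algebra_simps)
    moreover have "C * q powr (- (\<epsilon> / 2)) < x ^ (2 * \<nu>)"
    proof -
      have "(q powr (- \<gamma>)) ^ (2 * \<nu>) = q powr (- \<gamma> * real (2 * \<nu>))"
        using q by (simp add: powr_powr flip: powr_realpow)
      also have "- \<gamma> * real (2 * \<nu>) = - (\<epsilon> / 2)" using \<nu>0 by (simp add: \<gamma>_def field_simps)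
      finally have e: "(q powr (- \<gamma>)) ^ (2 * \<nu>) = q powr (- (\<epsilon> / 2))" .
      have "C ^ 1 \<le> C ^ (2 * \<nu>)" using C1 \<nu>0 by (intro power_increasing) auto
      hence "C * q powr (- (\<epsilon> / 2)) \<le> C ^ (2 * \<nu>) * q powr (- (\<epsilon> / 2))" by (intro mult_right_mono) auto
      also have "\<dots> = (C * q powr (- \<gamma>)) ^ (2 * \<nu>)" by (simp only: power_mult_distrib e)
      also have "\<dots> < x ^ (2 * \<nu>)"
        using neg C0 \<nu>0 by (intro power_strict_mono) auto
      finally show ?thesis .
    qed
    ultimately show False by linarith
  qed
  have "2 * real K / real N \<le> 4 * q powr (- \<gamma>)"
  proof -
    have "\<epsilon> * 1 \<le> \<epsilon> * (2 * real \<nu>)" using \<epsilon> \<nu>0 by (intro mult_left_mono) auto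
    hence g: "\<gamma> \<le> \<epsilon> / 2" using \<nu>0 by (simp add: \<gamma>_def field_simps)
    have "2 * real K \<le> 4 * q powr (\<epsilon> / 2)" using K by simp
    also have "\<dots> = 4 * (q powr (- (\<epsilon> / 2)) * q powr \<epsilon>)" by (simp flip: powr_add)
    also have "\<dots> \<le> 4 * (q powr (- \<gamma>) * q powr (real m + \<epsilon>))"
      using g q m1 by (intro mult_left_mono mult_mono powr_mono) auto
    also have "\<dots> \<le> 4 * (q powr (- \<gamma>) * real N)" using Nq by (intro mult_left_mono) auto
    finally show ?thesis using N0 by (simp add: divide_le_eq)
  qed
  hence "norm (\<Sum>n<N. echar p (phase a (w n))) / real N \<le> (C + 4) * q powr (- \<gamma>)"
    using x by (simp add: x_def algebra_simps)
  thus ?thesis using N0 by (simp add: divide_le_eq C_def q_def \<gamma>_def)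
qed

lemma card_last_coordinate:
  assumes w: "\<And>n. w n \<in> V" and inj: "inj_on w {..<N}"
  shows "N \<le> card ((\<lambda>n. w n m) ` {..<N}) * p ^ m"
proof -
  let ?Y = "(\<lambda>n. w n m) ` {..<N}"
  have "N = card (w ` {..<N})" by (simp add: card_image[OF inj])
  also have "\<dots> \<le> card {v \<in> V. v m \<in> ?Y}" using w by (intro card_mono) auto
  also have "\<dots> \<le> card ?Y * p ^ m"
    by (rule card_states_le[OF order_refl p0]) (auto intro!: card_mono)
  finally show ?thesis .
qed

text \<open>The last coordinate is an orbit of an affine map modulo \<open>p\<close>. Its values are \<open>N / p^m\<close> or more in
number, so the orbit is not constant and its period \<open>t\<close> is at least \<open>p^\<epsilon>\<close>. Over one period the sum
is complete: a sum over all residues if the multiplier is \<open>1\<close>, and a sum over a group of order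
\<open>t\<close> otherwise, to which the assumption \<open>gauss\<close> applies. An incomplete period costs
\<open>t \<le> p \<le> p^-\<epsilon> N\<close>.\<close>

lemma last_coordinate_bound:
  fixes w :: "nat \<Rightarrow> nat \<Rightarrow> int" and \<epsilon> \<gamma> :: real
  assumes a: "\<not> int p dvd a" and \<epsilon>: "\<epsilon> > 0" and m: "m \<ge> 1"
    and const: "\<And>v v'. G m v = G m v'" "\<And>v v'. H m v = H m v'"
    and w: "\<And>n. w n \<in> V" "\<And>n. w (Suc n) = step (w n)" and inj: "inj_on w {..<N}"
    and N: "real p powr (real m + \<epsilon>) \<le> real N"
    and gauss: "\<And>U b. U \<subseteq> {1..<int p} \<Longrightarrow> (\<forall>g\<in>U. \<forall>h\<in>U. g * h mod int p \<in> U) \<Longrightarrow>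
      real p powr \<epsilon> \<le> real (card U) \<Longrightarrow> \<not> int p dvd b \<Longrightarrow>
      norm (\<Sum>h\<in>U. echar p (b * h)) \<le> real p powr (- \<gamma>) * real (card U)"
  shows "norm (\<Sum>n<N. echar p (a * w n m)) \<le> (real p powr (- \<gamma>) + real p powr (- \<epsilon>)) * real N"
proof -
  define g where "g = G m (w 0)"
  define h where "h = H m (w 0)"
  define y where "y = (\<lambda>n. w n m)"
  define q where "q = real p"
  have q: "q > 1" using prime prime_gt_1_nat by (simp add: q_def)
  have Nq: "q powr (real m + \<epsilon>) \<le> real N" using N by (simp add: q_def)
  have N0: "real N > 0" using Nq q by (smt (verit) powr_gt_zero)
  have gp: "\<not> int p dvd g" unfolding g_def by (rule G_last)
  have yr: "y n \<in> {0..<int p}" for n unfolding y_def by (rule statesD[OF w(1)]) simp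
  have ystep: "[y (Suc n) = y n * g + h] (mod int p)" for n
    using step_cong[of m "w n"] const(1)[of "w n" "w 0"] const(2)[of "w n" "w 0"] by (simp add: y_def g_def h_def w(2))
  have Ybig: "q powr \<epsilon> \<le> real (card (y ` {..<N}))"
  proof -
    have "q powr real m * q powr \<epsilon> \<le> real N" using Nq by (simp add: powr_add)
    also have "\<dots> \<le> real (card (y ` {..<N})) * q powr real m"
      using card_last_coordinate[OF w(1) inj] q unfolding y_def q_def
      by (metis (no_types, lifting) of_nat_le_iff of_nat_mult of_nat_power powr_realpow p0 of_nat_0_less_iff)
    finally have "q powr real m * q powr \<epsilon> \<le> q powr real m * real (card (y ` {..<N}))" by (simp add: mult.commute)
    thus ?thesis using q by simp
  qed
  have nconst: False if "\<And>n. y n = y 0"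
  proof -
    have "y ` {..<N} \<subseteq> {y 0}" using that by blast
    hence "card (y ` {..<N}) \<le> 1" using card_mono[of "{y 0}"] by simp
    moreover have "q powr 0 < q powr \<epsilon>" using q \<epsilon> by (intro powr_less_mono) auto
    ultimately show False using Ybig q by simp
  qed
  have yeq: "y n = y n'" if "[y n = y n'] (mod int p)" for n n'
    using that yr[of n] yr[of n'] by (simp add: cong_def)
  have finish: ?thesis if t: "0 < t" "t \<le> p" "\<And>n. y (n + t) = y n"
      and b: "norm (\<Sum>n<t. echar p (a * y n)) \<le> q powr (- \<gamma>) * real t" for t
  proof -
    have "norm (\<Sum>n<N. echar p (a * y n)) \<le> q powr (- \<gamma>) * real N + real t"
      by (rule periodic_sum_le[OF _ t(1) _ b]) (auto simp: t(3))
    moreover have "real t \<le> q powr (- \<epsilon>) * real N"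
    proof -
      have "real t \<le> q powr 1" using t q by (simp add: q_def)
      also have "\<dots> \<le> q powr real m" using q m by (intro powr_mono) auto
      also have "\<dots> = q powr (- \<epsilon>) * q powr (real m + \<epsilon>)" by (simp flip: powr_add)
      also have "\<dots> \<le> q powr (- \<epsilon>) * real N" using Nq by (intro mult_left_mono) auto
      finally show ?thesis .
    qed
    ultimately show ?thesis by (simp add: y_def q_def algebra_simps)
  qed
  show ?thesis
  proof (cases "int p dvd g - 1")
    case True
    have ylin: "[y n = h * int n + y 0] (mod int p)" for n
    proof (induction n)
      case (Suc n)
      have "[g = 1] (mod int p)" using True by (simp add: cong_iff_dvd_diff)
      have "[y (Suc n) = y n * g + h] (mod int p)" by (rule ystep)
      also have "[y n * g + h = (h * int n + y 0) * 1 + h] (mod int p)"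
        using Suc \<open>[g = 1] (mod int p)\<close> by (intro cong_add cong_mult) auto
      finally show ?case by (simp add: algebra_simps)
    qed simp
    have hp: "\<not> int p dvd h"
    proof
      assume "int p dvd h"
      have "y n = y 0" for n
      proof (rule yeq)
        have "[h * int n + y 0 = 0 + y 0] (mod int p)"
          using \<open>int p dvd h\<close> by (intro cong_add) (auto simp: cong_0_iff)
        thus "[y n = y 0] (mod int p)" using ylin[of n] cong_trans by fastforce
      qed
      thus False by (rule nconst)
    qed
    show ?thesis
    proof (rule finish[of p])
      fix n
      have "[y (n + p) = h * int (n + p) + y 0] (mod int p)" by (rule ylin)
      also have "[h * int (n + p) + y 0 = h * int n + y 0] (mod int p)"
        by (intro cong_add) (auto simp: cong_iff_dvd_diff algebra_simps)
      also have "[h * int n + y 0 = y n] (mod int p)" by (rule cong_sym[OF ylin])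
      finally show "y (n + p) = y n" by (rule yeq)
    next
      have "(\<Sum>n<p. echar p (a * y n)) = (\<Sum>x\<in>{0..<int p}. echar p (a * h * x + a * y 0))"
      proof (rule sum.reindex_bij_witness[of _ nat int])
        fix n
        have "[a * (h * int n + y 0) = a * y n] (mod int p)" by (intro cong_mult cong_sym[OF ylin]) auto
        thus "echar p (a * h * int n + a * y 0) = echar p (a * y n)"
          by (intro echar_cong[OF _ p0]) (simp add: algebra_simps)
      qed auto
      also have "\<dots> = 0" using a hp prime by (simp add: sum_echar_linear[OF p0] prime_dvd_mult_iff)
      finally show "norm (\<Sum>n<p. echar p (a * y n)) \<le> q powr (- \<gamma>) * real p" by simp
    qed (use p0 in auto)
  next
    case False
    have pp: "prime (int p)" using prime by simp
    have "coprime (g - 1) (int p)" using False pp by (metis coprime_commute prime_imp_coprime)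
    then obtain r where r: "[(g - 1) * r = 1] (mod int p)" using cong_solve_coprime_int by blast
    \<comment> \<open>\<open>c\<close> is the fixed point of the affine map, so \<open>y n - c\<close> is a geometric progression.\<close>
    define c where "c = - h * r"
    have fixp: "[c * g + h = c] (mod int p)"
    proof -
      have "[h * ((g - 1) * r) = h * 1] (mod int p)" using r by (intro cong_mult) auto
      hence "int p dvd h * ((g - 1) * r) - h" by (simp add: cong_iff_dvd_diff)
      moreover have e: "c * g + h - c = - (h * ((g - 1) * r) - h)" by (simp add: c_def algebra_simps)
      ultimately show ?thesis unfolding cong_iff_dvd_diff e by (simp only: dvd_minus_iff)
    qed
    define e where "e = y 0 - c"
    have ygeo: "[y n = e * g ^ n + c] (mod int p)" for n
    proof (induction n)
      case 0 show ?case by (simp add: e_def)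
    next
      case (Suc n)
      have "[y (Suc n) = y n * g + h] (mod int p)" by (rule ystep)
      also have "[y n * g + h = (e * g ^ n + c) * g + h] (mod int p)" using Suc by (intro cong_add cong_mult) auto
      also have "(e * g ^ n + c) * g + h = e * g ^ Suc n + (c * g + h)" by (simp add: algebra_simps)
      also have "[e * g ^ Suc n + (c * g + h) = e * g ^ Suc n + c] (mod int p)" using fixp by (intro cong_add) auto
      finally show ?case .
    qed
    have ep: "\<not> int p dvd e"
    proof
      assume "int p dvd e"
      have "y n = y 0" for n
      proof (rule yeq)
        have "[e * g ^ n + c = e * g ^ 0 + c] (mod int p)"
          using \<open>int p dvd e\<close> by (intro cong_add) (auto simp: cong_iff_dvd_diff)
        thus "[y n = y 0] (mod int p)" using ygeo[of n] ygeo[of 0] by (meson cong_sym cong_trans)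
      qed
      thus False by (rule nconst)
    qed
    have ng: "\<not> int p dvd g ^ n" for n using gp pp prime_dvd_power by blast
    have pow_inj: "inj_on (\<lambda>n. g ^ n mod int p) {..<M}"
      if no: "\<And>r. 0 < r \<Longrightarrow> r < M \<Longrightarrow> \<not> [g ^ r = 1] (mod int p)" for M
    proof (rule linorder_inj_onI)
      fix k l assume kl: "k < l" "k \<in> {..<M}" "l \<in> {..<M}"
      show "g ^ k mod int p \<noteq> g ^ l mod int p"
      proof
        assume "g ^ k mod int p = g ^ l mod int p"
        hence "int p dvd g ^ l - g ^ k" by (metis mod_eq_dvd_iff)
        moreover have "g ^ l = g ^ k * g ^ (l - k)" using kl by (simp flip: power_add)
        ultimately have "int p dvd g ^ k * (g ^ (l - k) - 1)" by (simp add: algebra_simps)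
        hence "int p dvd g ^ (l - k) - 1" using pp ng[of k] by (simp add: prime_dvd_mult_iff)
        hence "[g ^ (l - k) = 1] (mod int p)" by (simp add: cong_iff_dvd_diff)
        moreover have "0 < l - k" "l - k < M" using kl by auto
        ultimately show False using no by blast
      qed
    qed auto
    have "\<exists>r>0. r < Suc p \<and> [g ^ r = 1] (mod int p)"
    proof (rule ccontr)
      assume "\<not> ?thesis"
      hence "inj_on (\<lambda>n. g ^ n mod int p) {..<Suc p}" by (intro pow_inj) blast
      hence "card {..<Suc p} \<le> card {0..<int p}" using p0 by (intro card_inj_on_le) auto
      thus False by simp
    qed
    then obtain r where r: "0 < r" "r \<le> p" "[g ^ r = 1] (mod int p)" by auto
    hence ex: "0 < r \<and> [g ^ r = 1] (mod int p)" by blast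
    \<comment> \<open>\<open>t\<close> is the multiplicative order of \<open>g\<close>, which exists because two of the first \<open>p + 1\<close>
      powers coincide.\<close>
    define t where "t = (LEAST t. 0 < t \<and> [g ^ t = 1] (mod int p))"
    have t: "0 < t" "[g ^ t = 1] (mod int p)" unfolding t_def
      using LeastI[of "\<lambda>t. 0 < t \<and> [g ^ t = 1] (mod int p)", OF ex] by auto
    have tp: "t \<le> p"
      using Least_le[of "\<lambda>t. 0 < t \<and> [g ^ t = 1] (mod int p)", OF ex] r(2) by (simp add: t_def)
    have tmin: "t \<le> k" if "0 < k" "[g ^ k = 1] (mod int p)" for k unfolding t_def using that by (intro Least_le) auto
    have gper: "[g ^ (n + t) = g ^ n] (mod int p)" for n
      using cong_mult[OF cong_refl[of "g ^ n"] t(2)] by (simp add: power_add)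
    have gmod: "[g ^ n = g ^ (n mod t)] (mod int p)" for n
    proof (induction n rule: less_induct)
      case (less n)
      show ?case
      proof (cases "n < t")
        case False
        hence "[g ^ (n - t) = g ^ ((n - t) mod t)] (mod int p)" using t by (intro less) auto
        moreover have "[g ^ n = g ^ (n - t)] (mod int p)" using gper[of "n - t"] False by simp
        ultimately show ?thesis using False by (metis cong_trans le_mod_geq not_less)
      qed simp
    qed
    define U where "U = (\<lambda>n. g ^ n mod int p) ` {..<t}"
    have injU: "inj_on (\<lambda>n. g ^ n mod int p) {..<t}"
      using tmin by (intro pow_inj) (metis not_less)
    have cU: "card U = t" unfolding U_def by (simp add: card_image[OF injU])
    have U1: "U \<subseteq> {1..<int p}"
    proof
      fix z assume "z \<in> U"
      then obtain n where n: "z = g ^ n mod int p" by (auto simp: U_def)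
      have "z \<noteq> 0" using ng[of n] n by (auto simp: mod_eq_0_iff_dvd)
      moreover have "0 \<le> z" "z < int p" using n p0 by simp_all
      ultimately show "z \<in> {1..<int p}" by simp
    qed
    have Umem: "g ^ n mod int p \<in> U" for n
      using gmod[of n] t unfolding U_def cong_def by (intro image_eqI[of _ _ "n mod t"]) auto
    have U2: "\<forall>z\<in>U. \<forall>z'\<in>U. z * z' mod int p \<in> U"
    proof (intro ballI)
      fix z z' assume "z \<in> U" "z' \<in> U"
      then obtain k l where "z = g ^ k mod int p" "z' = g ^ l mod int p" by (auto simp: U_def)
      hence "z * z' mod int p = g ^ (k + l) mod int p" by (simp add: mod_mult_eq power_add)
      thus "z * z' mod int p \<in> U" using Umem by simp
    qed
    have yper: "y (n + t) = y n" for n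
    proof (rule yeq)
      have "[e * g ^ (n + t) + c = e * g ^ n + c] (mod int p)" by (intro cong_add cong_mult gper) auto
      thus "[y (n + t) = y n] (mod int p)" using ygeo by (meson cong_sym cong_trans)
    qed
    have "card (y ` {..<N}) \<le> t"
    proof -
      have "y n = y (n mod t)" for n
      proof (induction n rule: less_induct)
        case (less n)
        show ?case
        proof (cases "n < t")
          case False
          hence "y (n - t) = y ((n - t) mod t)" using t by (intro less) auto
          moreover have "y n = y (n - t)" using yper[of "n - t"] False by simp
          ultimately show ?thesis using False by (metis le_mod_geq not_less)
        qed simp
      qed
      hence "y ` {..<N} \<subseteq> y ` {..<t}" using t by (metis image_subsetI imageI lessThan_iff mod_less_divisor)
      hence "card (y ` {..<N}) \<le> card (y ` {..<t})" by (intro card_mono) auto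
      also have "\<dots> \<le> t" using card_image_le[of "{..<t}" y] by simp
      finally show ?thesis .
    qed
    hence "q powr \<epsilon> \<le> real (card U)" using Ybig cU by linarith
    hence gs: "norm (\<Sum>z\<in>U. echar p (a * e * z)) \<le> q powr (- \<gamma>) * real t"
      using gauss[OF U1 U2, of "a * e"] a ep pp by (simp add: q_def cU prime_dvd_mult_iff)
    have "(\<Sum>n<t. echar p (a * y n)) = (\<Sum>n<t. echar p (a * c) * echar p (a * e * (g ^ n mod int p)))"
    proof (intro sum.cong refl)
      fix n
      have "[a * y n = a * (e * (g ^ n mod int p) + c)] (mod int p)"
      proof (intro cong_mult cong_refl cong_trans[OF ygeo])
        show "[e * g ^ n + c = e * (g ^ n mod int p) + c] (mod int p)" by (intro cong_add cong_mult) auto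
      qed
      hence "echar p (a * y n) = echar p (a * (e * (g ^ n mod int p) + c))" by (rule echar_cong[OF _ p0])
      also have "a * (e * (g ^ n mod int p) + c) = a * c + a * e * (g ^ n mod int p)" by (simp add: algebra_simps)
      finally show "echar p (a * y n) = echar p (a * c) * echar p (a * e * (g ^ n mod int p))" by (simp add: echar_add)
    qed
    also have "\<dots> = echar p (a * c) * (\<Sum>z\<in>U. echar p (a * e * z))"
      unfolding U_def by (simp add: sum.reindex[OF injU] sum_distrib_left)
    finally have "norm (\<Sum>n<t. echar p (a * y n)) \<le> q powr (- \<gamma>) * real t"
      using gs by (simp add: norm_mult)
    thus ?thesis by (rule finish[OF t(1) tp yper])
  qed
qed

end

section \<open>The discrepancy bound\<close>

theorem corollary7:
  fixes m d :: nat and \<epsilon> :: real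
  assumes "m \<ge> 1" and "d \<ge> 2" and "\<epsilon> > 0"
  shows "\<exists>\<gamma>>0. \<exists>C::real.
    \<forall>(p::nat) (S::nat mat) (F::nat \<Rightarrow> int_mpoly) (w::nat \<Rightarrow> nat \<Rightarrow> int) (\<tau>::nat) (N::nat).
      prime p \<longrightarrow>
      exponent_matrix m S \<longrightarrow>
      (\<Prod>i<m. S $$ (i, i + 1)) \<noteq> 0 \<longrightarrow>
      F \<in> poly_systems p S m \<longrightarrow>
      system_deg m F = ereal (real d) \<longrightarrow>
      generated_by p m F w \<longrightarrow>
      purely_periodic w \<tau> \<longrightarrow>
      0 < N \<longrightarrow> N \<le> \<tau> \<longrightarrow> real p powr (real m + \<epsilon>) \<le> real N \<longrightarrow>
      discrepancy (m + 1) N (\<lambda>n k. real_of_int (w n k) / real p) \<le> C * real p powr (- \<gamma>)"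
proof -
  note \<epsilon> = \<open>\<epsilon> > 0\<close>
  obtain \<gamma>0 P0 where \<gamma>0: "\<gamma>0 > 0" and bgk: "\<And>(p::nat) H a. prime p \<Longrightarrow> P0 \<le> real p \<Longrightarrow> H \<subseteq> {1..<int p} \<Longrightarrow>
    (\<forall>g\<in>H. \<forall>h\<in>H. g * h mod int p \<in> H) \<Longrightarrow> real p powr \<epsilon> \<le> real (card H) \<Longrightarrow> \<not> int p dvd a \<Longrightarrow>
    norm (char_sum p H a) \<le> real p powr (- \<gamma>0) * real (card H)"
    using subgroup_exponential_sum[OF \<epsilon>] by metis
  define \<nu> where "\<nu> = nat \<lceil>2 / \<epsilon>\<rceil>"
  have \<nu>: "2 / \<epsilon> \<le> real \<nu>" unfolding \<nu>_def by (rule real_nat_ceiling_ge)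
  have \<nu>0: "real \<nu> > 0" using \<nu> \<epsilon> by (smt (verit) divide_pos_pos)
  define \<gamma>1 where "\<gamma>1 = min (min (\<epsilon> / (4 * real \<nu>)) \<gamma>0) (min \<epsilon> 1)"
  have \<gamma>1: "\<gamma>1 > 0" "\<gamma>1 \<le> \<epsilon> / (4 * real \<nu>)" "\<gamma>1 \<le> \<gamma>0" "\<gamma>1 \<le> \<epsilon>" "\<gamma>1 \<le> 1"
    using \<epsilon> \<nu>0 \<gamma>0 by (auto simp: \<gamma>1_def)
  define C0 where "C0 = real \<nu> ^ \<nu> + 2 * real (m + 1) * real (d + 1) + 4"
  \<comment> \<open>Primes below \<open>P1\<close> are covered by the trivial bound for the sums, at the price of the
    constant \<open>P1 powr \<gamma>1\<close>.\<close>
  define P1 where "P1 = max P0 (real \<nu> + 1)"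
  define C1 where "C1 = max C0 (P1 powr \<gamma>1)"
  have P1: "P1 \<ge> 1" using \<nu>0 by (simp add: P1_def)
  have C0: "C0 \<ge> 2"
  proof -
    have "0 \<le> real \<nu> ^ \<nu>" "0 \<le> 2 * real (m + 1) * real (d + 1)" by simp_all
    thus ?thesis unfolding C0_def by linarith
  qed
  hence C1: "C1 \<ge> 2" by (simp add: C1_def)
  define s where "s = m + 1"
  \<comment> \<open>Half of the saving pays for the power of the logarithm, through \<open>ln p \<le> p^\<beta> / \<beta>\<close>.\<close>
  define \<beta> where "\<beta> = \<gamma>1 / (2 * real s)"
  have \<beta>: "\<beta> > 0" using \<gamma>1 by (simp add: \<beta>_def s_def)
  define C where "C = C1 * (3 + 2 / \<beta>) ^ s + real s"
  show ?thesis
  proof (rule exI[of _ "\<gamma>1 / 2"], intro conjI, use \<gamma>1 in simp, rule exI[of _ C], intro allI impI)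
    fix p :: nat and S F w \<tau> N
    assume p: "prime p" and "exponent_matrix m S" and S: "(\<Prod>i<m. S $$ (i, i + 1)) \<noteq> 0"
      and F: "F \<in> poly_systems p S m" and deg: "system_deg m F = ereal (real d)"
      and gen: "generated_by p m F w" and per: "purely_periodic w \<tau>"
      and N: "0 < N" "N \<le> \<tau>" "real p powr (real m + \<epsilon>) \<le> real N"
    have p1: "real p > 1" "p > 0" using prime_gt_1_nat[OF p] by auto
    obtain G H where sys: "triangular_system p m d G H (\<lambda>i. S $$ (i, Suc i))"
      and FG: "\<And>i v. i \<le> m \<Longrightarrow> [mpoly_eval (F i) v = v i * G i v + H i v] (mod int p)"
      and const: "\<And>v v'. G m v = G m v'" "\<And>v v'. H m v = H m v'"
      using poly_system_triangular[OF p S F deg] by blast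
    interpret triangular_system p m d G H "\<lambda>i. S $$ (i, Suc i)" by (rule sys)
    have wV: "w n \<in> V" for n using gen by (simp add: generated_by_def states_def)
    have wstep: "w (Suc n) = step (w n)" for n
    proof (rule PiE_ext[of _ "{..m}" "\<lambda>_. {0..<int p}"])
      show "w (Suc n) \<in> {..m} \<rightarrow>\<^sub>E {0..<int p}" "step (w n) \<in> {..m} \<rightarrow>\<^sub>E {0..<int p}"
        using wV step_states by (simp_all add: states_def)
      fix i assume i: "i \<in> {..m}"
      have "[w (Suc n) i = mpoly_eval (F i) (w n)] (mod int p)" using gen i by (simp add: generated_by_def)
      also have "[mpoly_eval (F i) (w n) = w n i * G i (w n) + H i (w n)] (mod int p)" using FG i by simp
      also have "[w n i * G i (w n) + H i (w n) = step (w n) i] (mod int p)"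
        using step_cong[of i "w n"] i by (simp add: cong_sym)
      finally have "w (Suc n) i mod int p = step (w n) i mod int p" by (simp add: cong_def)
      moreover have "w (Suc n) i \<in> {0..<int p}" "step (w n) i \<in> {0..<int p}"
        using statesD[OF wV] statesD[OF step_states] i by simp_all
      ultimately show "w (Suc n) i = step (w n) i" by simp
    qed
    have inj: "inj_on w {..<N}"
    proof (rule linorder_inj_onI)
      fix k l assume kl: "k < l" "k \<in> {..<N}" "l \<in> {..<N}"
      show "w k \<noteq> w l"
      proof
        assume eq: "w k = w l"
        have up: "w (k + n) = w (l + n)" for n by (induction n) (simp_all add: eq wstep)
        have mult: "w (n + c * \<tau>) = w n" for n c
          using per by (induction c) (simp_all add: purely_periodic_def add.assoc[symmetric] add.commute[of \<tau>])
        \<comment> \<open>Pure periodicity moves \<open>n\<close> beyond \<open>k\<close>, where \<open>l - k\<close> is a period.\<close>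
        have "w (n + (l - k)) = w n" for n
        proof -
          have \<tau>: "\<tau> > 0" using per by (simp add: purely_periodic_def)
          define M where "M = k * \<tau>"
          have kM: "k \<le> M" using \<tau> by (simp add: M_def)
          have "w (n + (l - k)) = w (n + (l - k) + M)" unfolding M_def by (rule mult[symmetric])
          also have "n + (l - k) + M = l + (n + (M - k))" using kl(1) kM by simp
          also have "w \<dots> = w (k + (n + (M - k)))" by (rule up[symmetric])
          also have "k + (n + (M - k)) = n + M" using kM by simp
          also have "w \<dots> = w n" unfolding M_def by (rule mult)
          finally show ?thesis .
        qed
        hence "\<tau> \<le> l - k" using per kl by (simp add: purely_periodic_def)
        thus False using kl N by simp
      qed
    qed auto
    define \<eta> where "\<eta> = C1 * real p powr (- \<gamma>1)"
    have \<eta>: "\<eta> \<ge> 0" using C1 by (simp add: \<eta>_def)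
    have sums: "norm (\<Sum>n<N. echar p (\<Sum>k<m + 1. a k * w n k)) \<le> \<eta> * real N"
      if a: "a \<in> {..<m + 1} \<rightarrow>\<^sub>E {0..<int p}" and nz: "\<exists>k<m + 1. a k \<noteq> 0" for a
    proof -
      have ph: "(\<Sum>k<m + 1. a k * w n k) = phase a (w n)" for n
        by (simp add: phase_def lessThan_Suc_atMost)
      show ?thesis
      proof (cases "P1 \<le> real p")
        case False
        have "norm (\<Sum>n<N. echar p (\<Sum>k<m + 1. a k * w n k)) \<le> real N"
          by (rule order_trans[OF norm_sum]) simp
        moreover have "1 \<le> \<eta>"
        proof -
          have "real p powr \<gamma>1 \<le> P1 powr \<gamma>1" using False \<gamma>1 by (intro powr_mono2) auto
          also have "\<dots> \<le> C1" by (simp add: C1_def)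
          finally show ?thesis using p1 by (simp add: \<eta>_def powr_minus field_simps)
        qed
        hence "1 * real N \<le> \<eta> * real N" by (intro mult_right_mono) auto
        ultimately show ?thesis by linarith
      next
        case True
        define i where "i = (LEAST k. a k \<noteq> 0)"
        have ai: "a i \<noteq> 0" unfolding i_def by (rule LeastI_ex) (use nz in blast)
        have im: "i \<le> m"
        proof -
          from nz obtain k where k: "k < m + 1" "a k \<noteq> 0" by blast
          have "i \<le> k" unfolding i_def using k(2) by (rule Least_le)
          thus ?thesis using k by simp
        qed
        have a0: "a j = 0" if "j < i" for j using not_less_Least[OF that[unfolded i_def]] by simp
        have nd: "\<not> int p dvd a i"
        proof -
          have "a i \<in> {0..<int p}" using PiE_mem[OF a, of i] im by simp
          hence "0 < a i" "a i < int p" using ai by simp_all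
          thus ?thesis by (rule zdvd_not_zless)
        qed
        show ?thesis
        proof (cases "i < m")
          case True
          have "norm (\<Sum>n<N. echar p (phase a (w n))) \<le> C0 * real p powr (- (\<epsilon> / (4 * real \<nu>))) * real N"
            unfolding C0_def
          proof (rule sequence_asymptotic[where a = a and w = w, OF True _ nd \<epsilon> \<nu> _ wV wstep inj N(3)])
            show "\<nu> < p" using \<open>P1 \<le> real p\<close> by (simp add: P1_def)
          qed (rule a0)
          also have "\<dots> \<le> C1 * real p powr (- \<gamma>1) * real N"
            using \<gamma>1 p1 C0 by (intro mult_right_mono mult_mono powr_mono) (auto simp: C1_def)
          finally show ?thesis by (simp only: ph \<eta>_def)
        next
          case False
          hence i: "i = m" using im by simp
          have "norm (\<Sum>n<N. echar p (a m * w n m)) \<le> (real p powr (- \<gamma>0) + real p powr (- \<epsilon>)) * real N"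
          proof (rule last_coordinate_bound[OF _ \<epsilon> \<open>m \<ge> 1\<close> const wV wstep inj N(3)])
            show "\<not> int p dvd a m" using nd i by simp
            fix U b
            assume "U \<subseteq> {1..<int p}" "\<forall>g\<in>U. \<forall>h\<in>U. g * h mod int p \<in> U"
              "real p powr \<epsilon> \<le> real (card U)" "\<not> int p dvd b"
            thus "norm (\<Sum>h\<in>U. echar p (b * h)) \<le> real p powr (- \<gamma>0) * real (card U)"
              using bgk[OF p, of U b] True by (simp add: char_sum_def P1_def)
          qed
          also have "real p powr (- \<gamma>0) + real p powr (- \<epsilon>) \<le> real p powr (- \<gamma>1) + real p powr (- \<gamma>1)"
            using \<gamma>1 p1 by (intro add_mono powr_mono) auto
          also have "\<dots> = 2 * real p powr (- \<gamma>1)" by simp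
          also have "\<dots> \<le> \<eta>" unfolding \<eta>_def using C1 by (intro mult_right_mono) auto
          finally have "norm (\<Sum>n<N. echar p (a m * w n m)) \<le> \<eta> * real N" by (simp add: mult_right_mono)
          moreover have "(\<Sum>k<m + 1. a k * w n k) = a m * w n m" for n
            using a0 i by simp
          ultimately show ?thesis by simp
        qed
      qed
    qed
    have "discrepancy (m + 1) N (\<lambda>n k. real_of_int (w n k) / real p)
      \<le> \<eta> * (3 + 2 * ln (real p)) ^ (m + 1) + real (m + 1) / real p"
    proof (rule discrepancy_le[OF p1(2) N(1) _ sums \<eta>])
      show "w n k \<in> {0..<int p}" if "n < N" "k < m + 1" for n k
        using statesD[OF wV, of k n] that by simp
    qed
    also have "\<eta> * (3 + 2 * ln (real p)) ^ (m + 1) \<le> C1 * (3 + 2 / \<beta>) ^ s * real p powr (- (\<gamma>1 / 2))"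
    proof -
      have "1 \<le> real p powr \<beta>" using p1 \<beta> by (intro ge_one_powr_ge_zero) auto
      moreover have "ln (real p) \<le> real p powr \<beta> / \<beta>" using p1 \<beta> by (intro ln_powr_bound) auto
      ultimately have "3 + 2 * ln (real p) \<le> 3 * real p powr \<beta> + 2 * (real p powr \<beta> / \<beta>)" by linarith
      also have "\<dots> = (3 + 2 / \<beta>) * real p powr \<beta>" by (simp add: algebra_simps)
      finally have "(3 + 2 * ln (real p)) ^ s \<le> ((3 + 2 / \<beta>) * real p powr \<beta>) ^ s"
        using p1 by (intro power_mono) auto
      also have "\<dots> = (3 + 2 / \<beta>) ^ s * real p powr (\<beta> * real s)"
        using p1 by (simp add: power_mult_distrib powr_powr flip: powr_realpow)
      also have "\<beta> * real s = \<gamma>1 / 2"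
      proof -
        have "real s \<noteq> 0" by (simp add: s_def)
        thus ?thesis by (simp add: \<beta>_def)
      qed
      finally have "\<eta> * (3 + 2 * ln (real p)) ^ s \<le> \<eta> * ((3 + 2 / \<beta>) ^ s * real p powr (\<gamma>1 / 2))"
        using \<eta> by (rule mult_left_mono)
      also have "\<dots> = C1 * (3 + 2 / \<beta>) ^ s * (real p powr (- \<gamma>1) * real p powr (\<gamma>1 / 2))"
        by (simp add: \<eta>_def mult_ac)
      also have "real p powr (- \<gamma>1) * real p powr (\<gamma>1 / 2) = real p powr (- (\<gamma>1 / 2))"
        by (simp flip: powr_add)
      finally show ?thesis by (simp only: s_def)
    qed
    also have "real (m + 1) / real p \<le> real s * real p powr (- (\<gamma>1 / 2))"
    proof -
      have "real p powr (- 1) \<le> real p powr (- (\<gamma>1 / 2))" using \<gamma>1 p1 by (intro powr_mono) auto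
      hence "real s * real p powr (- 1) \<le> real s * real p powr (- (\<gamma>1 / 2))" by (intro mult_left_mono) auto
      thus ?thesis using p1 by (simp add: s_def powr_minus_divide)
    qed
    finally show "discrepancy (m + 1) N (\<lambda>n k. real_of_int (w n k) / real p) \<le> C * real p powr (- (\<gamma>1 / 2))"
      by (simp add: C_def algebra_simps)
  qed
qed

end
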